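(* For every integer $k$ with $0\le k\le r$, the following identity holds in the conormal Chow ring $A_{M,M^\perp}$: \[ \gamma^k\,\delta^{\,n-k-1}\;=\;\sum_{B} x_{\mathcal F^+(B)\,|\,\mathcal G^+(B)}, \] where the sum runs over all nbc bases $B$ of $M$ with $|\mathrm{IA}(B)|=k+1$.
   Context: Let $M$ be a matroid with no loops and no coloops on the ground set $E=\{0,1,\dots,n\}$, totally ordered by the usual order of integers, of rank $r+1$; its dual $M^\perp$ has rank $n-r$. Write $\mathrm{cl}$, $\mathrm{cl}^\perp$ for the closure operators of $M$, $M^\perp$. A biflat of $M$ is a pair $F|G$ where $F$ is a flat of $M$, $G$ is a flat of $M^\perp$, both are nonempty, they are not both equal to $E$, and $F\cup G=E$. Two biflats $F|G$, $F'|G'$ are compatible if ($F\subseteq F'$ and $G\supseteq G'$) or ($F\supseteq F'$ and $G\subseteq G'$). A biflag is a set $\mathcal F|\mathcal G$ of pairwise compatible biflats with $\bigcup_{F|G\in\mathcal F|\mathcal G}(F\cap G)\neq E$; its length is its number of biflats. The biflats of a biflag of length $m$ can be indexed $F_1|G_1,\dots,F_m|G_m$ with $F_1\subseteq\cdots\subseteq F_m$ and $G_1\supseteq\cdots\supseteq G_m$. Conormal Chow ring: let $S$ be the polynomial ring over $\mathbb R$ in variables $x_{F|G}$, one for each biflat $F|G$; for a set $\mathcal F|\mathcal G$ of biflats put $x_{\mathcal F|\mathcal G}=\prod_{F|G\in\mathcal F|\mathcal G}x_{F|G}$. For $i\in E$ let $\gamma_i=\sum_{i\in F,\,F\neq E}x_{F|G}$,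 $\bar\gamma_i=\sum_{i\in G,\,G\neq E}x_{F|G}$, $\delta_i=\sum_{i\in F\cap G}x_{F|G}$ (sums over biflats). Let $I$ be the ideal generated by the monomials $x_{\mathcal F|\mathcal G}$ for sets $\mathcal F|\mathcal G$ of biflats that are not biflags, and $J$ the ideal generated by all $\gamma_i-\gamma_j$ and $\bar\gamma_i-\bar\gamma_j$. The conormal Chow ring is $A_{M,M^\perp}=S/(I+J)$; the classes of $\gamma_i$ and of $\delta_i$ in it do not depend on $i$ and are denoted $\gamma$ and $\delta$. Activities: for a basis $B$ of $M$ and $i\in B$, let $C^\perp(B,i)$ be the unique cocircuit of $M$ contained in $(E-B)\cup i$ and containing $i$; for $i\notin B$ let $C(B,i)$ be the unique circuit contained in $B\cup i$ and containing $i$. $\mathrm{IA}(B)=\{i\in B: i=\min C^\perp(B,i)\}$ and $\mathrm{EA}(B)=\{i\notin B: i=\min C(B,i)\}$. $B$ is an nbc basis if $\mathrm{EA}(B)=\emptyset$. Extended nbc biflag: for an nbc basis $B$ with $|\mathrm{IA}(B)|=k+1$, write $\mathrm{IA}(B)=\{c_1>\cdots>c_{k+1}\}$, $S_B=B-\mathrm{IA}(B)=\{e_1>\cdots>e_{r-k}\}$, and $T_B=(E-B)-\min(E-B)=\{e_{r-k+1}<\cdots<e_{n-k-1}\}$. Let $i$ be the smallest index with $\mathrm{cl}(S_B\cup\{c_1,\dots,c_i\})\cup\mathrm{cl}^\perp(T_B)=E$. Then $\mathcal F^+(B)|\mathcal G^+(B)$ is the biflag of length $n-1$ with biflats $F^+_j|G^+_j$,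 $1\le j\le n-1$, given by: $\mathrm{cl}\{e_1,\dots,e_j\}\,|\,E$ for $1\le j\le r-k$; $\mathrm{cl}(S_B\cup\{c_1,\dots,c_{j-(r-k)}\})\,|\,E$ for $1\le j-(r-k)\le i-1$; $\mathrm{cl}(S_B\cup\{c_1,\dots,c_{j-(r-k)}\})\,|\,\mathrm{cl}^\perp(T_B)$ for $i\le j-(r-k)\le k$; $E\,|\,\mathrm{cl}^\perp\{e_{j-k},e_{j-k+1},\dots,e_{n-k-1}\}$ for $r+1\le j\le n-1$. *)

theory Defs
  imports Complex_Main "HOL-Library.Poly_Mapping"
begin

definition matroid_bases :: "'a set \<Rightarrow> 'a set set \<Rightarrow> bool" where
  "matroid_bases E Bs \<longleftrightarrow> finite E \<and> Bs \<noteq> {} \<and> (\<forall>B\<in>Bs. B \<subseteq> E) \<and>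
     (\<forall>B1\<in>Bs. \<forall>B2\<in>Bs. \<forall>x\<in>B1 - B2. \<exists>y\<in>B2 - B1. insert y (B1 - {x}) \<in> Bs)"

definition indep :: "'a set set \<Rightarrow> 'a set \<Rightarrow> bool" where
  "indep Bs X \<longleftrightarrow> (\<exists>B\<in>Bs. X \<subseteq> B)"

definition mrank :: "'a set set \<Rightarrow> 'a set \<Rightarrow> nat" where
  "mrank Bs X = Max (card ` {I. I \<subseteq> X \<and> indep Bs I})"

definition mcl :: "'a set \<Rightarrow> 'a set set \<Rightarrow> 'a set \<Rightarrow> 'a set" where
  "mcl E Bs X = {e \<in> E. mrank Bs (insert e X) = mrank Bs X}"

definition flat :: "'a set \<Rightarrow> 'a set set \<Rightarrow> 'a set \<Rightarrow> bool" where
  "flat E Bs F \<longleftrightarrow> F \<subseteq> E \<and> mcl E Bs F = F"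

definition dual_bases :: "'a set \<Rightarrow> 'a set set \<Rightarrow> 'a set set" where
  "dual_bases E Bs = (\<lambda>B. E - B) ` Bs"

definition circuit :: "'a set \<Rightarrow> 'a set set \<Rightarrow> 'a set \<Rightarrow> bool" where
  "circuit E Bs C \<longleftrightarrow> C \<subseteq> E \<and> \<not> indep Bs C \<and> (\<forall>x\<in>C. indep Bs (C - {x}))"

definition cocircuit :: "'a set \<Rightarrow> 'a set set \<Rightarrow> 'a set \<Rightarrow> bool" where
  "cocircuit E Bs C \<longleftrightarrow> circuit E (dual_bases E Bs) C"

definition loop :: "'a set set \<Rightarrow> 'a \<Rightarrow> bool" where
  "loop Bs e \<longleftrightarrow> \<not> indep Bs {e}"

definition coloop :: "'a set set \<Rightarrow> 'a \<Rightarrow> bool" where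
  "coloop Bs e \<longleftrightarrow> (\<forall>B\<in>Bs. e \<in> B)"

definition fund_circuit :: "'a set \<Rightarrow> 'a set set \<Rightarrow> 'a set \<Rightarrow> 'a \<Rightarrow> 'a set" where
  "fund_circuit E Bs B i = (THE C. circuit E Bs C \<and> C \<subseteq> insert i B \<and> i \<in> C)"

definition fund_cocircuit :: "'a set \<Rightarrow> 'a set set \<Rightarrow> 'a set \<Rightarrow> 'a \<Rightarrow> 'a set" where
  "fund_cocircuit E Bs B i = (THE C. cocircuit E Bs C \<and> C \<subseteq> insert i (E - B) \<and> i \<in> C)"

definition IA :: "nat set \<Rightarrow> nat set set \<Rightarrow> nat set \<Rightarrow> nat set" where
  "IA E Bs B = {i \<in> B. i = Min (fund_cocircuit E Bs B i)}"

definition EA :: "nat set \<Rightarrow> nat set set \<Rightarrow> nat set \<Rightarrow> nat set" where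
  "EA E Bs B = {i \<in> E - B. i = Min (fund_circuit E Bs B i)}"

definition nbc_basis :: "nat set \<Rightarrow> nat set set \<Rightarrow> nat set \<Rightarrow> bool" where
  "nbc_basis E Bs B \<longleftrightarrow> B \<in> Bs \<and> EA E Bs B = {}"

definition biflat :: "nat set \<Rightarrow> nat set set \<Rightarrow> nat set \<times> nat set \<Rightarrow> bool" where
  "biflat E Bs FG \<longleftrightarrow> (case FG of (F, G) \<Rightarrow>
     flat E Bs F \<and> flat E (dual_bases E Bs) G \<and> F \<noteq> {} \<and> G \<noteq> {} \<and>
     \<not> (F = E \<and> G = E) \<and> F \<union> G = E)"

definition compatible :: "nat set \<times> nat set \<Rightarrow> nat set \<times> nat set \<Rightarrow> bool" where
  "compatible FG FG' \<longleftrightarrow> (case FG of (F, G) \<Rightarrow> case FG' of (F', G') \<Rightarrow>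
     (F \<subseteq> F' \<and> G' \<subseteq> G) \<or> (F' \<subseteq> F \<and> G \<subseteq> G'))"

definition biflag :: "nat set \<Rightarrow> nat set set \<Rightarrow> (nat set \<times> nat set) set \<Rightarrow> bool" where
  "biflag E Bs S \<longleftrightarrow> (\<forall>FG\<in>S. biflat E Bs FG) \<and> (\<forall>FG\<in>S. \<forall>FG'\<in>S. compatible FG FG') \<and>
     (\<Union>(F, G)\<in>S. F \<inter> G) \<noteq> E"

text \<open>Polynomials over the reals in variables indexed by pairs of sets
  (only the variables indexed by biflats are used).\<close>
type_synonym cpoly = "((nat set \<times> nat set) \<Rightarrow>\<^sub>0 nat) \<Rightarrow>\<^sub>0 real"

definition var :: "nat set \<times> nat set \<Rightarrow> cpoly" where
  "var FG = Poly_Mapping.single (Poly_Mapping.single FG 1) 1"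

definition xmon :: "(nat set \<times> nat set) set \<Rightarrow> cpoly" where
  "xmon S = (\<Prod>FG\<in>S. var FG)"

definition biflats :: "nat set \<Rightarrow> nat set set \<Rightarrow> (nat set \<times> nat set) set" where
  "biflats E Bs = {FG. biflat E Bs FG}"

definition gamma :: "nat set \<Rightarrow> nat set set \<Rightarrow> nat \<Rightarrow> cpoly" where
  "gamma E Bs i = (\<Sum>FG\<in>{(F, G) \<in> biflats E Bs. i \<in> F \<and> F \<noteq> E}. var FG)"

definition gammabar :: "nat set \<Rightarrow> nat set set \<Rightarrow> nat \<Rightarrow> cpoly" where
  "gammabar E Bs i = (\<Sum>FG\<in>{(F, G) \<in> biflats E Bs. i \<in> G \<and> G \<noteq> E}. var FG)"

definition delta :: "nat set \<Rightarrow> nat set set \<Rightarrow> nat \<Rightarrow> cpoly" where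
  "delta E Bs i = (\<Sum>FG\<in>{(F, G) \<in> biflats E Bs. i \<in> F \<inter> G}. var FG)"

definition gen_ideal :: "cpoly set \<Rightarrow> cpoly set" where
  "gen_ideal P = {p. \<exists>A c. finite A \<and> A \<subseteq> P \<and> p = (\<Sum>g\<in>A. c g * g)}"

definition chow_relations :: "nat set \<Rightarrow> nat set set \<Rightarrow> cpoly set" where
  "chow_relations E Bs =
     {xmon S | S. S \<subseteq> biflats E Bs \<and> \<not> biflag E Bs S}
     \<union> {gamma E Bs i - gamma E Bs j | i j. i \<in> E \<and> j \<in> E}
     \<union> {gammabar E Bs i - gammabar E Bs j | i j. i \<in> E \<and> j \<in> E}"

definition chow_eq :: "nat set \<Rightarrow> nat set set \<Rightarrow> cpoly \<Rightarrow> cpoly \<Rightarrow> bool" where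
  "chow_eq E Bs p q \<longleftrightarrow> p - q \<in> gen_ideal (chow_relations E Bs)"

definition nth_largest :: "nat set \<Rightarrow> nat \<Rightarrow> nat" where
  "nth_largest X j = rev (sorted_list_of_set X) ! (j - 1)"

definition nth_smallest :: "nat set \<Rightarrow> nat \<Rightarrow> nat" where
  "nth_smallest X j = sorted_list_of_set X ! (j - 1)"

text \<open>Here r+1 is the rank of M. S_B, T_B, c_j and e_j as in the paper.\<close>
definition SB :: "nat set \<Rightarrow> nat set set \<Rightarrow> nat set \<Rightarrow> nat set" where
  "SB E Bs B = B - IA E Bs B"

definition TB :: "nat set \<Rightarrow> nat set \<Rightarrow> nat set" where
  "TB E B = (E - B) - {Min (E - B)}"

definition cB :: "nat set \<Rightarrow> nat set set \<Rightarrow> nat set \<Rightarrow> nat \<Rightarrow> nat" where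
  "cB E Bs B j = nth_largest (IA E Bs B) j"

definition eB :: "nat set \<Rightarrow> nat set set \<Rightarrow> nat \<Rightarrow> nat \<Rightarrow> nat set \<Rightarrow> nat \<Rightarrow> nat" where
  "eB E Bs r k B j = (if j \<le> r - k then nth_largest (SB E Bs B) j
                      else nth_smallest (TB E B) (j - (r - k)))"

definition iB :: "nat set \<Rightarrow> nat set set \<Rightarrow> nat set \<Rightarrow> nat" where
  "iB E Bs B = (LEAST i. mcl E Bs (SB E Bs B \<union> {cB E Bs B m | m. 1 \<le> m \<and> m \<le> i})
                          \<union> mcl E (dual_bases E Bs) (TB E B) = E)"

definition ext_biflat :: "nat set \<Rightarrow> nat set set \<Rightarrow> nat \<Rightarrow> nat \<Rightarrow> nat \<Rightarrow> nat set \<Rightarrow> nat \<Rightarrow> nat set \<times> nat set" where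
  "ext_biflat E Bs n r k B j =
    (if j \<le> r - k then (mcl E Bs {eB E Bs r k B m | m. 1 \<le> m \<and> m \<le> j}, E)
     else if j \<le> r then
       (let F = mcl E Bs (SB E Bs B \<union> {cB E Bs B m | m. 1 \<le> m \<and> m \<le> j - (r - k)}) in
        if j - (r - k) \<le> iB E Bs B - 1 then (F, E)
        else (F, mcl E (dual_bases E Bs) (TB E B)))
     else (E, mcl E (dual_bases E Bs) {eB E Bs r k B m | m. j - k \<le> m \<and> m \<le> n - k - 1}))"

definition ext_nbc_biflag :: "nat set \<Rightarrow> nat set set \<Rightarrow> nat \<Rightarrow> nat \<Rightarrow> nat \<Rightarrow> nat set \<Rightarrow> (nat set \<times> nat set) set" where
  "ext_nbc_biflag E Bs n r k B = ext_biflat E Bs n r k B ` {1..n - 1}"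

end

theory Submission
  imports Defs
begin

text \<open>
Expand \<open>\<delta>^(n - k - 1)\<close> one factor at a time, writing \<open>\<delta> = \<delta>\<^sub>e\<close> where \<open>e\<close> is the largest element of \<open>E\<close>
not covered by the sets \<open>F \<inter> G\<close> of the biflats chosen so far. Every monomial containing a biflat
\<open>F|G\<close> with \<open>F \<noteq> E\<close> of corank at most \<open>k\<close> is killed by \<open>\<gamma>^k\<close>. If \<open>S\<close> and \<open>T\<close> are the elements
\<open>e\<close> chosen so far for biflats \<open>F|E\<close> and \<open>E|G\<close>, then modulo such monomials only two new biflats
contribute: \<open>cl (S \<union> e)|E\<close> and \<open>E|cl\<^sup>\<bottom> (T \<union> e)\<close>.
To see this, count the values of the strictly increasing function \<open>rk F + cork\<^sup>\<bottom> G\<close> on a biflag,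
corrected for the jump by \<open>k + 1\<close> at \<open>F = E\<close>: at full length exactly one value is omitted, and it
is omitted where the uncovered elements are. For any other new biflat a second value is omitted. This
is clear for \<open>F|E\<close> and \<open>E|G\<close>. For \<open>F|G\<close> with \<open>F, G \<noteq> E\<close>, orthogonality of circuits and cocircuits
shows that \<open>F\<close> is not spanned by \<open>S \<union> (E - G)\<close> or \<open>G\<close> is not spanned in the dual by \<open>T \<union> (E - F)\<close>;
in the first case one chooses \<open>e\<close> in \<open>E - G\<close> as long as possible, in the second case in \<open>E - F\<close>.

The pairs \<open>(S, T)\<close> that survive to the end correspond to the nbc bases \<open>B\<close> with \<open>k + 1\<close> internally active
elements: \<open>S = S\<^sub>B\<close>, \<open>T = T\<^sub>B\<close>, and the next largest uncovered element is \<open>min (E - B)\<close>.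
Finally, \<open>\<gamma>\<close> being represented by \<open>\<gamma>\<^sub>c\<close> for \<open>c = c\<^sub>1, \<dots>, c\<^sub>k\<close> in turn, multiplication by \<open>\<gamma>^k\<close> adds
to such a monomial exactly the missing biflats of the extended nbc biflag.
\<close>

section \<open>Matroids given by their bases\<close>

locale matroid =
  fixes E :: "'a set" and Bs :: "'a set set"
  assumes matroid_bases: "matroid_bases E Bs"
begin

abbreviation "ind \<equiv> indep Bs"
abbreviation "rk \<equiv> mrank Bs"
abbreviation "cl \<equiv> mcl E Bs"

lemma finite_E [simp]: "finite E"
  and bases_nonempty: "Bs \<noteq> {}"
  and basis_subset: "B \<in> Bs \<Longrightarrow> B \<subseteq> E"
  and basis_exchange: "B1 \<in> Bs \<Longrightarrow> B2 \<in> Bs \<Longrightarrow> x \<in> B1 - B2 \<Longrightarrow> \<exists>y\<in>B2 - B1. insert y (B1 - {x}) \<in> Bs"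
  using matroid_bases unfolding matroid_bases_def by auto

lemma finite_basis: "B \<in> Bs \<Longrightarrow> finite B"
  by (rule finite_subset[OF basis_subset finite_E])

section \<open>Bases and independent sets\<close>

lemma basis_card_eq: "B1 \<in> Bs \<Longrightarrow> B2 \<in> Bs \<Longrightarrow> card B1 = card B2"
proof (induction "card (B1 - B2)" arbitrary: B1 rule: less_induct)
  case less
  show ?case
  proof (cases "B1 - B2 = {}")
    case True
    then have "B2 - B1 = {}"
      using basis_exchange[OF less.prems(2,1)] by blast
    with True show ?thesis by (metis Diff_eq_empty_iff subset_antisym)
  next
    case False
    then obtain x where x: "x \<in> B1 - B2" by blast
    then obtain y where y: "y \<in> B2 - B1" "insert y (B1 - {x}) \<in> Bs"
      using basis_exchange less.prems by blast
    have "insert y (B1 - {x}) - B2 = B1 - B2 - {x}" using y by auto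
    then have "card (insert y (B1 - {x}) - B2) < card (B1 - B2)"
      using x finite_basis[OF less.prems(1)] by (metis card_Diff1_less finite_Diff)
    from less.hyps[OF this y(2) less.prems(2)]
    show ?thesis using x y finite_basis[OF less.prems(1)]
      by (simp add: card_insert_if) (metis Suc_pred card_gt_0_iff empty_iff)
  qed
qed

lemma ind_subset_E: "ind I \<Longrightarrow> I \<subseteq> E"
  unfolding indep_def using basis_subset by blast

lemma finite_ind: "ind I \<Longrightarrow> finite I"
  by (rule finite_subset[OF ind_subset_E finite_E])

lemma ind_mono: "ind I \<Longrightarrow> J \<subseteq> I \<Longrightarrow> ind J"
  unfolding indep_def by blast

lemma ind_empty: "ind {}"
  using bases_nonempty unfolding indep_def by blast

lemma ind_basis: "B \<in> Bs \<Longrightarrow> ind B"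
  unfolding indep_def by blast

text \<open>As long as a basis containing \<open>I\<close> has an element outside
  \<open>I \<union> B1\<close>, exchanging that element against \<open>B1\<close> keeps
  \<open>I\<close> and leaves fewer such elements.\<close>

lemma ind_extend_basis:
  assumes "ind I" "B1 \<in> Bs"
  shows "\<exists>B\<in>Bs. I \<subseteq> B \<and> B \<subseteq> I \<union> B1"
proof -
  obtain B0 where "B0 \<in> Bs" "I \<subseteq> B0" using assms unfolding indep_def by blast
  then show ?thesis
  proof (induction "card (B0 - (I \<union> B1))" arbitrary: B0 rule: less_induct)
    case less
    show ?case
    proof (cases "B0 \<subseteq> I \<union> B1")
      case True
      then show ?thesis using less.prems by blast
    next
      case False
      then obtain x where x: "x \<in> B0" "x \<notin> I \<union> B1" by blast
      then obtain y where y: "y \<in> B1 - B0" "insert y (B0 - {x}) \<in> Bs"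
        using basis_exchange less.prems assms by blast
      have "insert y (B0 - {x}) - (I \<union> B1) = B0 - (I \<union> B1) - {x}" using y by auto
      then have "card (insert y (B0 - {x}) - (I \<union> B1)) < card (B0 - (I \<union> B1))"
        using x finite_basis[OF less.prems(1)] by (metis DiffI card_Diff1_less finite_Diff)
      from less.hyps[OF this y(2)] show ?thesis using x less.prems(2) by blast
    qed
  qed
qed

text \<open>Let \<open>B1\<close> be a basis containing \<open>J\<close>. A basis between
  \<open>I\<close> and \<open>I \<union> B1\<close> has the size of \<open>B1\<close>, which is too
  large for it to avoid \<open>J - I\<close>.\<close>

lemma ind_augment:
  assumes "ind I" "ind J" "card I < card J"
  shows "\<exists>y\<in>J - I. ind (insert y I)"
proof -
  obtain B1 where B1: "B1 \<in> Bs" "J \<subseteq> B1" using assms unfolding indep_def by blast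
  obtain B where B: "B \<in> Bs" "I \<subseteq> B" "B \<subseteq> I \<union> B1"
    using ind_extend_basis assms B1 by blast
  have "B \<inter> (J - I) \<noteq> {}"
  proof
    assume "B \<inter> (J - I) = {}"
    then have "B \<subseteq> I \<union> (B1 - J)" using B by blast
    then have "card B \<le> card (I \<union> (B1 - J))"
      using finite_ind[OF assms(1)] finite_basis[OF B1(1)] by (intro card_mono) auto
    also have "\<dots> \<le> card I + card (B1 - J)" by (rule card_Un_le)
    also have "card (B1 - J) = card B1 - card J"
      using B1 finite_ind[OF assms(2)] by (simp add: card_Diff_subset)
    finally have "card B \<le> card I + (card B1 - card J)" .
    moreover have "card J \<le> card B1" using B1 finite_basis by (meson card_mono)
    ultimately show False using assms(3) basis_card_eq[OF B(1) B1(1)] by linarith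
  qed
  then show ?thesis using B unfolding indep_def by blast
qed

section \<open>Rank\<close>

lemma finite_ind_sets: "finite {I. I \<subseteq> X \<and> ind I}"
  by (rule finite_subset[of _ "Pow E"]) (use ind_subset_E in auto)

lemma card_le_rk: "ind I \<Longrightarrow> I \<subseteq> X \<Longrightarrow> card I \<le> rk X"
  unfolding mrank_def by (rule Max_ge) (use finite_ind_sets in auto)

lemma rk_attained: "\<exists>I. I \<subseteq> X \<and> ind I \<and> card I = rk X"
proof -
  have "Max (card ` {I. I \<subseteq> X \<and> ind I}) \<in> card ` {I. I \<subseteq> X \<and> ind I}"
    by (rule Max_in) (use finite_ind_sets ind_empty in auto)
  then show ?thesis unfolding mrank_def by auto
qed

lemma ind_extend:
  assumes "ind I" "I \<subseteq> X"
  shows "\<exists>J. I \<subseteq> J \<and> J \<subseteq> X \<and> ind J \<and> card J = rk X"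
  using assms
proof (induction "rk X - card I" arbitrary: I rule: less_induct)
  case less
  show ?case
  proof (cases "card I = rk X")
    case True
    then show ?thesis using less.prems by blast
  next
    case False
    then have lt: "card I < rk X" using card_le_rk[OF less.prems] by linarith
    obtain K where K: "K \<subseteq> X" "ind K" "card K = rk X" using rk_attained by blast
    then obtain y where y: "y \<in> K - I" "ind (insert y I)"
      using ind_augment[OF less.prems(1) K(2)] lt by auto
    have "card (insert y I) = Suc (card I)" using y finite_ind less.prems by auto
    then have "\<exists>J. insert y I \<subseteq> J \<and> J \<subseteq> X \<and> ind J \<and> card J = rk X"
      using lt y K less.prems by (intro less.hyps) auto
    then show ?thesis by blast
  qed
qed

lemma rk_mono: "X \<subseteq> Y \<Longrightarrow> rk X \<le> rk Y"
proof -
  assume "X \<subseteq> Y"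
  moreover obtain I where I: "I \<subseteq> X" "ind I" "card I = rk X" using rk_attained by blast
  ultimately show ?thesis using card_le_rk[of I Y] by auto
qed

lemma rk_ind: "ind I \<Longrightarrow> rk I = card I"
proof (rule order_antisym)
  assume I: "ind I"
  obtain J where "J \<subseteq> I" "card J = rk I" using rk_attained by blast
  then show "rk I \<le> card I" using card_mono[OF finite_ind[OF I]] by metis
  show "card I \<le> rk I" using card_le_rk I by blast
qed

lemma rk_empty [simp]: "rk {} = 0"
  using rk_ind[OF ind_empty] by simp

lemma rk_insert_le: "rk (insert e X) \<le> Suc (rk X)"
proof -
  obtain I where I: "I \<subseteq> insert e X" "ind I" "card I = rk (insert e X)" using rk_attained by blast
  have "card (I - {e}) \<le> rk X" using I by (intro card_le_rk) (auto intro: ind_mono)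
  then show ?thesis using I(3) finite_ind[OF I(2)] by (cases "e \<in> I") auto
qed

lemma rk_E: "B \<in> Bs \<Longrightarrow> rk E = card B"
proof -
  assume B: "B \<in> Bs"
  obtain I where I: "I \<subseteq> E" "ind I" "card I = rk E" using rk_attained by blast
  then obtain B' where "B' \<in> Bs" "I \<subseteq> B'" unfolding indep_def by blast
  then have "rk E \<le> card B" using I basis_card_eq[OF B] finite_basis by (metis card_mono)
  then show ?thesis using card_le_rk[OF ind_basis[OF B] basis_subset[OF B]] by simp
qed

lemma rk_le_rk_E: "rk X \<le> rk E"
proof -
  obtain I where I: "I \<subseteq> X" "ind I" "card I = rk X" using rk_attained by blast
  then show ?thesis using card_le_rk[of I E] ind_subset_E by auto
qed

lemma ind_card_rk_E_basis: "ind I \<Longrightarrow> card I = rk E \<Longrightarrow> I \<in> Bs"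
proof -
  assume I: "ind I" "card I = rk E"
  then obtain B where B: "B \<in> Bs" "I \<subseteq> B" unfolding indep_def by blast
  then have "I = B" using I rk_E[of B] finite_basis[of B] by (intro card_subset_eq) auto
  then show ?thesis using B by simp
qed

section \<open>Closure and flats\<close>

lemma in_cl: "e \<in> cl X \<longleftrightarrow> e \<in> E \<and> rk (insert e X) = rk X"
  unfolding mcl_def by simp

lemma rk_insert_notin_cl: "e \<in> E \<Longrightarrow> e \<notin> cl X \<Longrightarrow> rk (insert e X) = Suc (rk X)"
  using rk_insert_le[of e X] rk_mono[OF subset_insertI, of X e] unfolding in_cl by auto

lemma cl_subset_E: "cl X \<subseteq> E"
  unfolding mcl_def by auto

lemma subset_cl: "X \<subseteq> E \<Longrightarrow> X \<subseteq> cl X"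
  unfolding mcl_def by (auto simp: insert_absorb subset_iff)

lemma in_cl_ind: "ind I \<Longrightarrow> e \<in> E \<Longrightarrow> e \<notin> I \<Longrightarrow> e \<in> cl I \<longleftrightarrow> \<not> ind (insert e I)"
proof -
  assume *: "ind I" "e \<in> E" "e \<notin> I"
  have "ind (insert e I)" if "rk (insert e I) = Suc (card I)"
  proof -
    obtain J where J: "J \<subseteq> insert e I" "ind J" "card J = rk (insert e I)"
      using rk_attained by blast
    have "finite (insert e I)" "card J = card (insert e I)"
      using J(3) that * finite_ind by auto
    then have "J = insert e I" using J(1) by (intro card_subset_eq)
    then show ?thesis using J(2) by simp
  qed
  moreover have "rk (insert e I) = Suc (card I)" if "ind (insert e I)"
    using rk_ind[OF that] * finite_ind by auto
  moreover have "e \<in> cl I \<longleftrightarrow> rk (insert e I) \<noteq> Suc (card I)"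
    using * rk_ind[OF *(1)] rk_insert_notin_cl[of e I] in_cl[of e I] by auto
  ultimately show ?thesis by blast
qed

text \<open>A maximal independent subset \<open>I\<close> of \<open>X\<close> grows to one of
  \<open>Y\<close> and then to one of \<open>insert e Y\<close>, called \<open>K\<close>. If
  \<open>Y\<close> does not span \<open>e\<close>, then \<open>K\<close> contains \<open>e\<close>,
  so \<open>insert e I\<close> is independent and \<open>X\<close> does not span \<open>e\<close>
  either.\<close>

lemma cl_mono: "X \<subseteq> Y \<Longrightarrow> cl X \<subseteq> cl Y"
proof
  fix e assume XY: "X \<subseteq> Y" and e: "e \<in> cl X"
  show "e \<in> cl Y"
  proof (rule ccontr)
    assume n: "e \<notin> cl Y"
    have eE: "e \<in> E" using e in_cl by blast
    then have r: "rk (insert e Y) = Suc (rk Y)" using n rk_insert_notin_cl by blast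
    then have eY: "e \<notin> Y" by (metis insert_absorb n_not_Suc_n)
    obtain I where I: "I \<subseteq> X" "ind I" "card I = rk X" using rk_attained by blast
    obtain J where J: "I \<subseteq> J" "J \<subseteq> Y" "ind J" "card J = rk Y"
      using ind_extend[OF I(2)] I XY by (meson subset_trans)
    obtain K where K: "J \<subseteq> K" "K \<subseteq> insert e Y" "ind K" "card K = rk (insert e Y)"
      using ind_extend[OF J(3)] J by (meson subset_insertI2)
    have "e \<in> K" using card_le_rk[OF K(3), of Y] K r by fastforce
    then have "ind (insert e I)" using K J I by (meson ind_mono insert_subset subset_trans)
    then have "card (insert e I) \<le> rk (insert e X)" using I by (intro card_le_rk) auto
    moreover have "card (insert e I) = Suc (rk X)" using I XY eY finite_ind by (subst card_insert_disjoint) auto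
    ultimately show False using e in_cl by simp
  qed
qed

lemma rk_cl: "X \<subseteq> E \<Longrightarrow> rk (cl X) = rk X"
proof -
  assume X: "X \<subseteq> E"
  obtain I where I: "I \<subseteq> X" "ind I" "card I = rk X" using rk_attained by blast
  obtain J where J: "I \<subseteq> J" "J \<subseteq> cl X" "ind J" "card J = rk (cl X)"
    using ind_extend[OF I(2)] I subset_cl[OF X] by (meson subset_trans)
  have "J \<subseteq> I"
  proof
    fix e assume e: "e \<in> J"
    show "e \<in> I"
    proof (rule ccontr)
      assume n: "e \<notin> I"
      have "ind (insert e I)" using J e by (meson ind_mono insert_subset)
      then have "card (insert e I) \<le> rk (insert e X)" using I by (intro card_le_rk) auto
      then show False using n I finite_ind[OF I(2)] J e in_cl by fastforce
    qed
  qed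
  then show ?thesis using J I by (simp add: subset_antisym)
qed

lemma cl_cl: "X \<subseteq> E \<Longrightarrow> cl (cl X) = cl X"
proof (rule subset_antisym)
  assume X: "X \<subseteq> E"
  show "cl X \<subseteq> cl (cl X)" using subset_cl cl_subset_E by blast
  show "cl (cl X) \<subseteq> cl X"
  proof
    fix e assume "e \<in> cl (cl X)"
    then have e: "e \<in> E" "rk (insert e (cl X)) = rk X" using in_cl rk_cl X by auto
    moreover have "rk (insert e X) \<le> rk (insert e (cl X))" using subset_cl[OF X] by (intro rk_mono) auto
    ultimately show "e \<in> cl X" using in_cl rk_mono[OF subset_insertI, of X e] by auto
  qed
qed

lemma flat_cl: "X \<subseteq> E \<Longrightarrow> flat E Bs (cl X)"
  unfolding flat_def using cl_subset_E[of X] cl_cl[of X] by simp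

lemma cl_least: "flat E Bs F \<Longrightarrow> X \<subseteq> F \<Longrightarrow> cl X \<subseteq> F"
  unfolding flat_def using cl_mono[of X F] by simp

lemma flat_E: "flat E Bs E"
  unfolding flat_def using subset_cl[of E] cl_subset_E[of E] by simp

lemma flat_rk_less: "flat E Bs F \<Longrightarrow> F \<subset> F' \<Longrightarrow> F' \<subseteq> E \<Longrightarrow> rk F < rk F'"
proof -
  assume *: "flat E Bs F" "F \<subset> F'" "F' \<subseteq> E"
  then obtain e where e: "e \<in> F'" "e \<notin> F" by blast
  then have "rk (insert e F) = Suc (rk F)" using * rk_insert_notin_cl unfolding flat_def by auto
  moreover have "rk (insert e F) \<le> rk F'" using e * by (intro rk_mono) auto
  ultimately show ?thesis by simp
qed

lemma subset_cl_if_rk_eq: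
  assumes "X \<subseteq> Y" "Y \<subseteq> E" "rk Y \<le> rk X"
  shows "Y \<subseteq> cl X"
proof
  fix e assume "e \<in> Y"
  then have "rk (insert e X) \<le> rk X" using assms rk_mono[of "insert e X" Y] by auto
  moreover have "rk X \<le> rk (insert e X)" by (intro rk_mono) auto
  ultimately show "e \<in> cl X" using \<open>e \<in> Y\<close> assms(2) in_cl by auto
qed

lemma flat_eq_E_iff: "flat E Bs F \<Longrightarrow> F = E \<longleftrightarrow> rk F = rk E"
  using flat_rk_less[of F E] unfolding flat_def by (cases "F = E") (auto simp: psubset_eq)

lemma cl_basis: "B \<in> Bs \<Longrightarrow> cl B = E"
  using subset_cl_if_rk_eq[OF basis_subset, of B] rk_E[of B] rk_ind[OF ind_basis, of B]
    cl_subset_E[of B] by auto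

lemma ind_insert_cl: "ind I \<Longrightarrow> e \<in> E \<Longrightarrow> e \<notin> cl I \<Longrightarrow> ind (insert e I)"
  using in_cl_ind[of I e] subset_cl[OF ind_subset_E, of I] by auto

lemma ind_notin_cl: "ind I \<Longrightarrow> e \<in> I \<Longrightarrow> J \<subseteq> I \<Longrightarrow> e \<notin> J \<Longrightarrow> e \<notin> cl J"
  using in_cl_ind[of J e] ind_mono[of I J] ind_mono[of I "insert e J"] ind_subset_E[of I] by auto

section \<open>Duality and orthogonality\<close>

lemma matroid_dual: "matroid E (dual_bases E Bs)"
proof
  have "\<exists>y\<in>(E - B2) - (E - B1). insert y (E - B1 - {x}) \<in> dual_bases E Bs"
    if B: "B1 \<in> Bs" "B2 \<in> Bs" and x: "x \<in> (E - B1) - (E - B2)" for B1 B2 x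
  proof -
    \<comment> \<open>Extend this set to a basis inside \<open>insert x B1\<close>. Its size forces
      it to be \<open>insert x (B1 - {y})\<close>, and \<open>y\<close> is outside \<open>B2\<close>
      because \<open>B1 \<inter> B2\<close> was kept.\<close>
    have "ind (insert x (B1 \<inter> B2))" using B x unfolding indep_def by blast
    from ind_extend_basis[OF this B(1)]
    obtain B where B': "B \<in> Bs" "insert x (B1 \<inter> B2) \<subseteq> B" "B \<subseteq> insert x (B1 \<inter> B2) \<union> B1" by blast
    have "card (B - {x}) < card B"
      using B'(2) finite_basis[OF B'(1)] by (intro card_Diff1_less) auto
    then have "card (B - {x}) < card B1" using basis_card_eq[OF B'(1) B(1)] by simp
    moreover have "card B1 \<le> card (B - {x})" if "B1 \<subseteq> B"
      using that x finite_basis[OF B'(1)] by (intro card_mono) auto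
    ultimately obtain y where y: "y \<in> B1" "y \<notin> B" by fastforce
    have "B \<subseteq> insert x (B1 - {y})" using B' y by blast
    moreover have "card (insert x (B1 - {y})) = card B"
      using x card_Suc_Diff1[OF finite_basis[OF B(1)] y(1)] finite_basis[OF B(1)]
        basis_card_eq[OF B'(1) B(1)] by simp
    ultimately have "B = insert x (B1 - {y})"
      using finite_basis[OF B(1)] by (intro card_subset_eq) auto
    then have "insert y (E - B1 - {x}) = E - B"
      using x y basis_subset[OF B(1)] by auto
    moreover have "y \<in> (E - B2) - (E - B1)" using y x B' basis_subset[OF B(1)] by blast
    ultimately show ?thesis using B'(1) unfolding dual_bases_def by blast
  qed
  then show "matroid_bases E (dual_bases E Bs)"
    unfolding matroid_bases_def using bases_nonempty by (auto simp: dual_bases_def)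
qed

lemma dual_dual_bases: "dual_bases E (dual_bases E Bs) = Bs"
proof -
  have "E - (E - B) = B" if "B \<in> Bs" for B using basis_subset[OF that] by blast
  then show ?thesis unfolding dual_bases_def by (force simp: image_iff)
qed

text \<open>For each single basis \<open>B\<close> the equation \<open>key\<close> holds without any
  maximum. Taking \<open>B\<close> maximal for its left side gives one inequality, taking
  \<open>B\<close> maximal for its right side the other.\<close>

lemma rk_dual:
  assumes "X \<subseteq> E"
  shows "mrank (dual_bases E Bs) X + rk E = card X + rk (E - X)"
proof (rule order_antisym)
  interpret d: matroid E "dual_bases E Bs" by (rule matroid_dual)
  have fX: "finite X" using assms finite_E finite_subset by blast
  have key: "card (X \<inter> (E - B)) + rk E = card X + card (B - X)" if B: "B \<in> Bs" for B
  proof -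
    have "X \<inter> (E - B) = X - (X \<inter> B)" using assms by blast
    then have "card (X \<inter> (E - B)) = card X - card (X \<inter> B)"
      using fX by (simp add: card_Diff_subset)
    moreover have "card (X \<inter> B) \<le> card X" using fX by (simp add: card_mono)
    moreover have "card B = card (B \<inter> X) + card (B - X)"
      using finite_basis[OF B] by (metis add.commute card_Int_Diff)
    ultimately show ?thesis using rk_E[OF B] by (simp add: Int_commute)
  qed
  obtain I where I: "I \<subseteq> X" "d.ind I" "card I = d.rk X" using d.rk_attained by blast
  then obtain B where B: "B \<in> Bs" "I \<subseteq> E - B" unfolding indep_def dual_bases_def by blast
  have "card I \<le> card (X \<inter> (E - B))" using I B fX by (intro card_mono) auto
  moreover have "card (B - X) \<le> rk (E - X)"
    using B basis_subset by (intro card_le_rk) (auto intro: ind_mono[OF ind_basis])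
  ultimately show "d.rk X + rk E \<le> card X + rk (E - X)" using key[OF B(1)] I(3) by linarith
  obtain J where J: "J \<subseteq> E - X" "ind J" "card J = rk (E - X)" using rk_attained by blast
  then obtain B where B: "B \<in> Bs" "J \<subseteq> B" unfolding indep_def by blast
  have "rk (E - X) \<le> card (B - X)"
    unfolding J(3)[symmetric] using J(1) B finite_basis[OF B(1)] by (intro card_mono) auto
  moreover have "card (X \<inter> (E - B)) \<le> d.rk X"
    using B(1) by (intro d.card_le_rk) (auto simp: indep_def dual_bases_def)
  ultimately show "card X + rk (E - X) \<le> d.rk X + rk E" using key[OF B(1)] by linarith
qed

text \<open>By \<open>rk_dual\<close>, adding \<open>x\<close> to \<open>A\<close> leaves the dual
  rank unchanged exactly when removing \<open>x\<close> from the complement of \<open>A\<close>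
  lowers the rank there.\<close>

lemma in_cl_dual:
  assumes "x \<in> E" "x \<notin> A" "A \<subseteq> E"
  shows "x \<in> mcl E (dual_bases E Bs) A \<longleftrightarrow> x \<notin> cl (E - A - {x})"
proof -
  interpret d: matroid E "dual_bases E Bs" by (rule matroid_dual)
  have fA: "finite A" using assms finite_E finite_subset by blast
  have eq: "E - insert x A = E - A - {x}" "insert x (E - A - {x}) = E - A" using assms by auto
  have "d.rk (insert x A) + rk E = Suc (card A) + rk (E - A - {x})"
    using rk_dual[of "insert x A"] assms fA eq by simp
  moreover have "d.rk A + rk E = card A + rk (E - A)" using rk_dual assms by simp
  moreover have "rk (E - A) = rk (E - A - {x}) \<or> rk (E - A) = Suc (rk (E - A - {x}))"
    using rk_insert_notin_cl[of x "E - A - {x}"] assms(1) eq in_cl by metis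
  ultimately have "d.rk (insert x A) = d.rk A \<longleftrightarrow> rk (E - A) \<noteq> rk (E - A - {x})"
    by linarith
  then show ?thesis
    unfolding d.in_cl in_cl eq(2) using assms(1) by simp
qed

text \<open>Orthogonality in terms of closures: a circuit in \<open>insert x A\<close> and a
  cocircuit in \<open>insert x A'\<close>, both through \<open>x\<close>, would meet in
  \<open>x\<close> alone.\<close>

lemma closures_orthogonal:
  assumes "x \<in> cl A" "x \<in> mcl E (dual_bases E Bs) A'" "A \<subseteq> E" "A' \<subseteq> E" "A \<inter> A' = {}" "x \<notin> A" "x \<notin> A'"
  shows False
proof -
  have "x \<notin> cl (E - A' - {x})" using assms in_cl_dual[of x A'] in_cl by blast
  moreover have "A \<subseteq> E - A' - {x}" using assms by blast
  ultimately show False using cl_mono assms(1) by blast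
qed

section \<open>Fundamental circuits\<close>

lemma fundamental_circuit_eq:
  assumes B: "B \<in> Bs" and i: "i \<in> E - B" and C: "circuit E Bs C" "C \<subseteq> insert i B" "i \<in> C"
  shows "C = {x \<in> insert i B. ind (insert i B - {x})}"
proof -
  have fin: "finite (insert i B)" "card (insert i B) = Suc (card B)"
    using i finite_basis[OF B] by auto
  have rk: "rk (insert i B) = card B"
    using rk_E[OF B] card_le_rk[OF ind_basis[OF B] subset_insertI, of i] rk_le_rk_E[of "insert i B"] by auto
  \<comment> \<open>\<open>C - {x}\<close> extends inside \<open>insert i B\<close> to an
    independent set of size \<open>card B\<close>. It omits a single element, which must be
    \<open>x\<close> since \<open>C\<close> is dependent.\<close>
  have "ind (insert i B - {x})" if x: "x \<in> C" for x
  proof -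
    have "ind (C - {x})" using C x unfolding circuit_def by blast
    then obtain J where J: "C - {x} \<subseteq> J" "J \<subseteq> insert i B" "ind J" "card J = card B"
      using ind_extend[of "C - {x}" "insert i B"] C(2) rk by auto
    have "J \<noteq> insert i B" using J(4) fin by auto
    then obtain y where y: "y \<in> insert i B" "y \<notin> J" using J by blast
    have J_eq: "J = insert i B - {y}"
      using J y fin by (intro card_subset_eq) auto
    have "\<not> C \<subseteq> J" using J ind_mono C unfolding circuit_def by blast
    then have "x = y" using J J_eq C(2) by blast
    then show ?thesis using J J_eq by simp
  qed
  moreover have "x \<in> C" if "ind (insert i B - {x})" for x
  proof (rule ccontr)
    assume "x \<notin> C"
    then have "C \<subseteq> insert i B - {x}" using C by blast
    then show False using that ind_mono C unfolding circuit_def by blast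
  qed
  ultimately show ?thesis using C(2) by blast
qed

lemma dependent_contains_circuit:
  assumes "\<not> ind X" "X \<subseteq> E"
  shows "\<exists>C\<subseteq>X. circuit E Bs C"
proof -
  have fX: "finite X" using assms finite_E finite_subset by blast
  from fX assms show ?thesis
  proof (induction X rule: finite_psubset_induct)
    case (psubset X)
    show ?case
    proof (cases "\<forall>x\<in>X. ind (X - {x})")
      case True
      then show ?thesis using psubset.prems unfolding circuit_def by blast
    next
      case False
      then obtain x where x: "x \<in> X" "\<not> ind (X - {x})" by blast
      then obtain C where "C \<subseteq> X - {x}" "circuit E Bs C"
        using psubset.IH[of "X - {x}"] psubset.prems by blast
      then show ?thesis by blast
    qed
  qed
qed

text \<open>Justifies the definite description in \<open>fund_circuit\<close>. Uniqueness comes from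
  \<open>fundamental_circuit_eq\<close>, whose right side does not mention the circuit.\<close>

lemma
  assumes B: "B \<in> Bs" and i: "i \<in> E - B"
  shows circuit_fund_circuit: "circuit E Bs (fund_circuit E Bs B i)"
    and fund_circuit_subset: "fund_circuit E Bs B i \<subseteq> insert i B"
    and in_fund_circuit: "i \<in> fund_circuit E Bs B i"
proof -
  let ?P = "\<lambda>C. circuit E Bs C \<and> C \<subseteq> insert i B \<and> i \<in> C"
  have "\<not> ind (insert i B)"
    using in_cl_ind[OF ind_basis[OF B]] i cl_basis[OF B] by auto
  then obtain C where C: "C \<subseteq> insert i B" "circuit E Bs C"
    using dependent_contains_circuit[of "insert i B"] i basis_subset[OF B] by auto
  have "i \<in> C"
  proof (rule ccontr)
    assume "i \<notin> C"
    then show False using C ind_mono[OF ind_basis[OF B], of C] unfolding circuit_def by blast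
  qed
  then have P: "?P C" using C by simp
  moreover have "D = C" if "?P D" for D
    by (rule trans[OF fundamental_circuit_eq[OF B i] fundamental_circuit_eq[OF B i, symmetric]])
      (use P that in auto)
  ultimately have "\<exists>!C. ?P C" by (rule ex1I)
  from theI'[OF this] show "circuit E Bs (fund_circuit E Bs B i)"
    "fund_circuit E Bs B i \<subseteq> insert i B" "i \<in> fund_circuit E Bs B i"
    unfolding fund_circuit_def by auto
qed

text \<open>A circuit in \<open>insert i A\<close> must contain \<open>i\<close>, as
  \<open>A\<close> is independent, and so it is the fundamental circuit.\<close>

lemma in_cl_iff_fund_circuit_subset:
  assumes B: "B \<in> Bs" and i: "i \<in> E - B" and A: "A \<subseteq> B"
  shows "i \<in> cl A \<longleftrightarrow> fund_circuit E Bs B i \<subseteq> insert i A"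
proof -
  let ?C = "fund_circuit E Bs B i"
  note C = circuit_fund_circuit[OF B i] fund_circuit_subset[OF B i] in_fund_circuit[OF B i]
  have "i \<in> cl A \<longleftrightarrow> \<not> ind (insert i A)"
    using in_cl_ind[OF ind_mono[OF ind_basis[OF B] A]] i A by blast
  moreover have "\<not> ind (insert i A)" if "?C \<subseteq> insert i A"
    using C that ind_mono unfolding circuit_def by blast
  moreover have "?C \<subseteq> insert i A" if dep: "\<not> ind (insert i A)"
  proof -
    obtain D where D: "D \<subseteq> insert i A" "circuit E Bs D"
      using dependent_contains_circuit[OF dep] i A basis_subset[OF B] by auto
    have "i \<in> D"
    proof (rule ccontr)
      assume "i \<notin> D"
      then show False using D A ind_mono[OF ind_basis[OF B], of D] unfolding circuit_def by blast
    qed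
    moreover have "D \<subseteq> insert i B" using D A by blast
    ultimately have "D = ?C"
      using fundamental_circuit_eq[OF B i D(2)] fundamental_circuit_eq[OF B i C] by simp
    then show ?thesis using D by simp
  qed
  ultimately show ?thesis by blast
qed

end

lemma (in matroid) fund_cocircuit_dual:
  "fund_cocircuit E Bs B i = fund_circuit E (dual_bases E Bs) (E - B) i"
  unfolding fund_cocircuit_def fund_circuit_def cocircuit_def ..

section \<open>Activity as a closure condition\<close>

locale nat_matroid = matroid E Bs for E :: "nat set" and Bs
begin

text \<open>\<open>i\<close> is the minimum exactly when the rest of the circuit lies in
  \<open>{b \<in> B. i < b}\<close>, and this is a question of closure by
  \<open>in_cl_iff_fund_circuit_subset\<close>.\<close>

lemma eq_Min_fund_circuit_iff:
  assumes "B \<in> Bs" "i \<in> E - B"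
  shows "i = Min (fund_circuit E Bs B i) \<longleftrightarrow> i \<in> cl {b \<in> B. i < b}"
proof -
  let ?C = "fund_circuit E Bs B i"
  have "finite ?C" using fund_circuit_subset[OF assms] finite_basis[OF assms(1)]
    by (meson finite_insert finite_subset)
  then have "i = Min ?C \<longleftrightarrow> (\<forall>x\<in>?C. i \<le> x)"
    using in_fund_circuit[OF assms] by (metis Min_eqI Min.coboundedI)
  also have "\<dots> \<longleftrightarrow> ?C \<subseteq> insert i {b \<in> B. i < b}"
    using fund_circuit_subset[OF assms] assms(2) by (auto simp: order_le_less)
  also have "\<dots> \<longleftrightarrow> i \<in> cl {b \<in> B. i < b}"
    using in_cl_iff_fund_circuit_subset[OF assms, of "{b \<in> B. i < b}"] by auto
  finally show ?thesis .
qed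

lemma in_EA_iff:
  assumes "B \<in> Bs"
  shows "i \<in> EA E Bs B \<longleftrightarrow> i \<in> E - B \<and> i \<in> cl {b \<in> B. i < b}"
  unfolding EA_def using eq_Min_fund_circuit_iff[OF assms] by blast

lemma nat_matroid_dual: "nat_matroid E (dual_bases E Bs)"
  using matroid_dual unfolding nat_matroid_def .

lemma in_IA_iff:
  assumes "B \<in> Bs"
  shows "i \<in> IA E Bs B \<longleftrightarrow> i \<in> B \<and> i \<in> mcl E (dual_bases E Bs) {b \<in> E - B. i < b}"
proof -
  interpret d: nat_matroid E "dual_bases E Bs" by (rule nat_matroid_dual)
  have "E - B \<in> dual_bases E Bs" using assms by (simp add: dual_bases_def)
  from d.eq_Min_fund_circuit_iff[OF this, of i] show ?thesis
    unfolding IA_def fund_cocircuit_dual using basis_subset[OF assms] by auto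
qed

end

section \<open>Chains of biflats\<close>

text \<open>Relative to a set \<open>Bf\<close>, so that biflats killed by the power of \<gamma> can
  be left out from the start and the same argument serves the dual.\<close>

definition biflag_in :: "nat set \<Rightarrow> (nat set \<times> nat set) set \<Rightarrow> (nat set \<times> nat set) set \<Rightarrow> bool" where
  "biflag_in E Bf X \<longleftrightarrow> X \<subseteq> Bf \<and> (\<forall>P\<in>X. \<forall>Q\<in>X. compatible P Q) \<and> (\<Union>(F, G)\<in>X. F \<inter> G) \<noteq> E"

text \<open>A certificate that the monomial of \<open>X\<close> times \<open>N - card X\<close>
  factors \<delta> is zero, up to monomials with members outside \<open>Bf\<close>. Each
  \<open>expand\<close> represents one factor \<delta> at the uncovered element \<open>e\<close> and
  follows all the resulting terms.\<close>

inductive vanishing :: "nat set \<Rightarrow> (nat set \<times> nat set) set \<Rightarrow> nat \<Rightarrow> (nat set \<times> nat set) set \<Rightarrow> bool"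
  for E Bf N where
  stop: "\<not> biflag_in E Bf X \<Longrightarrow> vanishing E Bf N X"
| expand: "card X < N \<Longrightarrow> e \<in> E \<Longrightarrow> (\<forall>P\<in>X. e \<notin> fst P \<inter> snd P) \<Longrightarrow>
    (\<forall>P\<in>Bf. e \<in> fst P \<inter> snd P \<longrightarrow> vanishing E Bf N (insert P X)) \<Longrightarrow> vanishing E Bf N X"

lemma compatible_swap: "compatible (prod.swap P) (prod.swap Q) \<longleftrightarrow> compatible P Q"
  unfolding compatible_def by (cases P; cases Q) auto

lemma biflag_in_swap: "biflag_in E (prod.swap ` Bf) (prod.swap ` X) \<longleftrightarrow> biflag_in E Bf X"
proof -
  have "(\<Union>(F, G)\<in>prod.swap ` X. F \<inter> G) = (\<Union>(F, G)\<in>X. F \<inter> G)"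
    by (auto simp: split_beta Int_commute)
  then show ?thesis
    unfolding biflag_in_def by (simp add: compatible_swap inj_image_subset_iff)
qed

text \<open>Lets criteria proved for the left entries be used for the right entries through the dual
  matroid.\<close>

lemma vanishing_swap: "vanishing E Bf N X \<Longrightarrow> vanishing E (prod.swap ` Bf) N (prod.swap ` X)"
proof (induction rule: vanishing.induct)
  case (stop X)
  then show ?case by (intro vanishing.stop) (simp add: biflag_in_swap)
next
  case (expand X e)
  show ?case
  proof (rule vanishing.expand[of _ _ e])
    show "card (prod.swap ` X) < N" using expand by (simp add: card_image)
    show "\<forall>P\<in>prod.swap ` Bf. e \<in> fst P \<inter> snd P \<longrightarrow> vanishing E (prod.swap ` Bf) N (insert P (prod.swap ` X))"
    proof (intro ballI impI)
      fix P assume "P \<in> prod.swap ` Bf" "e \<in> fst P \<inter> snd P"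
      then obtain Q where "Q \<in> Bf" "P = prod.swap Q" "e \<in> fst Q \<inter> snd Q" by auto
      then show "vanishing E (prod.swap ` Bf) N (insert P (prod.swap ` X))"
        using expand.IH by auto
    qed
  qed (use expand in auto)
qed

lemma vanishing_swap_iff: "vanishing E (prod.swap ` Bf) N (prod.swap ` X) \<longleftrightarrow> vanishing E Bf N X"
  using vanishing_swap[of E Bf N X] vanishing_swap[of E "prod.swap ` Bf" N "prod.swap ` X"]
  unfolding image_image swap_swap by auto

section \<open>The order of biflats and the function \<open>phi\<close>\<close>

definition biflat_le :: "nat set \<times> nat set \<Rightarrow> nat set \<times> nat set \<Rightarrow> bool" where
  "biflat_le P Q \<longleftrightarrow> fst P \<subseteq> fst Q \<and> snd Q \<subseteq> snd P"

lemma compatible_iff_biflat_le: "compatible P Q \<longleftrightarrow> biflat_le P Q \<or> biflat_le Q P"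
  unfolding compatible_def biflat_le_def by (cases P; cases Q) auto

text \<open>The locale is applied to \<open>M\<close> and its dual in both orders. The flats of corank at most \<open>k\<close> other
  than \<open>E\<close> are left out on the side of \<open>M\<close>, and \<open>a\<close> is the rank, except that \<open>a E\<close> is smaller by \<open>k\<close>;
  hence the restriction to \<open>F' \<noteq> E\<close> in the covering property.\<close>

locale biflat_chains =
  fixes E :: "nat set" and Fl1 Fl2 :: "nat set set" and a b :: "nat set \<Rightarrow> nat"
    and closed :: "nat set \<Rightarrow> bool"
  assumes fin_E: "finite E" and E_ne: "E \<noteq> {}"
    and Fl1_sub: "F \<in> Fl1 \<Longrightarrow> F \<subseteq> E" and Fl2_sub: "G \<in> Fl2 \<Longrightarrow> G \<subseteq> E"
    and Fl1_E: "E \<in> Fl1" and Fl2_E: "E \<in> Fl2"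
    and Fl1_empty: "{} \<in> Fl1" and Fl2_empty: "{} \<in> Fl2"
    and a_less: "F \<in> Fl1 \<Longrightarrow> F' \<in> Fl1 \<Longrightarrow> F \<subset> F' \<Longrightarrow> a F < a F'"
    and b_less: "G \<in> Fl2 \<Longrightarrow> G' \<in> Fl2 \<Longrightarrow> G \<subset> G' \<Longrightarrow> b G < b G'"
    and cover: "F \<in> Fl1 \<Longrightarrow> F' \<in> Fl1 \<Longrightarrow> F \<subset> F' \<Longrightarrow> F' \<noteq> E \<Longrightarrow> a F' = Suc (a F) \<Longrightarrow>
      d \<in> F' \<Longrightarrow> d \<notin> F \<Longrightarrow> closed K \<Longrightarrow> F \<subseteq> K \<Longrightarrow> d \<in> K \<Longrightarrow> F' \<subseteq> K"
begin

definition Bf :: "(nat set \<times> nat set) set" where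
  "Bf = {(F, G). F \<in> Fl1 \<and> G \<in> Fl2 \<and> F \<noteq> {} \<and> G \<noteq> {} \<and> \<not> (F = E \<and> G = E) \<and> F \<union> G = E}"

definition phi :: "nat set \<times> nat set \<Rightarrow> nat" where
  "phi P = a (fst P) + (b E - b (snd P))"

text \<open>An upper bound for the length of a biflag: \<open>phi\<close> has values in
  \<open>{1..Suc N}\<close> and omits at least one of them.\<close>

definition N :: nat where "N = a E + b E - 2"

lemma a_less_neq: "F \<in> Fl1 \<Longrightarrow> F' \<in> Fl1 \<Longrightarrow> F \<subseteq> F' \<Longrightarrow> F \<noteq> F' \<Longrightarrow> a F < a F'"
  by (rule a_less) auto

lemma b_less_neq: "G \<in> Fl2 \<Longrightarrow> G' \<in> Fl2 \<Longrightarrow> G \<subseteq> G' \<Longrightarrow> G \<noteq> G' \<Longrightarrow> b G < b G'"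
  by (rule b_less) auto

lemma a_le: "F \<in> Fl1 \<Longrightarrow> F' \<in> Fl1 \<Longrightarrow> F \<subseteq> F' \<Longrightarrow> a F \<le> a F'"
  using a_less_neq[of F F'] by (cases "F = F'") auto

lemma b_le: "G \<in> Fl2 \<Longrightarrow> G' \<in> Fl2 \<Longrightarrow> G \<subseteq> G' \<Longrightarrow> b G \<le> b G'"
  using b_less_neq[of G G'] by (cases "G = G'") auto

lemma a_E_pos: "0 < a E" using a_less_neq[OF Fl1_empty Fl1_E] E_ne by auto
lemma b_E_pos: "0 < b E" using b_less_neq[OF Fl2_empty Fl2_E] E_ne by auto

lemma Suc_N: "Suc N = a E + b E - 1"
  unfolding N_def using a_E_pos b_E_pos by auto

abbreviation "Prs \<equiv> Fl1 \<times> Fl2"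

lemma Bf_Prs: "P \<in> Bf \<Longrightarrow> P \<in> Prs"
  unfolding Bf_def by auto

lemma in_Bf_iff: "P \<in> Bf \<longleftrightarrow> fst P \<in> Fl1 \<and> snd P \<in> Fl2 \<and> fst P \<noteq> {} \<and> snd P \<noteq> {} \<and>
    \<not> (fst P = E \<and> snd P = E) \<and> fst P \<union> snd P = E"
  unfolding Bf_def by (simp add: case_prod_beta)

lemma finite_Bf: "finite Bf"
proof (rule finite_subset)
  show "Bf \<subseteq> Pow E \<times> Pow E" using Fl1_sub Fl2_sub by (auto simp: Bf_def)
qed (simp add: fin_E)

lemma phi_le: "P \<in> Prs \<Longrightarrow> Q \<in> Prs \<Longrightarrow> biflat_le P Q \<Longrightarrow> phi P \<le> phi Q"
  unfolding phi_def biflat_le_def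
  using a_le[of "fst P" "fst Q"] b_le[of "snd Q" "snd P"] by auto

lemma phi_less: 
  assumes "P \<in> Prs" "Q \<in> Prs" "biflat_le P Q" "P \<noteq> Q"
  shows "phi P < phi Q"
proof -
  have m: "fst P \<in> Fl1" "fst Q \<in> Fl1" "snd P \<in> Fl2" "snd Q \<in> Fl2"
    "fst P \<subseteq> fst Q" "snd Q \<subseteq> snd P" using assms unfolding biflat_le_def by auto
  have le: "a (fst P) \<le> a (fst Q)" "b (snd Q) \<le> b (snd P)" "b (snd P) \<le> b E"
    using m a_le b_le Fl2_E Fl2_sub by auto
  have "fst P \<subset> fst Q \<or> snd Q \<subset> snd P" using assms(4) m(5,6) by (auto simp: prod_eq_iff)
  then have "a (fst P) < a (fst Q) \<or> b (snd Q) < b (snd P)" using a_less b_less m by blast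
  then show ?thesis unfolding phi_def using le by linarith
qed

lemma biflat_le_if_phi_less:
  assumes "P \<in> Prs" "Q \<in> Prs" "compatible P Q" "phi P < phi Q"
  shows "biflat_le P Q"
  using assms(3,4) phi_le[OF assms(2,1)] unfolding compatible_iff_biflat_le by linarith

lemma phi_bounds:
  assumes "P \<in> Bf"
  shows "phi P \<in> {1..Suc N}"
proof -
  have P: "fst P \<in> Fl1" "snd P \<in> Fl2" "fst P \<noteq> {}" "snd P \<noteq> {}" using assms unfolding Bf_def by auto
  have "0 < a (fst P)" "0 < b (snd P)"
    using a_less_neq[OF Fl1_empty P(1)] b_less_neq[OF Fl2_empty P(2)] P by auto
  moreover have "a (fst P) \<le> a E" "b (snd P) \<le> b E"
    using a_le[OF P(1) Fl1_E] b_le[OF P(2) Fl2_E] Fl1_sub Fl2_sub P by auto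
  ultimately show ?thesis unfolding phi_def using Suc_N by auto
qed

lemma biflag_in_finite: "biflag_in E Bf X \<Longrightarrow> finite X"
  unfolding biflag_in_def by (rule finite_subset[OF _ finite_Bf]) simp

lemma biflag_in_inj_phi: 
  assumes "biflag_in E Bf X"
  shows "inj_on phi X"
proof (rule inj_onI, rule ccontr)
  fix P Q assume PQ: "P \<in> X" "Q \<in> X" "phi P = phi Q" "P \<noteq> Q"
  then have "biflat_le P Q \<or> biflat_le Q P" "P \<in> Prs" "Q \<in> Prs"
    using assms Bf_Prs unfolding biflag_in_def compatible_iff_biflat_le by blast+
  then show False using phi_less[of P Q] phi_less[of Q P] PQ by auto
qed

lemma biflag_in_uncovered:
  assumes "biflag_in E Bf X"
  shows "\<exists>z\<in>E. \<forall>P\<in>X. z \<notin> fst P \<inter> snd P"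
proof -
  have "(\<Union>P\<in>X. fst P \<inter> snd P) \<noteq> E" using assms unfolding biflag_in_def by (simp add: split_beta)
  moreover have "(\<Union>P\<in>X. fst P \<inter> snd P) \<subseteq> E"
  proof (rule UN_least)
    fix P assume "P \<in> X"
    then have "P \<in> Bf" using assms unfolding biflag_in_def by blast
    then show "fst P \<inter> snd P \<subseteq> E" unfolding in_Bf_iff using Fl1_sub by auto
  qed
  ultimately show ?thesis by blast
qed

text \<open>Where an element is uncovered, both entries of the biflag jump, so \<open>phi\<close> omits a value.\<close>

lemma gap_value:
  assumes X: "biflag_in E Bf X" and z: "z \<in> E" "\<forall>P\<in>X. z \<notin> fst P \<inter> snd P"
  shows "\<exists>v\<in>{1..Suc N}. \<forall>P\<in>X. (z \<in> fst P \<longrightarrow> v < phi P) \<and> (z \<notin> fst P \<longrightarrow> phi P < v)"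
proof -
  define L where "L = {P \<in> X. z \<notin> fst P}"
  \<comment> \<open>The first value above those of the biflats to the left of \<open>z\<close>; the
    inserted \<open>0\<close> is the default when there are none.\<close>
  define v where "v = Suc (Max (insert 0 (phi ` L)))"
  have finL: "finite (insert 0 (phi ` L))" using biflag_in_finite[OF X] unfolding L_def by auto
  have prs: "P \<in> Prs" and ne: "fst P \<noteq> {}" "snd P \<noteq> {}" and un: "fst P \<union> snd P = E" if "P \<in> X" for P
  proof -
    have "P \<in> Bf" using that X unfolding biflag_in_def by blast
    then show "P \<in> Prs" "fst P \<noteq> {}" "snd P \<noteq> {}" "fst P \<union> snd P = E"
      unfolding in_Bf_iff by (auto simp: mem_Times_iff)
  qed
  have low: "phi P < v" if "P \<in> X" "z \<notin> fst P" for P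
  proof -
    have "phi P \<le> Max (insert 0 (phi ` L))" using that finL unfolding L_def by (intro Max_ge) auto
    then show ?thesis unfolding v_def by simp
  qed
  have high: "v < phi P" if P: "P \<in> X" "z \<in> fst P" for P
  proof -
    have zP: "z \<notin> snd P" using z P by auto
    have P1: "fst P \<in> Fl1" "snd P \<in> Fl2" using prs[OF P(1)] by auto
    have bP: "b (snd P) < b E" using b_less_neq[OF P1(2) Fl2_E] Fl2_sub[OF P1(2)] zP z(1) by auto
    \<comment> \<open>Between the last biflat left of \<open>z\<close> and \<open>P\<close>, the
      left entry gains \<open>z\<close> and the right entry loses it, so both summands of
      \<open>phi\<close> grow. For \<open>y = 0\<close> the comparison is with
      \<open>({}, E)\<close>.\<close>
    have "Suc (Suc y) \<le> phi P" if y: "y \<in> insert 0 (phi ` L)" for y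
    proof (cases "y = 0")
      case True
      have "0 < a (fst P)" using a_less_neq[OF Fl1_empty P1(1)] ne[OF P(1)] by auto
      then show ?thesis using True bP unfolding phi_def by simp
    next
      case False
      then obtain P' where P': "P' \<in> X" "z \<notin> fst P'" "y = phi P'" using y unfolding L_def by auto
      have P2: "fst P' \<in> Fl1" "snd P' \<in> Fl2" using prs[OF P'(1)] by auto
      have zP': "z \<in> snd P'" using un[OF P'(1)] P' z by blast
      have "biflat_le P' P" using X P P' unfolding biflag_in_def compatible_iff_biflat_le biflat_le_def by blast
      then have "fst P' \<subset> fst P" "snd P \<subset> snd P'" using P P' zP zP' unfolding biflat_le_def by auto
      then have "a (fst P') < a (fst P)" "b (snd P) < b (snd P')" "b (snd P') \<le> b E"
        using a_less b_less b_le P1 P2 Fl2_E Fl2_sub by auto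
      then show ?thesis unfolding P'(3) phi_def by linarith
    qed
    moreover have "Max (insert 0 (phi ` L)) \<in> insert 0 (phi ` L)" using finL by (intro Max_in) auto
    ultimately have "Suc (Suc (Max (insert 0 (phi ` L)))) \<le> phi P" by blast
    then show ?thesis unfolding v_def by simp
  qed
  \<comment> \<open>The left entry misses \<open>z\<close> and the right entry is nonempty, so both
    summands stay below their maxima. This keeps \<open>v\<close> within
    \<open>Suc N\<close>.\<close>
  have "phi P \<le> N" if P: "P \<in> X" "z \<notin> fst P" for P
  proof -
    have P1: "fst P \<in> Fl1" "snd P \<in> Fl2" using prs[OF P(1)] by auto
    have "a (fst P) < a E" using a_less_neq[OF P1(1) Fl1_E] Fl1_sub[OF P1(1)] P z by auto
    moreover have "0 < b (snd P)" using b_less_neq[OF Fl2_empty P1(2)] ne[OF P(1)] by auto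
    moreover have "b (snd P) \<le> b E" using b_le P1 Fl2_E Fl2_sub by auto
    ultimately show ?thesis using Suc_N unfolding phi_def by simp
  qed
  then have "\<forall>y\<in>insert 0 (phi ` L). y \<le> N" unfolding L_def by auto
  then have "Max (insert 0 (phi ` L)) \<le> N" using finL by (subst Max_le_iff) auto
  then have "v \<in> {1..Suc N}" unfolding v_def by simp
  then show ?thesis using low high by blast
qed

lemma gap_value_notin: "\<forall>P\<in>X. (z \<in> fst P \<longrightarrow> v < phi P) \<and> (z \<notin> fst P \<longrightarrow> phi P < v) \<Longrightarrow> v \<notin> phi ` X"
  by (rule notI, erule imageE) (metis less_irrefl)

section \<open>The maximal length of biflags and criteria for vanishing\<close>

lemma biflag_in_card_le: 
  assumes "biflag_in E Bf X"
  shows "card X \<le> N"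
proof -
  obtain z where z: "z \<in> E" "\<forall>P\<in>X. z \<notin> fst P \<inter> snd P" using biflag_in_uncovered[OF assms] by blast
  obtain v where v: "v \<in> {1..Suc N}" "v \<notin> phi ` X"
    using gap_value[OF assms z] gap_value_notin by blast
  have "X \<subseteq> Bf" using assms unfolding biflag_in_def by blast
  then have "phi ` X \<subseteq> {1..Suc N}" using phi_bounds by (meson image_subsetI subsetD)
  then have "phi ` X \<subseteq> {1..Suc N} - {v}" using v(2) by (simp add: subset_Diff_insert del: image_subset_iff)
  then have "card (phi ` X) \<le> card ({1..Suc N} - {v})"
    by (rule card_mono[OF finite_Diff[OF finite_atLeastAtMost]])
  then show ?thesis using v card_image[OF biflag_in_inj_phi[OF assms]] by simp
qed

text \<open>\<open>phi\<close> is injective on a biflag, so at length \<open>N\<close> it omits only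
  one of the \<open>Suc N\<close> values.\<close>

lemma two_missing:
  assumes "biflag_in E Bf X" "card X = N" "v \<in> {1..Suc N}" "w \<in> {1..Suc N}" "v \<noteq> w"
    "v \<notin> phi ` X" "w \<notin> phi ` X"
  shows False
proof -
  have "X \<subseteq> Bf" using assms unfolding biflag_in_def by blast
  then have "phi ` X \<subseteq> {1..Suc N}" using phi_bounds by (meson image_subsetI subsetD)
  then have "phi ` X \<subseteq> {1..Suc N} - {v} - {w}" using assms(6,7) by (simp add: subset_Diff_insert del: image_subset_iff)
  then have "card (phi ` X) \<le> card ({1..Suc N} - {v} - {w})"
    by (rule card_mono[OF finite_Diff[OF finite_Diff[OF finite_atLeastAtMost]]])
  moreover have "card ({1..Suc N} - {v} - {w}) = N - 1" using assms(3-5) by simp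
  moreover have "0 < N" using assms(3-5) by (cases N) auto
  ultimately show False using assms(2) card_image[OF biflag_in_inj_phi[OF assms(1)]] by simp
qed

text \<open>A certificate from a strategy: below length \<open>N\<close> it names an uncovered
  element whose terms all keep the invariant, and the invariant rules out length \<open>N\<close>.
  As no biflag is longer, the expansion ends with sets that are not biflags.\<close>

lemma vanishing_by_invariant:
  assumes step: "\<And>X. Inv X \<Longrightarrow> biflag_in E Bf X \<Longrightarrow> card X < N \<Longrightarrow>
      \<exists>e\<in>E. (\<forall>P\<in>X. e \<notin> fst P \<inter> snd P) \<and>
        (\<forall>P\<in>Bf. e \<in> fst P \<inter> snd P \<longrightarrow> biflag_in E Bf (insert P X) \<longrightarrow> Inv (insert P X))"
    and final: "\<And>X. Inv X \<Longrightarrow> biflag_in E Bf X \<Longrightarrow> card X = N \<Longrightarrow> False"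
    and "Inv X"
  shows "vanishing E Bf N X"
  using \<open>Inv X\<close>
proof (induction "N - card X" arbitrary: X rule: less_induct)
  case less
  show ?case
  proof (cases "biflag_in E Bf X")
    case False
    then show ?thesis by (rule vanishing.stop)
  next
    case True
    then have lt: "card X < N" using biflag_in_card_le[OF True] final[OF less.prems True] by fastforce
    obtain e where e: "e \<in> E" "\<forall>P\<in>X. e \<notin> fst P \<inter> snd P"
      "\<forall>P\<in>Bf. e \<in> fst P \<inter> snd P \<longrightarrow> biflag_in E Bf (insert P X) \<longrightarrow> Inv (insert P X)"
      using step[OF less.prems True lt] by blast
    have "vanishing E Bf N (insert P X)" if P: "P \<in> Bf" "e \<in> fst P \<inter> snd P" for P
    proof (cases "biflag_in E Bf (insert P X)")
      case False
      then show ?thesis by (rule vanishing.stop)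
    next
      case B: True
      have "card (insert P X) = Suc (card X)" using e P biflag_in_finite[OF True] by (subst card_insert_disjoint) auto
      then show ?thesis using less.hyps[of "insert P X"] lt e P B by auto
    qed
    then show ?thesis using vanishing.expand[OF lt e(1,2)] by blast
  qed
qed

text \<open>The value \<open>Suc (a Fs)\<close> is skipped below \<open>F\<close>, and it stays
  skipped: a later biflat contains an element outside \<open>F\<close>, so it lies above
  \<open>(F, E)\<close>. At full length the remaining uncovered element is outside \<open>F\<close>
  too and causes a second omission, above \<open>a F\<close>.\<close>

lemma vanishing_cover:
  assumes Q: "(F, E) \<in> Bf" "(F, E) \<in> X0" and Fs: "Fs \<in> Fl1" "a Fs + 2 \<le> a F"
    and old: "\<forall>P\<in>X0. (fst P \<subseteq> Fs \<and> snd P = E) \<or> biflat_le (F, E) P"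
  shows "vanishing E Bf N X0"
proof -
  define Inv where "Inv X \<longleftrightarrow> X0 \<subseteq> X \<and> (\<forall>P\<in>X. (fst P \<subseteq> Fs \<and> snd P = E) \<or> biflat_le (F, E) P)" for X
  have FF: "F \<in> Fl1" "F \<subseteq> E" using Q Fl1_sub unfolding Bf_def by auto
  have pQ: "phi (F, E) = a F" unfolding phi_def by simp
  show ?thesis
  proof (rule vanishing_by_invariant[of Inv])
    fix X assume X: "Inv X" "biflag_in E Bf X"
    obtain e where e: "e \<in> E" "\<forall>P\<in>X. e \<notin> fst P \<inter> snd P" using biflag_in_uncovered[OF X(2)] by blast
    have eF: "e \<notin> F" using e X(1) Q(2) unfolding Inv_def by force
    have "Inv (insert P X)" if P: "e \<in> fst P \<inter> snd P" "biflag_in E Bf (insert P X)" for P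
    proof -
      have "(F, E) \<in> X" using X Q unfolding Inv_def by blast
      then have "compatible P (F, E)" using P(2) unfolding biflag_in_def by blast
      then have "biflat_le (F, E) P" using P eF unfolding compatible_iff_biflat_le biflat_le_def by auto
      then show ?thesis using X unfolding Inv_def by blast
    qed
    then show "\<exists>e\<in>E. (\<forall>P\<in>X. e \<notin> fst P \<inter> snd P) \<and>
        (\<forall>P\<in>Bf. e \<in> fst P \<inter> snd P \<longrightarrow> biflag_in E Bf (insert P X) \<longrightarrow> Inv (insert P X))"
      using e by blast
  next
    fix X assume X: "Inv X" "biflag_in E Bf X" "card X = N"
    have XB: "X \<subseteq> Bf" using X unfolding biflag_in_def by blast
    obtain z where z: "z \<in> E" "\<forall>P\<in>X. z \<notin> fst P \<inter> snd P" using biflag_in_uncovered[OF X(2)] by blast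
    obtain v where v: "v \<in> {1..Suc N}" "\<forall>P\<in>X. (z \<in> fst P \<longrightarrow> v < phi P) \<and> (z \<notin> fst P \<longrightarrow> phi P < v)"
      using gap_value[OF X(2) z] by blast
    have QX: "(F, E) \<in> X" using X Q unfolding Inv_def by blast
    then have "z \<notin> F" using z by force
    then have v_gt: "a F < v" using v QX pQ by force
    have "phi P \<noteq> Suc (a Fs)" if P: "P \<in> X" for P
    proof -
      have PP: "P \<in> Prs" using P XB Bf_Prs by blast
      consider "fst P \<subseteq> Fs \<and> snd P = E" | "biflat_le (F, E) P" using X(1) P unfolding Inv_def by blast
      then show ?thesis
      proof cases
        case 1
        then have "phi P \<le> a Fs" unfolding phi_def using a_le[of "fst P" Fs] PP Fs by auto
        then show ?thesis by simp
      next
        case 2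
        then have "a F \<le> phi P" using phi_le[OF Bf_Prs[OF Q(1)] PP] pQ by simp
        then show ?thesis using Fs by simp
      qed
    qed
    then have "Suc (a Fs) \<notin> phi ` X" by force
    moreover have "v \<notin> phi ` X" using v gap_value_notin by blast
    ultimately show False
      using two_missing[OF X(2,3) v(1), of "Suc (a Fs)"] v_gt Fs v(1) by simp
  next
    show "Inv X0" unfolding Inv_def using old by blast
  qed
qed

text \<open>Expand at uncovered elements of \<open>E - G\<close> as long as there are any, where \<open>d P\<close> is the element for
  which \<open>P\<close> was inserted. If no value of \<open>phi\<close> to the left of \<open>F|G\<close> were omitted, then all left entries
  there, and finally \<open>F\<close>, would be spanned by the elements \<open>d P\<close> over \<open>Fs\<close>.\<close>

lemma vanishing_left:
  assumes Q: "(F, G) \<in> Bf" "F \<noteq> E" "G \<noteq> E" "(F, G) \<in> X0"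
    and e: "e \<in> F" "e \<in> G" "e \<notin> Fs" "e \<notin> Gl"
    and Fs: "Fs \<in> Fl1" "Fs \<subseteq> F" and Gl: "Gl \<in> Fl2" "Gl \<subseteq> G"
    and old: "\<forall>P\<in>X0. P = (F, G) \<or> (fst P \<subseteq> Fs \<and> snd P = E) \<or> (fst P = E \<and> snd P \<subseteq> Gl)"
    and Fs_in: "Fs = {} \<or> (Fs, E) \<in> X0"
    and K: "closed K" "Fs \<subseteq> K" "E - G \<subseteq> K" "\<not> F \<subseteq> K"
  shows "vanishing E Bf N X0"
proof -
  let ?Q = "(F, G)"
  \<comment> \<open>Of two biflats inserted to the left, the later one was inserted for an element
    that the earlier one does not cover. The order of insertion is not recorded, hence the
    disjunction.\<close>
  define good where "good X d \<longleftrightarrow>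
      (\<forall>P\<in>X - X0. biflat_le P ?Q \<longrightarrow> d P \<in> E - G \<and> d P \<notin> Fs \<and> d P \<in> fst P \<inter> snd P) \<and>
      (\<forall>P\<in>X - X0. \<forall>P'\<in>X - X0. biflat_le P ?Q \<longrightarrow> biflat_le P' ?Q \<longrightarrow> P \<noteq> P' \<longrightarrow>
        d P \<notin> fst P' \<inter> snd P' \<or> d P' \<notin> fst P \<inter> snd P)" for X and d :: "nat set \<times> nat set \<Rightarrow> nat"
  \<comment> \<open>The last clause expresses the strategy: a biflat not to the left of
    \<open>?Q\<close> is inserted only after all of \<open>E - G - Fs\<close> is covered.\<close>
  define Inv where "Inv X \<longleftrightarrow> X0 \<subseteq> X \<and> (\<exists>d. good X d) \<and>
      ((\<exists>P\<in>X - X0. \<not> biflat_le P ?Q) \<longrightarrow> (\<forall>x\<in>E - G - Fs. \<exists>P\<in>X. x \<in> fst P \<inter> snd P))" for X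
  have QF: "F \<in> Fl1" "G \<in> Fl2" "F \<subseteq> E" "G \<subseteq> E" "F \<union> G = E" "F \<noteq> {}" "G \<noteq> {}" "?Q \<in> Prs"
    using Q Fl1_sub Fl2_sub unfolding Bf_def by auto
  show ?thesis
  proof (rule vanishing_by_invariant[of Inv])
    fix X assume X: "Inv X" "biflag_in E Bf X"
    have QX: "?Q \<in> X" using X Q unfolding Inv_def by blast
    obtain d where d: "good X d" using X(1) unfolding Inv_def by blast
    show "\<exists>e\<in>E. (\<forall>P\<in>X. e \<notin> fst P \<inter> snd P) \<and>
        (\<forall>P\<in>Bf. e \<in> fst P \<inter> snd P \<longrightarrow> biflag_in E Bf (insert P X) \<longrightarrow> Inv (insert P X))"
    proof (cases "\<forall>x\<in>E - G - Fs. \<exists>P\<in>X. x \<in> fst P \<inter> snd P")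
      case False
      then obtain x where x: "x \<in> E - G - Fs" "\<forall>P\<in>X. x \<notin> fst P \<inter> snd P" by blast
      have "Inv (insert P X)" if P: "x \<in> fst P \<inter> snd P" "biflag_in E Bf (insert P X)" for P
      proof -
        have "compatible P ?Q" using P(2) QX unfolding biflag_in_def by blast
        then have PQ: "biflat_le P ?Q" using P x unfolding compatible_iff_biflat_le biflat_le_def by auto
        have PX: "P \<notin> X" using P x by blast
        have "good (insert P X) (d(P := x))"
          using d P(1) x PX unfolding good_def by auto
        moreover have "\<forall>P\<in>X - X0. biflat_le P ?Q" using X(1) False unfolding Inv_def by blast
        ultimately show ?thesis using X(1) PQ unfolding Inv_def by blast
      qed
      then show ?thesis using x by blast
    next
      case True
      obtain x where x: "x \<in> E" "\<forall>P\<in>X. x \<notin> fst P \<inter> snd P" using biflag_in_uncovered[OF X(2)] by blast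
      have xFs: "x \<notin> Fs" using x Fs_in X(1) unfolding Inv_def by force
      have "Inv (insert P X)" if P: "x \<in> fst P \<inter> snd P" "biflag_in E Bf (insert P X)" for P
      proof -
        have "\<not> biflat_le P ?Q"
        proof
          assume "biflat_le P ?Q"
          then have "x \<in> F" using P unfolding biflat_le_def by auto
          then have "x \<notin> G" using x QX by force
          then show False using True x xFs by blast
        qed
        then have "good (insert P X) d" using d unfolding good_def by auto
        then show ?thesis using X(1) True unfolding Inv_def by blast
      qed
      then show ?thesis using x by blast
    qed
  next
    show "Inv X0" unfolding Inv_def good_def by auto
  next
    fix X assume X: "Inv X" "biflag_in E Bf X" "card X = N"
    have QX: "?Q \<in> X" using X Q unfolding Inv_def by blast
    have XP: "P \<in> Prs" if "P \<in> X" for P using that X Bf_Prs unfolding biflag_in_def by blast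
    have comp: "compatible P P'" if "P \<in> X" "P' \<in> X" for P P' using that X(2) unfolding biflag_in_def by blast
    obtain d where d: "good X d" using X(1) unfolding Inv_def by blast
    have ineqs: "a Fs < a F" "a F < a E" "b Gl < b G" "b G < b E"
      using a_less_neq[of Fs F] a_less_neq[of F E] b_less_neq[of Gl G] b_less_neq[of G E] Fs Gl QF Q e Fl1_E Fl2_E by auto
    have pQ: "phi ?Q = a F + (b E - b G)" unfolding phi_def by simp
    have left: "phi P \<le> a Fs" if "P \<in> X" "fst P \<subseteq> Fs" "snd P = E" for P
      using that a_le[of "fst P" Fs] XP[of P] Fs unfolding phi_def by auto
    have right: "phi ?Q + 2 \<le> phi P" if "P \<in> X" "fst P = E" "snd P \<subseteq> Gl" for P
    proof -
      have "b (snd P) \<le> b Gl" using that b_le[of "snd P" Gl] XP[of P] Gl by auto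
      then show ?thesis unfolding pQ phi_def using ineqs that by simp
    qed
    show False
    proof (cases "\<forall>x\<in>E - G - Fs. \<exists>P\<in>X. x \<in> fst P \<inter> snd P")
      case False
      \<comment> \<open>Full length was reached while \<open>E - G - Fs\<close> still had an
        uncovered element. Then a value to the left of \<open>?Q\<close> is omitted, and so is
        \<open>Suc (phi ?Q)\<close>, because nothing was inserted to the right.\<close>
      then obtain z where z: "z \<in> E - G - Fs" "\<forall>P\<in>X. z \<notin> fst P \<inter> snd P" by blast
      then obtain v where v: "v \<in> {1..Suc N}" "\<forall>P\<in>X. (z \<in> fst P \<longrightarrow> v < phi P) \<and> (z \<notin> fst P \<longrightarrow> phi P < v)"
        using gap_value[OF X(2), of z] by blast
      have "z \<in> F" using z QF by blast
      then have v_lt: "v < phi ?Q" using v QX by force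
      have "phi P \<noteq> Suc (phi ?Q)" if P: "P \<in> X" for P
      proof -
        consider "P \<in> X0" | "P \<in> X - X0" using P by blast
        then show ?thesis
        proof cases
          case 1
          then consider "P = ?Q" | "fst P \<subseteq> Fs" "snd P = E" | "fst P = E" "snd P \<subseteq> Gl" using old by blast
          then show ?thesis
            using left[OF P] right[OF P] pQ ineqs by cases auto
        next
          case 2
          then have "biflat_le P ?Q" using X(1) False unfolding Inv_def by blast
          then show ?thesis using phi_le[OF XP[OF P] QF(8)] by simp
        qed
      qed
      then have "Suc (phi ?Q) \<notin> phi ` X" by force
      moreover have "Suc (phi ?Q) \<le> Suc N" using Suc_N ineqs unfolding pQ by simp
      moreover have "v \<notin> phi ` X" using v gap_value_notin by blast
      ultimately show False using two_missing[OF X(2,3) v(1), of "Suc (phi ?Q)"] v_lt by simp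
    next
      case True
      \<comment> \<open>Now the single omission is to the right of \<open>?Q\<close>. Hence all
        values between \<open>a Fs\<close> and \<open>phi ?Q\<close> occur, and the left entries
        climb in steps of one inside \<open>K\<close>.\<close>
      obtain z where z: "z \<in> E" "\<forall>P\<in>X. z \<notin> fst P \<inter> snd P" using biflag_in_uncovered[OF X(2)] by blast
      then obtain v where v: "v \<in> {1..Suc N}" "\<forall>P\<in>X. (z \<in> fst P \<longrightarrow> v < phi P) \<and> (z \<notin> fst P \<longrightarrow> phi P < v)"
        using gap_value[OF X(2), of z] by blast
      have "z \<notin> Fs" using z Fs_in X(1) unfolding Inv_def by force
      then have "z \<in> G" using True z by blast
      then have "z \<notin> F" using z QX by force
      then have v_gt: "phi ?Q < v" using v QX by force
      have v_notin: "v \<notin> phi ` X" using v gap_value_notin by blast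
      have all: "w \<in> phi ` X" if "1 \<le> w" "w < phi ?Q" for w
        using two_missing[OF X(2,3) v(1), of w] v_gt v_notin that v(1) by auto
      have reach: "w < phi ?Q \<Longrightarrow> \<exists>P. (P = (Fs, E) \<or> P \<in> X - X0 \<and> biflat_le P ?Q) \<and> phi P = w \<and> fst P \<subseteq> K"
        if "a Fs \<le> w" for w
        using that
      proof (induction w rule: dec_induct)
        case base
        have "phi (Fs, E) = a Fs" unfolding phi_def by simp
        then show ?case using K by (intro exI[of _ "(Fs, E)"]) auto
      next
        case (step w)
        have "w < phi ?Q" using step.prems by simp
        from step.IH[OF this] obtain P where
          P: "P = (Fs, E) \<or> P \<in> X - X0 \<and> biflat_le P ?Q" "phi P = w" "fst P \<subseteq> K" by blast
        obtain P' where P': "P' \<in> X" "phi P' = Suc w" using all[of "Suc w"] step.prems by (metis imageE le_add1 plus_1_eq_Suc)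
        \<comment> \<open>No old member has a value strictly between \<open>a Fs\<close> and
          \<open>phi ?Q\<close>.\<close>
        have "P' \<notin> X0"
        proof
          assume "P' \<in> X0"
          then consider "P' = ?Q" | "fst P' \<subseteq> Fs" "snd P' = E" | "fst P' = E" "snd P' \<subseteq> Gl" using old by blast
          then show False using left[OF P'(1)] right[OF P'(1)] P' step.hyps step.prems by cases auto
        qed
        then have P'X: "P' \<in> X - X0" using P' by blast
        have P'Q: "biflat_le P' ?Q"
          using biflat_le_if_phi_less[OF XP[OF P'(1)] QF(8) comp[OF P'(1) QX]] P' step.prems by simp
        have PP: "P \<in> Prs" using P(1) XP[of P] Fs(1) Fl2_E by (elim disjE) simp_all
        have PP': "biflat_le P P'"
        proof (cases "P = ({}, E)")
          case True
          then show ?thesis using Fl2_sub[of "snd P'"] XP[OF P'(1)] unfolding biflat_le_def by (simp add: mem_Times_iff)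
        next
          case False
          then have "P \<in> X" using P(1) Fs_in X(1) unfolding Inv_def by auto
          then show ?thesis using biflat_le_if_phi_less[OF PP XP[OF P'(1)] comp] P' P by simp
        qed
        have "fst P' \<subseteq> K"
        proof (cases "fst P = fst P'")
          case True
          then show ?thesis using P by simp
        next
          case False
          have m: "fst P \<in> Fl1" "fst P' \<in> Fl1" "snd P \<in> Fl2" "snd P' \<in> Fl2" using PP XP[OF P'(1)] by auto
          have sub: "fst P \<subset> fst P'" "snd P' \<subseteq> snd P" using False PP' unfolding biflat_le_def by auto
          have lt: "a (fst P) < a (fst P')" using a_less m sub by blast
          have bE: "b (snd P) \<le> b E" using b_le m Fl2_E Fl2_sub by blast
          \<comment> \<open>\<open>phi\<close> rises by one only, and the left entry already
            accounts for it.\<close>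
          have eq: "snd P = snd P'"
          proof (rule ccontr)
            assume "snd P \<noteq> snd P'"
            then have "b (snd P') < b (snd P)" using b_less m sub by blast
            then show False using lt bE P(2) P'(2) unfolding phi_def by linarith
          qed
          have suc: "a (fst P') = Suc (a (fst P))" using P(2) P'(2) eq unfolding phi_def by simp
          have dP': "d P' \<in> E - G" "d P' \<notin> Fs" "d P' \<in> fst P' \<inter> snd P'"
            using d P'X P'Q unfolding good_def by blast+
          \<comment> \<open>\<open>P'\<close> covers \<open>d P\<close>, so the disjunction in
            \<open>good\<close> leaves only that \<open>P\<close> does not cover
            \<open>d P'\<close>.\<close>
          have "d P' \<notin> fst P"
          proof (cases "P = (Fs, E)")
            case True
            then show ?thesis using dP' by simp
          next
            case False
            then have PX: "P \<in> X - X0" "biflat_le P ?Q" using P by auto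
            then have "d P \<in> fst P \<inter> snd P" using d unfolding good_def by blast
            then have "d P \<in> fst P' \<inter> snd P'" using sub eq by auto
            moreover have "P \<noteq> P'" using P P' by auto
            ultimately have "d P' \<notin> fst P \<inter> snd P" using d PX P'X P'Q unfolding good_def by blast
            then show ?thesis using dP' eq by auto
          qed
          moreover have "fst P' \<noteq> E" using P'Q QF(3) Q(2) unfolding biflat_le_def by auto
          ultimately show ?thesis
            using cover[OF m(1,2) sub(1) _ suc _ _ K(1) P(3)] dP' K by blast
        qed
        then show ?case using P'X P'Q P' by blast
      qed
      have last: "a Fs \<le> phi ?Q - 1" "phi ?Q - 1 < phi ?Q" using pQ ineqs by auto
      from reach[OF last] obtain P where
        P: "P = (Fs, E) \<or> P \<in> X - X0 \<and> biflat_le P ?Q" "phi P = phi ?Q - 1" "fst P \<subseteq> K" by blast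
      have PP: "P \<in> Prs" using P(1) XP[of P] Fs(1) Fl2_E by (elim disjE) simp_all
      have PQ: "biflat_le P ?Q" using P(1) Fs QF unfolding biflat_le_def by auto
      have m: "fst P \<in> Fl1" "snd P \<in> Fl2" using PP by auto
      have sub: "fst P \<subset> F" "G \<subseteq> snd P" using PQ P(3) K(4) unfolding biflat_le_def by auto
      \<comment> \<open>\<open>F\<close> is not contained in \<open>K\<close>, so the last step
        before \<open>?Q\<close> changes the left entry and hence not the right one. But
        \<open>d P\<close> is in the right entry of \<open>P\<close> and outside
        \<open>G\<close>.\<close>
      have "snd P = G"
      proof (rule ccontr)
        assume "snd P \<noteq> G"
        then have "b G < b (snd P)" using b_less m sub QF by blast
        moreover have "b (snd P) \<le> b E" using b_le m Fl2_E Fl2_sub by blast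
        moreover have "a (fst P) < a F" using a_less m sub QF by blast
        ultimately show False using P(2) last unfolding pQ phi_def fst_conv snd_conv by linarith
      qed
      moreover have "d P \<in> E - G \<and> d P \<in> snd P" if "P \<noteq> (Fs, E)"
        using d P(1) that unfolding good_def by auto
      ultimately show False using Q(3) by (cases "P = (Fs, E)") auto
    qed
  qed
qed

end

section \<open>The conormal Chow ring\<close>

lemma gen_ideal_zero: "0 \<in> gen_ideal R"
  unfolding gen_ideal_def by (rule CollectI, rule exI[of _ "{}"]) simp

lemma gen_ideal_base: "g \<in> R \<Longrightarrow> g \<in> gen_ideal R"
  unfolding gen_ideal_def by (rule CollectI, rule exI[of _ "{g}"], rule exI[of _ "\<lambda>_. 1"]) simp

lemma gen_ideal_mult: "p \<in> gen_ideal R \<Longrightarrow> q * p \<in> gen_ideal R"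
proof -
  assume "p \<in> gen_ideal R"
  then obtain A c where "finite A" "A \<subseteq> R" "p = (\<Sum>g\<in>A. c g * g)" unfolding gen_ideal_def by blast
  moreover from this have "q * p = (\<Sum>g\<in>A. (q * c g) * g)"
    by (simp add: sum_distrib_left mult.assoc)
  ultimately show ?thesis
    unfolding gen_ideal_def by (intro CollectI exI[of _ A] exI[of _ "\<lambda>g. q * c g"]) simp
qed

lemma gen_ideal_add:
  assumes "p \<in> gen_ideal R" "q \<in> gen_ideal R"
  shows "p + q \<in> gen_ideal R"
proof -
  obtain A c where A: "finite A" "A \<subseteq> R" "p = (\<Sum>g\<in>A. c g * g)"
    using assms(1) unfolding gen_ideal_def by blast
  obtain B d where B: "finite B" "B \<subseteq> R" "q = (\<Sum>g\<in>B. d g * g)"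
    using assms(2) unfolding gen_ideal_def by blast
  define f where "f g = (if g \<in> A then c g else 0) + (if g \<in> B then d g else 0)" for g
  have "p = (\<Sum>g\<in>A \<union> B. (if g \<in> A then c g else 0) * g)"
    unfolding A(3) using A B by (intro sum.mono_neutral_cong_left) auto
  moreover have "q = (\<Sum>g\<in>A \<union> B. (if g \<in> B then d g else 0) * g)"
    unfolding B(3) using A B by (intro sum.mono_neutral_cong_left) auto
  ultimately have "p + q = (\<Sum>g\<in>A \<union> B. f g * g)"
    unfolding f_def by (simp only: distrib_right sum.distrib)
  then show ?thesis
    unfolding gen_ideal_def using A B by (intro CollectI exI[of _ "A \<union> B"] exI[of _ f]) simp
qed

lemma chow_eq_refl: "chow_eq E Bs p p"
  unfolding chow_eq_def by (simp add: gen_ideal_zero)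

lemma chow_eq_trans: "chow_eq E Bs p q \<Longrightarrow> chow_eq E Bs q s \<Longrightarrow> chow_eq E Bs p s"
  unfolding chow_eq_def using gen_ideal_add[of "p - q" _ "q - s"] by simp

lemma chow_eq_add: "chow_eq E Bs p q \<Longrightarrow> chow_eq E Bs p' q' \<Longrightarrow> chow_eq E Bs (p + p') (q + q')"
  unfolding chow_eq_def using gen_ideal_add[of "p - q" _ "p' - q'"] by (simp add: algebra_simps)

lemma chow_eq_mult: "chow_eq E Bs p q \<Longrightarrow> chow_eq E Bs (s * p) (s * q)"
  unfolding chow_eq_def using gen_ideal_mult[of "p - q" _ s] by (simp add: algebra_simps)

lemma chow_eq_sum: "(\<And>x. x \<in> A \<Longrightarrow> chow_eq E Bs (f x) (g x)) \<Longrightarrow> chow_eq E Bs (sum f A) (sum g A)"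
  by (induction A rule: infinite_finite_induct) (auto intro: chow_eq_refl chow_eq_add)

lemma chow_zero_mult: "chow_eq E Bs p 0 \<Longrightarrow> chow_eq E Bs (s * p) 0"
  using chow_eq_mult[of E Bs p 0 s] by simp

lemma chow_zero_sum: "(\<And>x. x \<in> A \<Longrightarrow> chow_eq E Bs (f x) 0) \<Longrightarrow> chow_eq E Bs (sum f A) 0"
  using chow_eq_sum[of A E Bs f "\<lambda>_. 0"] by simp

lemma xmon_insert: "finite X \<Longrightarrow> P \<notin> X \<Longrightarrow> xmon (insert P X) = var P * xmon X"
  unfolding xmon_def by simp

lemma biflats_iff: "P \<in> biflats E Bs \<longleftrightarrow> flat E Bs (fst P) \<and> flat E (dual_bases E Bs) (snd P) \<and>
    fst P \<noteq> {} \<and> snd P \<noteq> {} \<and> \<not> (fst P = E \<and> snd P = E) \<and> fst P \<union> snd P = E"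
  unfolding biflats_def biflat_def by (cases P) auto

lemma flat_subset: "flat E Bs F \<Longrightarrow> F \<subseteq> E"
  unfolding flat_def by blast

lemma gamma_alt: "gamma E Bs i = (\<Sum>P\<in>{P \<in> biflats E Bs. i \<in> fst P \<and> fst P \<noteq> E}. var P)"
  unfolding gamma_def by (rule sum.cong) auto

lemma delta_alt: "delta E Bs i = (\<Sum>P\<in>{P \<in> biflats E Bs. i \<in> fst P \<inter> snd P}. var P)"
  unfolding delta_def by (rule sum.cong) auto

lemma gammabar_alt: "gammabar E Bs i = (\<Sum>P\<in>{P \<in> biflats E Bs. i \<in> snd P \<and> snd P \<noteq> E}. var P)"
  unfolding gammabar_def by (rule sum.cong) auto

lemma chow_gamma_eq: "i \<in> E \<Longrightarrow> j \<in> E \<Longrightarrow> chow_eq E Bs (gamma E Bs i) (gamma E Bs j)"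
  unfolding chow_eq_def by (rule gen_ideal_base) (auto simp: chow_relations_def)

lemma chow_gammabar_eq: "i \<in> E \<Longrightarrow> j \<in> E \<Longrightarrow> chow_eq E Bs (gammabar E Bs i) (gammabar E Bs j)"
  unfolding chow_eq_def by (rule gen_ideal_base) (auto simp: chow_relations_def)

lemma xmon_not_biflag: "X \<subseteq> biflats E Bs \<Longrightarrow> \<not> biflag E Bs X \<Longrightarrow> chow_eq E Bs (xmon X) 0"
  unfolding chow_eq_def by (simp, rule gen_ideal_base) (auto simp: chow_relations_def)

section \<open>Products with representatives of \<gamma> and \<delta>\<close>

context nat_matroid
begin

abbreviation "Bfs \<equiv> biflats E Bs"
abbreviation ceq (infix "\<approx>" 50) where "p \<approx> q \<equiv> chow_eq E Bs p q"

lemma finite_biflats: "finite Bfs"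
proof (rule finite_subset)
  show "Bfs \<subseteq> Pow E \<times> Pow E" unfolding biflats_def biflat_def flat_def by auto
qed simp

lemma finite_subset_biflats: "X \<subseteq> Bfs \<Longrightarrow> finite X"
  by (rule finite_subset[OF _ finite_biflats])

text \<open>Since \<open>F \<union> G = E\<close>, the indicator of \<open>i \<in> F \<inter> G\<close> is that of \<open>i \<in> F\<close> plus that of
  \<open>i \<in> G\<close> minus one.\<close>

lemma delta_expand:
  assumes "i \<in> E"
  shows "delta E Bs i = gamma E Bs i + gammabar E Bs i + (\<Sum>P\<in>{P \<in> Bfs. fst P = E}. var P)
    + (\<Sum>P\<in>{P \<in> Bfs. snd P = E}. var P) - (\<Sum>P\<in>Bfs. var P)"
proof -
  have ind: "(\<Sum>P\<in>{P \<in> Bfs. Q P}. var P) = (\<Sum>P\<in>Bfs. if Q P then var P else 0)" for Q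
    using finite_biflats by (rule sum.inter_filter)
  have "delta E Bs i + (\<Sum>P\<in>Bfs. var P) = gamma E Bs i + gammabar E Bs i +
     (\<Sum>P\<in>{P \<in> Bfs. fst P = E}. var P) + (\<Sum>P\<in>{P \<in> Bfs. snd P = E}. var P)"
    unfolding delta_alt gamma_alt gammabar_alt ind sum.distrib[symmetric]
    by (rule sum.cong) (use assms in \<open>auto simp: biflats_iff\<close>)
  then show ?thesis by (simp add: algebra_simps)
qed

lemma chow_delta_eq: "i \<in> E \<Longrightarrow> j \<in> E \<Longrightarrow> delta E Bs i \<approx> delta E Bs j"
proof -
  assume ij: "i \<in> E" "j \<in> E"
  have "delta E Bs i - delta E Bs j = (gamma E Bs i + gammabar E Bs i) - (gamma E Bs j + gammabar E Bs j)"
    unfolding delta_expand[OF ij(1)] delta_expand[OF ij(2)] by simp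
  moreover have "gamma E Bs i + gammabar E Bs i \<approx> gamma E Bs j + gammabar E Bs j"
    by (intro chow_eq_add chow_gamma_eq chow_gammabar_eq ij)
  ultimately show ?thesis unfolding chow_eq_def by simp
qed

text \<open>Represent one factor \<gamma> at an element \<open>c\<close> outside the flat. The terms
  with a compatible biflat have a strictly larger proper flat, so the corank falls with each factor,
  while a proper flat has positive corank.\<close>

lemma gamma_power_var_zero:
  assumes "P \<in> Bfs" "fst P \<noteq> E" "rk E \<le> rk (fst P) + m" "i \<in> E"
  shows "gamma E Bs i ^ m * var P \<approx> 0"
  using assms
proof (induction m arbitrary: P)
  case 0
  then have "flat E Bs (fst P)" using biflats_iff by blast
  then have False using flat_eq_E_iff 0(2,3) rk_le_rk_E[of "fst P"] by simp
  then show ?case ..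
next
  case (Suc m)
  have P: "flat E Bs (fst P)" using Suc.prems(1) biflats_iff by blast
  have "fst P \<subseteq> E" by (rule flat_subset[OF P])
  then obtain c where c: "c \<in> E" "c \<notin> fst P" using Suc.prems(2) by blast
  have "gamma E Bs i ^ m * var P * var Q \<approx> 0" if Q: "Q \<in> Bfs" "c \<in> fst Q" "fst Q \<noteq> E" for Q
  proof (cases "compatible P Q")
    case True
    have "fst P \<subseteq> fst Q" using True Q(2) c unfolding compatible_iff_biflat_le biflat_le_def by auto
    then have "fst P \<subset> fst Q" using c Q by blast
    moreover have "flat E Bs (fst Q)" using Q(1) biflats_iff by blast
    ultimately have "rk (fst P) < rk (fst Q)" using flat_rk_less[OF P] flat_subset by blast
    then have "gamma E Bs i ^ m * var Q \<approx> 0" using Suc.IH[OF Q(1,3) _ Suc.prems(4)] Suc.prems(3) by simp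
    then have "var P * (gamma E Bs i ^ m * var Q) \<approx> 0" by (rule chow_zero_mult)
    then show ?thesis by (simp add: mult_ac)
  next
    case False
    then have "\<not> biflag E Bs {P, Q}" unfolding biflag_def by blast
    then have "xmon {P, Q} \<approx> 0" using Suc.prems Q by (intro xmon_not_biflag) auto
    moreover have "P \<noteq> Q" using c Q by auto
    ultimately have "var P * var Q \<approx> 0" by (simp add: xmon_def)
    then have "gamma E Bs i ^ m * (var P * var Q) \<approx> 0" by (rule chow_zero_mult)
    then show ?thesis by (simp add: mult_ac)
  qed
  then have "(\<Sum>Q\<in>{Q \<in> Bfs. c \<in> fst Q \<and> fst Q \<noteq> E}. gamma E Bs i ^ m * var P * var Q) \<approx> 0"
    by (intro chow_zero_sum) blast
  then have "gamma E Bs i ^ m * var P * gamma E Bs c \<approx> 0"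
    unfolding gamma_alt[of E Bs c] by (simp add: sum_distrib_left)
  moreover have "gamma E Bs i ^ m * var P * gamma E Bs i \<approx> gamma E Bs i ^ m * var P * gamma E Bs c"
    using Suc.prems c by (intro chow_eq_mult chow_gamma_eq)
  ultimately have "gamma E Bs i ^ m * var P * gamma E Bs i \<approx> 0" by (rule chow_eq_trans[rotated])
  then show ?case by (simp add: mult_ac)
qed

lemma gamma_power_xmon_zero:
  assumes X: "X \<subseteq> Bfs" "P \<in> X" and P: "fst P \<noteq> E" "rk E \<le> rk (fst P) + m" "i \<in> E"
  shows "gamma E Bs i ^ m * xmon X \<approx> 0"
proof -
  have "xmon X = var P * xmon (X - {P})"
    using xmon_insert[of "X - {P}" P] X finite_subset_biflats[OF X(1)] by (simp add: insert_absorb)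
  moreover have "xmon (X - {P}) * (gamma E Bs i ^ m * var P) \<approx> 0"
    using assms by (intro chow_zero_mult gamma_power_var_zero) auto
  ultimately show ?thesis by (simp add: mult_ac)
qed

text \<open>Since \<open>e\<close> is uncovered, no variable of \<delta> at \<open>e\<close> occurs
  in the monomial yet, and the product stays squarefree.\<close>

lemma delta_times_xmon:
  assumes X: "X \<subseteq> Bfs" and e: "\<forall>P\<in>X. e \<notin> fst P \<inter> snd P"
  shows "delta E Bs e * xmon X = (\<Sum>P\<in>{P \<in> Bfs. e \<in> fst P \<inter> snd P}. xmon (insert P X))"
  unfolding delta_alt sum_distrib_right
  by (rule sum.cong[OF refl], subst xmon_insert) (use e finite_subset_biflats[OF X] in auto)

text \<open>All other biflats are annihilated by the \<open>k\<close>-th power of \<gamma>.\<close>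

definition large_corank_biflats :: "nat \<Rightarrow> (nat set \<times> nat set) set" where
  "large_corank_biflats k = {P \<in> Bfs. fst P = E \<or> rk (fst P) + k < rk E}"

text \<open>Induction on the certificate, with \<open>chow_delta_eq\<close> for the change of
  representative. Terms that leave \<open>large_corank_biflats k\<close> are not followed by the
  certificate; they vanish by \<open>gamma_power_xmon_zero\<close>.\<close>

lemma vanishing_imp_zero:
  assumes "vanishing E (large_corank_biflats k) N X" "X \<subseteq> Bfs" "card X \<le> N" "i \<in> E" "j \<in> E"
  shows "gamma E Bs i ^ k * (delta E Bs j ^ (N - card X) * xmon X) \<approx> 0"
  using assms
proof (induction rule: vanishing.induct)
  case (stop X)
  show ?case
  proof (cases "X \<subseteq> large_corank_biflats k")
    case True
    then have "\<not> biflag E Bs X"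
      using stop unfolding biflag_in_def biflag_def biflats_def by blast
    then show ?thesis using stop by (intro chow_zero_mult xmon_not_biflag)
  next
    case False
    then obtain P where P: "P \<in> X" "fst P \<noteq> E" "rk E \<le> rk (fst P) + k"
      using stop(2) unfolding large_corank_biflats_def by fastforce
    have "delta E Bs j ^ (N - card X) * (gamma E Bs i ^ k * xmon X) \<approx> 0"
      using stop P by (intro chow_zero_mult gamma_power_xmon_zero) auto
    then show ?thesis by (simp add: mult_ac)
  qed
next
  case (expand X e)
  have card: "card (insert P X) = Suc (card X)" if "e \<in> fst P \<inter> snd P" for P
    using that expand.hyps finite_subset_biflats[OF expand.prems(1)] by (subst card_insert_disjoint) auto
  let ?c = "gamma E Bs i ^ k * delta E Bs j ^ (N - Suc (card X))"
  have zero: "?c * xmon (insert P X) \<approx> 0" if P: "P \<in> Bfs" "e \<in> fst P \<inter> snd P" for P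
  proof (cases "P \<in> large_corank_biflats k")
    case True
    then have "gamma E Bs i ^ k * (delta E Bs j ^ (N - card (insert P X)) * xmon (insert P X)) \<approx> 0"
      using expand P card[OF P(2)] by auto
    then show ?thesis using card[OF P(2)] by (simp add: mult_ac)
  next
    case False
    then have "delta E Bs j ^ (N - Suc (card X)) * (gamma E Bs i ^ k * xmon (insert P X)) \<approx> 0"
      using expand P unfolding large_corank_biflats_def
      by (intro chow_zero_mult gamma_power_xmon_zero[of _ P]) auto
    then show ?thesis by (simp add: mult_ac)
  qed
  have "?c * (delta E Bs e * xmon X) \<approx> 0"
    unfolding delta_times_xmon[OF expand.prems(1) expand.hyps(3)] sum_distrib_left
    using zero by (intro chow_zero_sum) blast
  moreover have "?c * xmon X * delta E Bs j \<approx> ?c * xmon X * delta E Bs e"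
    using expand by (intro chow_eq_mult chow_delta_eq) auto
  ultimately have "?c * xmon X * delta E Bs j \<approx> 0"
    using chow_eq_trans[of E Bs _ "?c * xmon X * delta E Bs e"] by (simp add: mult_ac)
  moreover have "delta E Bs j ^ (N - card X) = delta E Bs j * delta E Bs j ^ (N - Suc (card X))"
    using expand.hyps(1) by (simp add: Suc_diff_Suc flip: power_Suc)
  ultimately show ?case by (simp add: mult_ac)
qed

end

section \<open>The order of choices and nbc bases\<close>

definition above :: "nat set \<Rightarrow> nat \<Rightarrow> nat set" where
  "above X e = {x \<in> X. e < x}"

lemma above_subset: "above X e \<subseteq> X"
  unfolding above_def by blast

lemma above_mono: "X \<subseteq> Y \<Longrightarrow> e \<le> f \<Longrightarrow> above X f \<subseteq> above Y e"
  unfolding above_def by auto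

context nat_matroid
begin

abbreviation "dBs \<equiv> dual_bases E Bs"
abbreviation "cl' \<equiv> mcl E dBs"
abbreviation "rk' \<equiv> mrank dBs"

definition uncovered :: "nat set \<Rightarrow> nat set \<Rightarrow> nat set" where
  "uncovered S T = E - (cl S \<union> cl' T)"

definition is_next :: "nat set \<Rightarrow> nat set \<Rightarrow> nat \<Rightarrow> bool" where
  "is_next S T e \<longleftrightarrow> e \<in> uncovered S T \<and> (\<forall>y\<in>uncovered S T. y \<le> e)"

text \<open>The pairs of sets of elements chosen, on the left and on the right, in the expansion of a
  power of \<open>\<delta>\<close> in which \<open>\<delta>\<close> is always represented by \<open>\<delta>\<^sub>e\<close> for the largest uncovered \<open>e\<close>.\<close>

definition valid_choice :: "nat set \<Rightarrow> nat set \<Rightarrow> bool" where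
  "valid_choice S T \<longleftrightarrow> S \<subseteq> E \<and> T \<subseteq> E \<and> S \<inter> T = {} \<and> (\<forall>e\<in>S \<union> T. is_next (above S e) (above T e) e)"

section \<open>The forced order of choices\<close>

lemma is_next_unique: "is_next S T e \<Longrightarrow> is_next S T f \<Longrightarrow> e = f"
  unfolding is_next_def by (metis order_antisym)

lemma is_next_exists: "uncovered S T \<noteq> {} \<Longrightarrow> \<exists>e. is_next S T e"
proof -
  assume ne: "uncovered S T \<noteq> {}"
  have fin: "finite (uncovered S T)" unfolding uncovered_def by simp
  show ?thesis unfolding is_next_def using Max_in[OF fin ne] Max_ge[OF fin] by blast
qed

lemma cl'_mono: "X \<subseteq> Y \<Longrightarrow> cl' X \<subseteq> cl' Y"
proof -
  interpret d: nat_matroid E dBs by (rule nat_matroid_dual)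
  show "X \<subseteq> Y \<Longrightarrow> cl' X \<subseteq> cl' Y" by (rule d.cl_mono)
qed

lemma subset_cl': "X \<subseteq> E \<Longrightarrow> X \<subseteq> cl' X"
proof -
  interpret d: nat_matroid E dBs by (rule nat_matroid_dual)
  show "X \<subseteq> E \<Longrightarrow> X \<subseteq> cl' X" by (rule d.subset_cl)
qed

lemma uncovered_antimono: "S \<subseteq> S' \<Longrightarrow> T \<subseteq> T' \<Longrightarrow> uncovered S' T' \<subseteq> uncovered S T"
  unfolding uncovered_def using cl_mono[of S S'] cl'_mono[of T T'] by blast

text \<open>Add the elements from the largest down: none is spanned by those added before.\<close>

lemma ind_by_order:
  assumes "finite X" "X \<subseteq> E" "\<forall>e\<in>X. e \<notin> cl (above X e)"
  shows "ind X"
  using assms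
proof (induction X rule: finite_linorder_min_induct)
  case empty
  show ?case by (rule ind_empty)
next
  case (insert b A)
  have up1: "above (insert b A) e = above A e" if "e \<in> A" for e
    using that insert.hyps unfolding above_def by auto
  have up2: "above (insert b A) b = A" using insert.hyps unfolding above_def by auto
  have "ind A" using insert up1 by auto
  then show ?case using ind_insert_cl[of A b] insert.prems up2 by auto
qed

lemma valid_ind: "valid_choice S T \<Longrightarrow> ind S"
proof (rule ind_by_order)
  assume v: "valid_choice S T"
  show "finite S" using v finite_E finite_subset unfolding valid_choice_def by metis
  show "S \<subseteq> E" using v unfolding valid_choice_def by simp
  show "\<forall>e\<in>S. e \<notin> cl (above S e)" using v unfolding valid_choice_def is_next_def uncovered_def by auto
qed

lemma valid_ind': "valid_choice S T \<Longrightarrow> indep dBs T"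
proof -
  interpret d: nat_matroid E dBs by (rule nat_matroid_dual)
  assume v: "valid_choice S T"
  show ?thesis
  proof (rule d.ind_by_order)
    show "finite T" using v finite_E finite_subset unfolding valid_choice_def by metis
    show "T \<subseteq> E" using v unfolding valid_choice_def by simp
    show "\<forall>e\<in>T. e \<notin> cl' (above T e)" using v unfolding valid_choice_def is_next_def uncovered_def by auto
  qed
qed

lemma next_notin:
  assumes "S \<subseteq> E" "T \<subseteq> E" "is_next S T e"
  shows "e \<in> E" "e \<notin> S" "e \<notin> T" "e \<notin> cl S" "e \<notin> cl' T"
  using assms subset_cl[OF assms(1)] subset_cl'[OF assms(2)] unfolding is_next_def uncovered_def by auto

text \<open>Uncovered sets only shrink, so \<open>e\<close> was already a candidate when
  \<open>f\<close> was taken as the largest one.\<close>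

lemma next_less:
  assumes v: "valid_choice S T" and e: "is_next S T e" and f: "f \<in> S \<union> T"
  shows "e < f"
proof -
  have "is_next (above S f) (above T f) f" using v f unfolding valid_choice_def by blast
  moreover have "e \<in> uncovered (above S f) (above T f)"
    using e uncovered_antimono[OF above_subset above_subset] unfolding is_next_def by blast
  ultimately have "e \<le> f" unfolding is_next_def by blast
  moreover have "e \<noteq> f" using next_notin[OF _ _ e] v f unfolding valid_choice_def by blast
  ultimately show ?thesis by simp
qed

lemma above_insert_less: "\<forall>f\<in>X. e < f \<Longrightarrow> above (insert e X) e = X"
  unfolding above_def by auto

lemma above_insert_other: "e < f \<Longrightarrow> above (insert e X) f = above X f"
  unfolding above_def by auto

lemma above_all: "\<forall>f\<in>X. e < f \<Longrightarrow> above X e = X"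
  unfolding above_def by auto

text \<open>The next element may go to either side. Being smaller than all earlier choices, it
  changes none of their sets \<open>above\<close>.\<close>

lemma valid_insert:
  assumes v: "valid_choice S T" and e: "is_next S T e"
  shows "valid_choice (insert e S) T" "valid_choice S (insert e T)"
proof -
  have ST: "S \<subseteq> E" "T \<subseteq> E" "S \<inter> T = {}" using v unfolding valid_choice_def by auto
  note ne = next_notin[OF ST(1,2) e]
  have less: "\<forall>f\<in>S. e < f" "\<forall>f\<in>T. e < f" using next_less[OF v e] by auto
  have old: "is_next (above S f) (above T f) f" if "f \<in> S \<union> T" for f using that v unfolding valid_choice_def by blast
  have "is_next (above (insert e S) f) (above T f) f" if "f \<in> insert e S \<union> T" for f
  proof (cases "f = e")
    case True
    then show ?thesis using e less by (simp add: above_insert_less above_all)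
  next
    case False
    then have f: "f \<in> S \<union> T" using that by auto
    then show ?thesis using old[OF f] next_less[OF v e f] by (simp add: above_insert_other)
  qed
  then show "valid_choice (insert e S) T" unfolding valid_choice_def using ST ne by auto
  have "is_next (above S f) (above (insert e T) f) f" if "f \<in> S \<union> insert e T" for f
  proof (cases "f = e")
    case True
    then show ?thesis using e less by (simp add: above_insert_less above_all)
  next
    case False
    then have f: "f \<in> S \<union> T" using that by auto
    then show ?thesis using old[OF f] next_less[OF v e f] by (simp add: above_insert_other)
  qed
  then show "valid_choice S (insert e T)" unfolding valid_choice_def using ST ne by auto
qed

lemma valid_remove_min:
  assumes v: "valid_choice S T" and x: "x \<in> T" "\<forall>f\<in>S \<union> T. x \<le> f"
  shows "valid_choice S (T - {x})" "is_next S (T - {x}) x"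
proof -
  have ST: "S \<subseteq> E" "T \<subseteq> E" "S \<inter> T = {}" using v unfolding valid_choice_def by auto
  have old: "is_next (above S f) (above T f) f" if "f \<in> S \<union> T" for f using that v unfolding valid_choice_def by blast
  have less: "x < f" if "f \<in> S \<union> (T - {x})" for f
    using that x ST by (metis DiffE IntI UnE UnI1 UnI2 empty_iff insertI1 order_le_less)
  have "above S x = S" "above T x = T - {x}" using less unfolding above_def by auto
  then show "is_next S (T - {x}) x" using old[of x] x by simp
  have "is_next (above S f) (above (T - {x}) f) f" if f: "f \<in> S \<union> (T - {x})" for f
  proof -
    have "above (T - {x}) f = above T f" using less[OF f] unfolding above_def by auto
    then show ?thesis using old[of f] f by auto
  qed
  then show "valid_choice S (T - {x})" unfolding valid_choice_def using ST by auto
qed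

text \<open>Above the largest new element \<open>e\<close> both pairs agree, so \<open>e\<close> is
  next at that stage. If \<open>S \<union> T\<close> had elements below \<open>e\<close>, the
  largest of them would be next at the same stage and thus equal to \<open>e\<close>.\<close>

lemma valid_extension:
  assumes v: "valid_choice S T" and v': "valid_choice S' T'" and sub: "S \<subseteq> S'" "T \<subseteq> T'"
    and ne: "S \<noteq> S' \<or> T \<noteq> T'"
  shows "\<exists>e. is_next S T e \<and> e \<in> S' \<union> T'"
proof -
  define D where "D = (S' - S) \<union> (T' - T)"
  have ST: "S' \<subseteq> E" "T' \<subseteq> E" "S' \<inter> T' = {}" using v' unfolding valid_choice_def by auto
  have fin: "finite S'" "finite T'" using ST finite_E finite_subset by metis+
  then have finD: "finite D" "D \<noteq> {}" using ne sub unfolding D_def by auto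
  define e where "e = Max D"
  have eD: "e \<in> D" unfolding e_def by (rule Max_in[OF finD])
  have top: "x \<le> e" if "x \<in> D" for x unfolding e_def by (rule Max_ge[OF finD(1) that])
  have eS: "e \<notin> S" "e \<notin> T" "e \<in> S' \<union> T'" using eD sub ST unfolding D_def by auto
  have "above S' e = above S e" "above T' e = above T e" using top sub unfolding above_def D_def by force+
  moreover have "is_next (above S' e) (above T' e) e" using v' eS(3) unfolding valid_choice_def by blast
  ultimately have e: "is_next (above S e) (above T e) e" by simp
  have "e < f" if f: "f \<in> S \<union> T" for f
  proof (rule ccontr)
    assume "\<not> e < f"
    define L where "L = {f \<in> S \<union> T. f < e}"
    have "f \<noteq> e" using f eS by auto
    then have L: "finite L" "L \<noteq> {}" using f fin sub finite_subset \<open>\<not> e < f\<close> unfolding L_def by auto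
    define g where "g = Max L"
    have g: "g \<in> S \<union> T" "g < e" using Max_in[OF L] unfolding g_def L_def by auto
    have gtop: "x \<le> g" if "x \<in> S \<union> T" "x < e" for x
      using Max_ge[OF L(1)] that unfolding g_def L_def by auto
    have "e < x" if "x \<in> S \<union> T" "g < x" for x
      using gtop[of x] that eS(1,2) by (metis UnE linorder_neqE_nat not_less)
    then have "above S g = above S e" "above T g = above T e" using g(2) unfolding above_def by auto
    moreover have "is_next (above S g) (above T g) g" using v g unfolding valid_choice_def by blast
    ultimately have "g = e" using is_next_unique e by metis
    then show False using g by simp
  qed
  then have "above S e = S" "above T e = T" by (auto intro!: above_all)
  then show ?thesis using e eS(3) by auto
qed

section \<open>Nbc bases as completed choices\<close>

lemma SB_subset: "SB E Bs B \<subseteq> B"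
  unfolding SB_def by blast

lemma nbc_basis_iff: "nbc_basis E Bs B \<longleftrightarrow> B \<in> Bs \<and> (\<forall>t\<in>E - B. t \<notin> cl (above B t))"
  unfolding nbc_basis_def using in_EA_iff[of B] unfolding above_def by blast

lemma in_IA_above: "B \<in> Bs \<Longrightarrow> i \<in> IA E Bs B \<longleftrightarrow> i \<in> B \<and> i \<in> cl' (above (E - B) i)"
  using in_IA_iff unfolding above_def .

text \<open>Internally active elements are spanned in the dual by the larger elements of
  \<open>E - B\<close>, so they are covered when their turn comes. All others are uncovered at their
  turn: on one side by independence, on the other side because they are inactive.\<close>

lemma nbc_valid:
  assumes "nbc_basis E Bs B"
  shows "valid_choice (SB E Bs B) (E - B)"
proof -
  interpret d: nat_matroid E dBs by (rule nat_matroid_dual)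
  let ?S = "SB E Bs B" and ?T = "E - B"
  have B: "B \<in> Bs" and nbc: "\<forall>t\<in>E - B. t \<notin> cl (above B t)" using assms nbc_basis_iff by auto
  have iB: "ind B" by (rule ind_basis[OF B])
  have iT: "d.ind ?T" using B by (intro d.ind_basis) (simp add: dual_bases_def)
  have BE: "B \<subseteq> E" by (rule basis_subset[OF B])
  have S_E: "?S \<subseteq> E" using BE SB_subset by blast
  have next_e: "is_next (above ?S e) (above ?T e) e" if e: "e \<in> ?S \<union> ?T" for e
  proof -
    have eE: "e \<in> E" using e S_E by blast
    have irr: "e \<notin> above X e" for X unfolding above_def by simp
    have "e \<notin> cl (above ?S e)"
    proof (cases "e \<in> B")
      case True
      then show ?thesis using ind_notin_cl[OF iB True _ irr] above_subset SB_subset by blast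
    next
      case False
      then have "e \<notin> cl (above B e)" using nbc eE by blast
      then show ?thesis using cl_mono[OF above_mono[OF SB_subset order_refl]] by blast
    qed
    moreover have "e \<notin> cl' (above ?T e)"
    proof (cases "e \<in> B")
      case True
      then have "e \<notin> IA E Bs B" using e unfolding SB_def by blast
      then show ?thesis using in_IA_above[OF B] True by blast
    next
      case False
      then show ?thesis using d.ind_notin_cl[OF iT _ above_subset irr] eE by blast
    qed
    ultimately have "e \<in> uncovered (above ?S e) (above ?T e)" unfolding uncovered_def using eE by blast
    moreover have "y \<le> e" if y: "y \<in> uncovered (above ?S e) (above ?T e)" for y
    proof (rule ccontr)
      assume "\<not> y \<le> e"
      then have ey: "e < y" by simp
      have yE: "y \<in> E" using y unfolding uncovered_def by blast
      consider "y \<in> ?S" | "y \<in> ?T" | "y \<in> IA E Bs B" using yE unfolding SB_def by blast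
      then have "y \<in> cl (above ?S e) \<union> cl' (above ?T e)"
      proof cases
        case 1
        then have "y \<in> above ?S e" using ey unfolding above_def by blast
        then show ?thesis using subset_cl[of "above ?S e"] above_subset[of ?S] S_E by blast
      next
        case 2
        then have "y \<in> above ?T e" using ey unfolding above_def by blast
        then show ?thesis using subset_cl'[of "above ?T e"] above_subset[of ?T] by blast
      next
        case 3
        then have "y \<in> cl' (above ?T y)" using in_IA_above[OF B] by blast
        moreover have "above ?T y \<subseteq> above ?T e" using ey by (intro above_mono) auto
        ultimately show ?thesis using cl'_mono by blast
      qed
      then show False using y unfolding uncovered_def by blast
    qed
    ultimately show ?thesis unfolding is_next_def by blast
  qed
  then show ?thesis unfolding valid_choice_def using S_E SB_subset by blast
qed

text \<open>Otherwise the fundamental circuit of \<open>t\<close> consists of \<open>t\<close> and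
  larger, hence covered, elements. \<open>T0\<close> is disjoint from the circuit, so by
  orthogonality it spans none of them in the dual. Then \<open>S0\<close> spans them, and with them
  \<open>t\<close>.\<close>

lemma next_not_spanned_above:
  assumes B: "B \<in> Bs" and t: "t \<in> E - B" "is_next S0 T0 t" and S0: "S0 \<subseteq> E"
    and T0: "T0 \<subseteq> E" "T0 \<inter> B = {}" "t \<notin> T0"
  shows "t \<notin> cl (above B t)"
proof
  let ?C = "fund_circuit E Bs B t"
  assume "t \<in> cl (above B t)"
  then have C_above: "?C \<subseteq> insert t (above B t)"
    using in_cl_iff_fund_circuit_subset[OF B t(1) above_subset] by blast
  have C: "circuit E Bs ?C" "t \<in> ?C" "?C \<subseteq> insert t B"
    using circuit_fund_circuit[OF B t(1)] in_fund_circuit[OF B t(1)] fund_circuit_subset[OF B t(1)] by auto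
  have C_E: "?C \<subseteq> E" using C unfolding circuit_def by blast
  have in_rest: "b \<in> cl (?C - {b})" if b: "b \<in> ?C" for b
  proof -
    have "ind (?C - {b})" "\<not> ind (insert b (?C - {b}))"
      using C b unfolding circuit_def by (auto simp: insert_absorb)
    then show ?thesis using in_cl_ind[of "?C - {b}" b] C_E b by blast
  qed
  have "b \<in> cl S0" if b: "b \<in> ?C - {t}" for b
  proof (rule ccontr)
    assume n: "b \<notin> cl S0"
    have "t < b" using b C_above unfolding above_def by blast
    then have "b \<notin> uncovered S0 T0" using t(2) unfolding is_next_def by (auto simp: not_le)
    then have "b \<in> cl' T0" using n b C_E unfolding uncovered_def by blast
    moreover have "b \<in> cl (?C - {b})" using b by (intro in_rest) blast
    moreover have "(?C - {b}) \<inter> T0 = {}" "b \<notin> T0" using C(3) T0 b by blast+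
    ultimately show False using closures_orthogonal[of b "?C - {b}" T0] C_E T0(1) by blast
  qed
  then have "cl (?C - {t}) \<subseteq> cl S0" using cl_mono[of "?C - {t}" "cl S0"] cl_cl[OF S0] by blast
  then have "t \<in> cl S0" using in_rest[OF C(2)] by blast
  then show False using t(2) unfolding is_next_def uncovered_def by blast
qed

text \<open>Converse to \<open>nbc_valid\<close>. An element of the basis outside \<open>S\<close>
  was covered when the next smaller choice was made, and not by \<open>S\<close> because the basis
  is independent; so it is spanned in the dual and active. If no choice is smaller, all of
  \<open>T\<close> spans it.\<close>

lemma valid_nbc:
  assumes v: "valid_choice S T" and T: "T \<in> dBs"
  shows "nbc_basis E Bs (E - T)" "IA E Bs (E - T) = E - T - S"
proof -
  interpret d: nat_matroid E dBs by (rule nat_matroid_dual)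
  let ?B = "E - T"
  have ST: "S \<subseteq> E" "T \<subseteq> E" "S \<inter> T = {}" using v unfolding valid_choice_def by auto
  have B: "?B \<in> Bs" using T dual_dual_bases unfolding dual_bases_def by blast
  have EB: "E - ?B = T" using ST by blast
  have nx: "is_next (above S f) (above T f) f" if "f \<in> S \<union> T" for f using that v unfolding valid_choice_def by blast
  have "t \<notin> cl (above ?B t)" if t: "t \<in> E - ?B" for t
  proof (rule next_not_spanned_above[OF B t nx])
    show "t \<in> S \<union> T" using t by blast
    show "above S t \<subseteq> E" "above T t \<subseteq> E" using above_subset ST by blast+
    show "above T t \<inter> ?B = {}" using above_subset by blast
    show "t \<notin> above T t" unfolding above_def by blast
  qed
  then show "nbc_basis E Bs ?B" using nbc_basis_iff B by blast
  have "b \<in> IA E Bs ?B \<longleftrightarrow> b \<notin> S" if b: "b \<in> ?B" for b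
  proof (cases "b \<in> S")
    case True
    then have "b \<notin> cl' (above T b)" using nx[of b] unfolding is_next_def uncovered_def by blast
    then show ?thesis using True in_IA_above[OF B] EB by simp
  next
    case False
    have "b \<in> cl' (above T b)"
    proof (cases "\<exists>f\<in>S \<union> T. f < b")
      case False
      then have "above T b = T" using b unfolding above_def by (auto simp: not_less order_le_less)
      then show ?thesis using d.cl_basis[OF T] b by simp
    next
      case True
      define L where "L = {f \<in> S \<union> T. f < b}"
      have "finite S" "finite T" using ST finite_E finite_subset by metis+
      then have L: "finite L" "L \<noteq> {}" using True unfolding L_def by auto
      define g where "g = Max L"
      have g: "g \<in> S \<union> T" "g < b" using Max_in[OF L] unfolding g_def L_def by auto
      have gtop: "x \<le> g" if "x \<in> S \<union> T" "x < b" for x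
        using Max_ge[OF L(1)] that unfolding g_def L_def by auto
      have "b < x" if "x \<in> S \<union> T" "g < x" for x
        using gtop[of x] that b \<open>b \<notin> S\<close> by (metis DiffE UnE linorder_neqE_nat not_less)
      then have "above S g = above S b" "above T g = above T b" using g(2) unfolding above_def by auto
      then have "b \<notin> uncovered (above S b) (above T b)" using nx[OF g(1)] g(2) unfolding is_next_def by auto
      moreover have "b \<notin> cl (above S b)"
        using ind_notin_cl[OF ind_basis[OF B] b, of "above S b"] above_subset[of S b] ST unfolding above_def by blast
      ultimately show ?thesis using b unfolding uncovered_def by blast
    qed
    then show ?thesis using False b in_IA_above[OF B] EB by simp
  qed
  moreover have "IA E Bs ?B \<subseteq> ?B" unfolding IA_def by blast
  ultimately show "IA E Bs ?B = ?B - S" by blast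
qed

text \<open>The minimum of \<open>E - B\<close> is the last choice: an element of
  \<open>SB E Bs B\<close> below it would come after the whole dual basis \<open>E - B\<close>, when
  everything is covered.\<close>

lemma TB_facts:
  assumes nbc: "nbc_basis E Bs B" and ne: "E - B \<noteq> {}"
  shows "valid_choice (SB E Bs B) (TB E B)" "is_next (SB E Bs B) (TB E B) (Min (E - B))"
proof -
  interpret d: nat_matroid E dBs by (rule nat_matroid_dual)
  let ?S = "SB E Bs B" and ?T = "E - B" and ?x = "Min (E - B)"
  have v: "valid_choice ?S ?T" by (rule nbc_valid[OF nbc])
  have B: "B \<in> Bs" using nbc nbc_basis_iff by blast
  have x: "?x \<in> ?T" "\<forall>f\<in>?T. ?x \<le> f" using Min_in[of ?T] Min_le[of ?T] ne by simp_all
  have "?x \<le> f" if f: "f \<in> ?S" for f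
  proof (rule ccontr)
    assume "\<not> ?x \<le> f"
    then have "f < y" if "y \<in> ?T" for y using x(2) that by (meson less_le_trans not_less)
    then have "above ?T f = ?T" by (intro above_all) blast
    moreover have "cl' ?T = E" using B by (intro d.cl_basis) (simp add: dual_bases_def)
    moreover have "is_next (above ?S f) (above ?T f) f" using v f unfolding valid_choice_def by blast
    ultimately show False unfolding is_next_def uncovered_def by auto
  qed
  then have "\<forall>f\<in>?S \<union> ?T. ?x \<le> f" using x by blast
  from valid_remove_min[OF v x(1) this]
  show "valid_choice ?S (TB E B)" "is_next ?S (TB E B) ?x" unfolding TB_def by auto
qed

end

section \<open>Vanishing of the remaining biflats\<close>

definition above_eq :: "nat set \<Rightarrow> nat \<Rightarrow> nat set" where
  "above_eq X e = {x \<in> X. e \<le> x}"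

lemma chow_eq_sum_restrict:
  assumes "finite A" "A' \<subseteq> A" "\<And>x. x \<in> A - A' \<Longrightarrow> chow_eq E Bs (f x) 0"
  shows "chow_eq E Bs (sum f A) (sum f A')"
proof -
  have "chow_eq E Bs (sum f (A - A') + sum f A') (0 + sum f A')"
    using assms(3) by (intro chow_eq_add chow_zero_sum chow_eq_refl)
  then show ?thesis using sum.subset_diff[OF assms(2,1), of f] by simp
qed

text \<open>Supplies the covering property of \<open>biflat_chains\<close>: by rank,
  \<open>insert d F\<close> already spans \<open>F'\<close>.\<close>

lemma (in matroid) flat_cover:
  assumes F: "flat E Bs F" "F \<subseteq> F'" "F' \<subseteq> E" "rk F' = Suc (rk F)" and d: "d \<in> F'" "d \<notin> F"
    and K: "flat E Bs K" "F \<subseteq> K" "d \<in> K"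
  shows "F' \<subseteq> K"
proof -
  have "d \<in> E" "d \<notin> cl F" using F d unfolding flat_def by auto
  then have "rk (insert d F) = rk F'" using rk_insert_notin_cl F(4) by simp
  then have "F' \<subseteq> cl (insert d F)" using F d by (intro subset_cl_if_rk_eq) auto
  moreover have "cl (insert d F) \<subseteq> K" using K by (intro cl_least) auto
  ultimately show ?thesis by blast
qed

section \<open>Shortened ranks and the biflats of a choice\<close>

locale loopless_nat_matroid = nat_matroid E Bs for E Bs +
  fixes k :: nat
  assumes cl_empty: "mcl E Bs {} = {}" and cl'_empty: "mcl E (dual_bases E Bs) {} = {}"
    and k_less: "k < mrank Bs E"
begin

definition Fl1 :: "nat set set" where "Fl1 = {F. flat E Bs F \<and> (F = E \<or> rk F + k < rk E)}"
definition Fl2 :: "nat set set" where "Fl2 = {G. flat E dBs G}"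
text \<open>A proper flat in \<open>Fl1\<close> has rank below \<open>rk E - k\<close>, so lowering
  the value at \<open>E\<close> keeps the function strictly increasing.\<close>

definition cut_rk :: "nat set \<Rightarrow> nat" where "cut_rk F = (if F = E then rk E - k else rk F)"
text \<open>The size of \<open>SB E Bs B\<close> for a basis with \<open>k + 1\<close> internally
  active elements; \<open>right_len\<close> is the size of \<open>TB E B\<close>.\<close>

definition left_len :: nat where "left_len = rk E - 1 - k"
definition right_len :: nat where "right_len = rk' E - 1"

lemma E_nonempty: "E \<noteq> {}"
  using k_less by auto

lemma rk'_E_pos: "0 < rk' E"
proof -
  interpret d: nat_matroid E dBs by (rule nat_matroid_dual)
  obtain x where x: "x \<in> E" using E_nonempty by blast
  then have "rk' {x} = 1" using d.rk_insert_notin_cl[of x "{}"] cl'_empty by auto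
  then show ?thesis using d.rk_mono[of "{x}" E] x by auto
qed

lemma rk_E_eq: "rk E = Suc (left_len + k)" unfolding left_len_def using k_less by simp
lemma rk'_E_eq: "rk' E = Suc right_len" unfolding right_len_def using rk'_E_pos by simp

lemma rk_sum: "rk' E + rk E = card E"
  using rk_dual[of E] by simp

lemma flat_empty: "flat E Bs {}" "flat E dBs {}"
  unfolding flat_def using cl_empty cl'_empty by auto

lemma cut_rk_less: "F \<in> Fl1 \<Longrightarrow> F' \<in> Fl1 \<Longrightarrow> F \<subset> F' \<Longrightarrow> cut_rk F < cut_rk F'"
proof -
  assume *: "F \<in> Fl1" "F' \<in> Fl1" "F \<subset> F'"
  have sub: "F' \<subseteq> E" "flat E Bs F" using * flat_subset unfolding Fl1_def by auto
  have "F \<noteq> E" using * sub by blast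
  then show ?thesis
    using flat_rk_less[OF sub(2) *(3) sub(1)] * unfolding cut_rk_def Fl1_def by auto
qed

lemma rk'_less: "G \<in> Fl2 \<Longrightarrow> G' \<in> Fl2 \<Longrightarrow> G \<subset> G' \<Longrightarrow> rk' G < rk' G'"
proof -
  interpret d: nat_matroid E dBs by (rule nat_matroid_dual)
  show "G \<in> Fl2 \<Longrightarrow> G' \<in> Fl2 \<Longrightarrow> G \<subset> G' \<Longrightarrow> rk' G < rk' G'"
    unfolding Fl2_def using d.flat_rk_less flat_subset by blast
qed

lemma flats_basics:
  "F \<in> Fl1 \<Longrightarrow> F \<subseteq> E" "G \<in> Fl2 \<Longrightarrow> G \<subseteq> E" "E \<in> Fl1" "E \<in> Fl2" "{} \<in> Fl1" "{} \<in> Fl2"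
proof -
  interpret d: nat_matroid E dBs by (rule nat_matroid_dual)
  show "F \<in> Fl1 \<Longrightarrow> F \<subseteq> E" "G \<in> Fl2 \<Longrightarrow> G \<subseteq> E" "E \<in> Fl1" "E \<in> Fl2" "{} \<in> Fl1" "{} \<in> Fl2"
      using flat_E d.flat_E flat_empty k_less
    unfolding Fl1_def Fl2_def cut_rk_def flat_def by auto
qed

lemma chains_left: "biflat_chains E Fl1 Fl2 cut_rk rk' (flat E Bs)"
proof
  fix F F' d K
  assume F: "F \<in> Fl1" "F' \<in> Fl1" "F \<subset> F'" "F' \<noteq> E" "cut_rk F' = Suc (cut_rk F)"
    and d: "d \<in> F'" "d \<notin> F" and K: "flat E Bs K" "F \<subseteq> K" "d \<in> K"
  have FE: "F' \<subseteq> E" "F \<noteq> E" using F flats_basics by blast+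
  have "flat E Bs F" "F \<subseteq> F'" "rk F' = Suc (rk F)" using F FE unfolding Fl1_def cut_rk_def by auto
  then show "F' \<subseteq> K" using flat_cover[of F F' d K] d K FE by blast
qed (use E_nonempty flats_basics cut_rk_less rk'_less finite_E in \<open>auto simp del: psubset_eq\<close>)

lemma chains_right: "biflat_chains E Fl2 Fl1 rk' cut_rk (flat E dBs)"
proof
  interpret d: nat_matroid E dBs by (rule nat_matroid_dual)
  fix F F' d K
  assume F: "F \<in> Fl2" "F' \<in> Fl2" "F \<subset> F'" "F' \<noteq> E" "rk' F' = Suc (rk' F)"
    and d: "d \<in> F'" "d \<notin> F" and K: "flat E dBs K" "F \<subseteq> K" "d \<in> K"
  have FE: "F' \<subseteq> E" using F flats_basics by blast
  have "flat E dBs F" "F \<subseteq> F'" using F unfolding Fl2_def by auto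
  then show "F' \<subseteq> K" using d.flat_cover[of F F' d K] d K FE F(5) by blast
qed (use E_nonempty flats_basics cut_rk_less rk'_less finite_E in \<open>auto simp del: psubset_eq\<close>)

sublocale L: biflat_chains E Fl1 Fl2 cut_rk "mrank (dual_bases E Bs)" "flat E Bs"
  by (rule chains_left)

sublocale R: biflat_chains E Fl2 Fl1 "mrank (dual_bases E Bs)" cut_rk "flat E (dual_bases E Bs)"
  by (rule chains_right)

abbreviation "LB \<equiv> large_corank_biflats k"

lemma L_Bf: "L.Bf = LB"
  by (rule set_eqI)
    (unfold L.in_Bf_iff, unfold large_corank_biflats_def Fl1_def Fl2_def biflats_iff mem_Collect_eq, blast)

lemma R_Bf: "R.Bf = prod.swap ` LB"
proof (rule set_eqI)
  fix P :: "nat set \<times> nat set"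
  have "P \<in> R.Bf \<longleftrightarrow> prod.swap P \<in> L.Bf"
    unfolding L.in_Bf_iff R.in_Bf_iff fst_swap snd_swap by (simp only: Un_commute) blast
  also have "\<dots> \<longleftrightarrow> P \<in> prod.swap ` LB"
    unfolding L_Bf by (metis image_iff swap_swap)
  finally show "P \<in> R.Bf \<longleftrightarrow> P \<in> prod.swap ` LB" .
qed

lemma L_N: "L.N = left_len + right_len"
  unfolding L.N_def cut_rk_def using rk_E_eq rk'_E_eq by simp

lemma R_N: "R.N = left_len + right_len"
  unfolding R.N_def cut_rk_def using rk_E_eq rk'_E_eq by simp

text \<open>The choice of \<open>e\<close> adds the closure of everything chosen on its side up to
  and including \<open>e\<close>.\<close>

definition chosen_biflats :: "nat set \<Rightarrow> nat set \<Rightarrow> (nat set \<times> nat set) set" where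
  "chosen_biflats S T = (\<lambda>e. (cl (above_eq S e), E)) ` S \<union> (\<lambda>e. (E, cl' (above_eq T e))) ` T"

lemma above_eq_subset: "above_eq X e \<subseteq> X"
  unfolding above_eq_def by blast

lemma above_eq_Min: "finite X \<Longrightarrow> X \<noteq> {} \<Longrightarrow> above_eq X (Min X) = X"
  unfolding above_eq_def by auto

lemma chosen_biflats_cases: "P \<in> chosen_biflats S T \<Longrightarrow> (fst P \<subseteq> cl S \<and> snd P = E) \<or> (fst P = E \<and> snd P \<subseteq> cl' T)"
proof -
  assume "P \<in> chosen_biflats S T"
  then consider e where "P = (cl (above_eq S e), E)" | e where "P = (E, cl' (above_eq T e))"
    unfolding chosen_biflats_def by blast
  then show ?thesis
  proof cases
    case (1 e)
    then show ?thesis using cl_mono[OF above_eq_subset, of S e] by simp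
  next
    case (2 e)
    then show ?thesis using cl'_mono[OF above_eq_subset, of T e] by simp
  qed
qed

lemma chosen_biflats_top:
  assumes "S \<subseteq> E" "T \<subseteq> E"
  shows "S = {} \<or> (cl S, E) \<in> chosen_biflats S T" "T = {} \<or> (E, cl' T) \<in> chosen_biflats S T"
proof -
  have "finite S" "finite T" using assms finite_E finite_subset by metis+
  then show "S = {} \<or> (cl S, E) \<in> chosen_biflats S T"
    unfolding chosen_biflats_def using above_eq_Min[of S] Min_in[of S] by (metis UnI1 image_eqI)
  show "T = {} \<or> (E, cl' T) \<in> chosen_biflats S T"
    unfolding chosen_biflats_def using \<open>finite T\<close> above_eq_Min[of T] Min_in[of T] by (metis UnI2 image_eqI)
qed

lemma valid_E: "valid_choice S T \<Longrightarrow> S \<subseteq> E" "valid_choice S T \<Longrightarrow> T \<subseteq> E" "valid_choice S T \<Longrightarrow> S \<inter> T = {}"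
  unfolding valid_choice_def by auto

lemma valid_finite: "valid_choice S T \<Longrightarrow> finite S" "valid_choice S T \<Longrightarrow> finite T"
  using valid_E finite_E finite_subset by metis+

lemma rk_cl_valid: "valid_choice S T \<Longrightarrow> rk (cl S) = card S"
  using rk_cl[of S] rk_ind[OF valid_ind] valid_E by simp

lemma rk'_cl_valid: "valid_choice S T \<Longrightarrow> rk' (cl' T) = card T"
proof -
  interpret d: nat_matroid E dBs by (rule nat_matroid_dual)
  assume "valid_choice S T"
  then show ?thesis using d.rk_cl[of T] d.rk_ind[OF valid_ind'] valid_E by simp
qed

lemma flat_cl': "X \<subseteq> E \<Longrightarrow> flat E dBs (cl' X)"
proof -
  interpret d: nat_matroid E dBs by (rule nat_matroid_dual)
  show "X \<subseteq> E \<Longrightarrow> flat E dBs (cl' X)" by (rule d.flat_cl)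
qed

lemma cl'_least: "flat E dBs G \<Longrightarrow> X \<subseteq> G \<Longrightarrow> cl' X \<subseteq> G"
proof -
  interpret d: nat_matroid E dBs by (rule nat_matroid_dual)
  show "flat E dBs G \<Longrightarrow> X \<subseteq> G \<Longrightarrow> cl' X \<subseteq> G" by (rule d.cl_least)
qed

lemma flat_rk'_less: "flat E dBs F \<Longrightarrow> F \<subset> F' \<Longrightarrow> F' \<subseteq> E \<Longrightarrow> rk' F < rk' F'"
proof -
  interpret d: nat_matroid E dBs by (rule nat_matroid_dual)
  show "flat E dBs F \<Longrightarrow> F \<subset> F' \<Longrightarrow> F' \<subseteq> E \<Longrightarrow> rk' F < rk' F'" by (rule d.flat_rk_less)
qed

text \<open>The two excluded biflats continue the choice. Any other \<open>F|E\<close> or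
  \<open>E|G\<close> skips a rank on its side, and for two proper entries orthogonality provides the
  flat \<open>K\<close> of \<open>vanishing_left\<close> on one of the sides.\<close>

lemma other_biflats_vanishing:
  assumes v: "valid_choice S T" and cS: "card S \<le> left_len" and e: "is_next S T e"
    and P: "P \<in> LB" "e \<in> fst P \<inter> snd P" "P \<noteq> (cl (insert e S), E)" "P \<noteq> (E, cl' (insert e T))"
  shows "vanishing E LB (left_len + right_len) (insert P (chosen_biflats S T))"
proof (cases "biflag_in E LB (insert P (chosen_biflats S T))")
  case False
  then show ?thesis by (rule vanishing.stop)
next
  case True
  obtain F G where FG: "P = (F, G)" by (cases P)
  have ST: "S \<subseteq> E" "T \<subseteq> E" "S \<inter> T = {}" using valid_E[OF v] by auto
  note ne = next_notin[OF ST(1,2) e]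
  let ?Fs = "cl S" and ?Gl = "cl' T" and ?X = "insert P (chosen_biflats S T)"
  have eFG: "e \<in> F" "e \<in> G" using P FG by auto
  have PB: "P \<in> Bfs" using P(1) unfolding large_corank_biflats_def by blast
  have flats: "flat E Bs F" "flat E dBs G" "F \<subseteq> E" "G \<subseteq> E" "F \<union> G = E" "\<not> (F = E \<and> G = E)"
    using PB FG flat_subset unfolding biflats_iff by auto
  have comp: "compatible P Q" if "Q \<in> ?X" for Q using True that unfolding biflag_in_def by blast
  have Fs_le: "?Fs \<subseteq> F"
  proof (cases "S = {}")
    case True
    then show ?thesis using cl_empty by simp
  next
    case False
    then have "compatible P (?Fs, E)" using comp chosen_biflats_top(1)[OF ST(1,2)] by blast
    then show ?thesis using eFG ne(4) unfolding compatible_iff_biflat_le biflat_le_def FG by auto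
  qed
  have Gl_le: "?Gl \<subseteq> G"
  proof (cases "T = {}")
    case True
    then show ?thesis using cl'_empty by simp
  next
    case False
    then have "compatible P (E, ?Gl)" using comp chosen_biflats_top(2)[OF ST(1,2)] by blast
    then show ?thesis using eFG ne(5) unfolding compatible_iff_biflat_le biflat_le_def FG by auto
  qed
  have Fs_flat: "flat E Bs ?Fs" and Gl_flat: "flat E dBs ?Gl" using flat_cl flat_cl' ST by auto
  have rkFs: "rk ?Fs = card S" by (rule rk_cl_valid[OF v])
  have Fs_ne: "?Fs \<noteq> E" using rkFs cS rk_E_eq by auto
  have Fs1: "?Fs \<in> Fl1" using Fs_flat rkFs cS rk_E_eq unfolding Fl1_def by auto
  have Gl2: "?Gl \<in> Fl2" using Gl_flat unfolding Fl2_def by blast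
  have PL: "(F, G) \<in> L.Bf" using P(1) FG L_Bf by simp
  then have PR: "(G, F) \<in> R.Bf" unfolding R_Bf L_Bf by force
  have Fs_in: "?Fs = {} \<or> (?Fs, E) \<in> ?X" using chosen_biflats_top(1)[OF ST(1,2)] cl_empty by auto
  have Gl_in: "?Gl = {} \<or> (?Gl, E) \<in> prod.swap ` ?X" using chosen_biflats_top(2)[OF ST(1,2)] cl'_empty by force
  have swapI: "vanishing E LB (left_len + right_len) ?X" if "vanishing E R.Bf R.N (prod.swap ` ?X)"
    using that unfolding R_Bf R_N vanishing_swap_iff .
  consider "G = E" "F \<noteq> E" | "F = E" "G \<noteq> E" | "F \<noteq> E" "G \<noteq> E" using flats(6) by blast
  then show ?thesis
  proof cases
    case 1
    \<comment> \<open>\<open>F\<close> properly contains this closure, so its rank exceeds that of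
      \<open>cl S\<close> by at least two.\<close>
    have sub: "cl (insert e S) \<subseteq> F" using cl_least[OF flats(1), of "insert e S"] eFG Fs_le subset_cl[OF ST(1)] by auto
    have neq: "cl (insert e S) \<noteq> F" using P(3) FG 1 by auto
    have "rk (cl (insert e S)) = Suc (card S)"
      using rk_cl_valid[OF valid_insert(1)[OF v e]] ne(2) valid_finite[OF v] by simp
    moreover have "rk (cl (insert e S)) < rk F"
      using sub neq flat_rk_less[OF flat_cl, of "insert e S" F] ST ne(1) flats(3) by auto
    ultimately have "cut_rk ?Fs + 2 \<le> cut_rk F" unfolding cut_rk_def using 1 Fs_ne rkFs by simp
    moreover have "\<forall>Q\<in>?X. (fst Q \<subseteq> ?Fs \<and> snd Q = E) \<or> biflat_le (F, E) Q"
    proof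
      fix Q assume "Q \<in> ?X"
      then have "Q = (F, G) \<or> Q \<in> chosen_biflats S T" unfolding FG by blast
      then show "(fst Q \<subseteq> ?Fs \<and> snd Q = E) \<or> biflat_le (F, E) Q"
        using chosen_biflats_cases[of Q S T] flats(3) flat_subset[OF Gl_flat] unfolding biflat_le_def 1(1) by auto
    qed
    ultimately have "vanishing E L.Bf L.N ?X" using L.vanishing_cover[of F ?X ?Fs] PL Fs1 FG 1 by blast
    then show ?thesis unfolding L_Bf L_N .
  next
    case 2
    have sub: "cl' (insert e T) \<subseteq> G" using cl'_least[OF flats(2), of "insert e T"] eFG Gl_le subset_cl'[OF ST(2)] by auto
    have neq: "cl' (insert e T) \<noteq> G" using P(4) FG 2 by auto
    have "rk' (cl' (insert e T)) = Suc (card T)"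
      using rk'_cl_valid[OF valid_insert(2)[OF v e]] ne(3) valid_finite[OF v] by simp
    moreover have "rk' (cl' (insert e T)) < rk' G"
      using sub neq flat_rk'_less[OF flat_cl', of "insert e T" G] ST ne(1) flats(4) by auto
    ultimately have "rk' ?Gl + 2 \<le> rk' G" using rk'_cl_valid[OF v] by simp
    moreover have "\<forall>Q\<in>prod.swap ` ?X. (fst Q \<subseteq> ?Gl \<and> snd Q = E) \<or> biflat_le (G, E) Q"
    proof
      fix Q assume "Q \<in> prod.swap ` ?X"
      then obtain Q' where Q': "Q = prod.swap Q'" "Q' = (F, G) \<or> Q' \<in> chosen_biflats S T" unfolding FG by blast
      then show "(fst Q \<subseteq> ?Gl \<and> snd Q = E) \<or> biflat_le (G, E) Q"
        using chosen_biflats_cases[of Q' S T] flats(4) flat_subset[OF Fs_flat] unfolding biflat_le_def 2(1) by auto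
    qed
    moreover have "(G, E) \<in> prod.swap ` ?X" unfolding FG 2(1) by force
    ultimately have "vanishing E R.Bf R.N (prod.swap ` ?X)"
      using R.vanishing_cover[of G "prod.swap ` ?X" ?Gl] PR Gl2 2 by blast
    then show ?thesis by (rule swapI)
  next
    case 3
    let ?Kl = "cl (?Fs \<union> (E - G))" and ?Kr = "cl' (?Gl \<union> (E - F))"
    have sub: "?Fs \<union> (E - G) \<subseteq> E" "?Gl \<union> (E - F) \<subseteq> E" using Fs_flat Gl_flat flat_subset by blast+
    \<comment> \<open>\<open>S \<union> (E - G)\<close> and \<open>T \<union> (E - F)\<close> are
      disjoint and do not contain \<open>e\<close>, so they cannot span it in the matroid and in its
      dual respectively.\<close>
    have "e \<notin> ?Kl \<or> e \<notin> ?Kr"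
    proof (rule ccontr)
      assume "\<not> ?thesis"
      moreover have "?Kl \<subseteq> cl (S \<union> (E - G))"
      proof (rule cl_least)
        show "flat E Bs (cl (S \<union> (E - G)))" using ST by (intro flat_cl) auto
        show "?Fs \<union> (E - G) \<subseteq> cl (S \<union> (E - G))"
          using cl_mono[of S "S \<union> (E - G)"] subset_cl[of "S \<union> (E - G)"] ST by blast
      qed
      moreover have "?Kr \<subseteq> cl' (T \<union> (E - F))"
      proof (rule cl'_least)
        show "flat E dBs (cl' (T \<union> (E - F)))" using ST by (intro flat_cl') auto
        show "?Gl \<union> (E - F) \<subseteq> cl' (T \<union> (E - F))"
          using cl'_mono[of T "T \<union> (E - F)"] subset_cl'[of "T \<union> (E - F)"] ST by blast
      qed
      ultimately have "e \<in> cl (S \<union> (E - G))" "e \<in> cl' (T \<union> (E - F))" by blast+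
      moreover have "S \<subseteq> F" "T \<subseteq> G" using Fs_le Gl_le subset_cl[OF ST(1)] subset_cl'[OF ST(2)] by auto
      then have "(S \<union> (E - G)) \<inter> (T \<union> (E - F)) = {}" using ST(3) flats(5) by blast
      moreover have "S \<union> (E - G) \<subseteq> E" "T \<union> (E - F) \<subseteq> E" "e \<notin> S \<union> (E - G)" "e \<notin> T \<union> (E - F)"
        using ST(1,2) ne(2,3) eFG by auto
      ultimately show False using closures_orthogonal[of e "S \<union> (E - G)" "T \<union> (E - F)"] by simp
    qed
    then consider "\<not> F \<subseteq> ?Kl" | "\<not> G \<subseteq> ?Kr" using eFG by blast
    then show ?thesis
    proof cases
      case K: 1
      have "\<forall>Q\<in>?X. Q = (F, G) \<or> (fst Q \<subseteq> ?Fs \<and> snd Q = E) \<or> (fst Q = E \<and> snd Q \<subseteq> ?Gl)"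
        using chosen_biflats_cases FG by blast
      then have "vanishing E L.Bf L.N ?X"
        using L.vanishing_left[of F G ?X e ?Fs ?Gl ?Kl, OF PL 3 _ eFG ne(4,5) Fs1 Fs_le Gl2 Gl_le _ Fs_in
            flat_cl[OF sub(1)] _ _ K] subset_cl[OF sub(1)] FG by blast
      then show ?thesis unfolding L_Bf L_N .
    next
      case K: 2
      have "\<forall>Q\<in>prod.swap ` ?X. Q = (G, F) \<or> (fst Q \<subseteq> ?Gl \<and> snd Q = E) \<or> (fst Q = E \<and> snd Q \<subseteq> ?Fs)"
      proof
        fix Q assume "Q \<in> prod.swap ` ?X"
        then obtain Q' where Q': "Q = prod.swap Q'" "Q' = (F, G) \<or> Q' \<in> chosen_biflats S T" unfolding FG by blast
        then show "Q = (G, F) \<or> (fst Q \<subseteq> ?Gl \<and> snd Q = E) \<or> (fst Q = E \<and> snd Q \<subseteq> ?Fs)"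
          using chosen_biflats_cases[of Q' S T] by auto
      qed
      moreover have "(G, F) \<in> prod.swap ` ?X" unfolding FG by force
      ultimately have "vanishing E R.Bf R.N (prod.swap ` ?X)"
        using R.vanishing_left[of G F "prod.swap ` ?X" e ?Gl ?Fs ?Kr, OF PR 3(2,1) _ eFG(2,1) ne(5,4) Gl2 Gl_le Fs1 Fs_le _ Gl_in
            flat_cl'[OF sub(2)] _ _ K] subset_cl'[OF sub(2)] by blast
      then show ?thesis by (rule swapI)
    qed
  qed
qed

end

section \<open>Expansion of the powers of \<open>\<delta>\<close>\<close>

context loopless_nat_matroid
begin

section \<open>The monomial of a choice\<close>

lemma valid_subflats:
  assumes v: "valid_choice S T" and c: "card S \<le> left_len" "card T \<le> right_len"
  shows "cl S \<noteq> E" "cl' T \<noteq> E"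
  using rk_cl_valid[OF v] rk'_cl_valid[OF v] c rk_E_eq rk'_E_eq by auto

lemma chosen_biflats_subset_biflats:
  assumes v: "valid_choice S T" and c: "card S \<le> left_len" "card T \<le> right_len"
  shows "chosen_biflats S T \<subseteq> Bfs"
proof
  fix P assume "P \<in> chosen_biflats S T"
  then consider e where "e \<in> S" "P = (cl (above_eq S e), E)" | e where "e \<in> T" "P = (E, cl' (above_eq T e))"
    unfolding chosen_biflats_def by blast
  then show "P \<in> Bfs"
  proof cases
    case (1 e)
    have sub: "above_eq S e \<subseteq> E" using above_eq_subset valid_E(1)[OF v] by blast
    have "e \<in> cl (above_eq S e)" using subset_cl[OF sub] 1 unfolding above_eq_def by blast
    moreover have "cl (above_eq S e) \<noteq> E"
      using valid_subflats(1)[OF assms] cl_mono[OF above_eq_subset, of S e] cl_subset_E by blast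
    moreover have "cl (above_eq S e) \<union> E = E" using cl_subset_E by blast
    ultimately show ?thesis
      using flat_cl[OF sub] flats_basics(4) E_nonempty unfolding biflats_iff 1(2) Fl2_def fst_conv snd_conv by blast
  next
    case (2 e)
    have sub: "above_eq T e \<subseteq> E" using above_eq_subset valid_E(2)[OF v] by blast
    have "e \<in> cl' (above_eq T e)" using subset_cl'[OF sub] 2 unfolding above_eq_def by blast
    moreover have "cl' (above_eq T e) \<noteq> E"
      using valid_subflats(2)[OF assms] cl'_mono[OF above_eq_subset, of T e] flat_subset[OF flat_cl'[OF valid_E(2)[OF v]]] by blast
    moreover have "E \<union> cl' (above_eq T e) = E" using flat_subset[OF flat_cl'[OF sub]] by blast
    ultimately show ?thesis
      using flat_cl'[OF sub] flat_E E_nonempty unfolding biflats_iff 2(2) fst_conv snd_conv by blast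
  qed
qed

lemma inj_on_above_eq_closures:
  assumes "\<And>X. X \<subseteq> S \<Longrightarrow> X \<subseteq> c X" and "\<And>e f. e \<in> S \<Longrightarrow> e < f \<Longrightarrow> e \<notin> c (above_eq S f)"
  shows "inj_on (\<lambda>e. c (above_eq S e)) S"
proof (rule inj_onI)
  have less: "c (above_eq S e) \<noteq> c (above_eq S f)" if "e \<in> S" "e < f" for e f
  proof -
    have "e \<in> c (above_eq S e)" using assms(1)[of "above_eq S e"] above_eq_subset that(1) unfolding above_eq_def by blast
    then show ?thesis using assms(2)[OF that] by blast
  qed
  fix e f assume *: "e \<in> S" "f \<in> S" "c (above_eq S e) = c (above_eq S f)"
  show "e = f"
  proof (rule ccontr)
    assume "e \<noteq> f"
    then consider "e < f" | "f < e" by linarith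
    then show False using less[of e f] less[of f e] * by cases simp_all
  qed
qed

lemma card_chosen_biflats:
  assumes v: "valid_choice S T" and c: "card S \<le> left_len" "card T \<le> right_len"
  shows "card (chosen_biflats S T) = card S + card T"
proof -
  interpret d: nat_matroid E dBs by (rule nat_matroid_dual)
  note SE = valid_E[OF v]
  have out: "e \<notin> above_eq X f" if "e < f" for e f :: nat and X using that unfolding above_eq_def by auto
  have "inj_on (\<lambda>e. cl (above_eq S e)) S"
    using SE ind_notin_cl[OF valid_ind[OF v] _ above_eq_subset out]
    by (intro inj_on_above_eq_closures) (auto intro!: subset_cl dest: subset_trans)
  then have i1: "inj_on (\<lambda>e. (cl (above_eq S e), E)) S" unfolding inj_on_def by simp
  have "inj_on (\<lambda>e. cl' (above_eq T e)) T"
    using SE d.ind_notin_cl[OF valid_ind'[OF v] _ above_eq_subset out]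
    by (intro inj_on_above_eq_closures) (auto intro!: subset_cl' dest: subset_trans)
  then have i2: "inj_on (\<lambda>e. (E, cl' (above_eq T e))) T" unfolding inj_on_def by simp
  have "(\<lambda>e. (cl (above_eq S e), E)) ` S \<inter> (\<lambda>e. (E, cl' (above_eq T e))) ` T = {}"
  proof -
    have "cl (above_eq S e) \<noteq> E" for e
      using valid_subflats(1)[OF assms] cl_mono[OF above_eq_subset, of S e] cl_subset_E by blast
    then show ?thesis by auto
  qed
  then show ?thesis unfolding chosen_biflats_def
    using card_image[OF i1] card_image[OF i2] valid_finite[OF v] by (subst card_Un_disjoint) auto
qed

lemma chosen_biflats_insert_left:
  assumes "\<forall>f\<in>S. e < f"
  shows "chosen_biflats (insert e S) T = insert (cl (insert e S), E) (chosen_biflats S T)"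
proof -
  have "above_eq (insert e S) e = insert e S" using assms unfolding above_eq_def by auto
  moreover have "above_eq (insert e S) f = above_eq S f" if "f \<in> S" for f using assms that unfolding above_eq_def by auto
  ultimately show ?thesis unfolding chosen_biflats_def by simp
qed

lemma chosen_biflats_insert_right:
  assumes "\<forall>f\<in>T. e < f"
  shows "chosen_biflats S (insert e T) = insert (E, cl' (insert e T)) (chosen_biflats S T)"
proof -
  have "above_eq (insert e T) e = insert e T" using assms unfolding above_eq_def by auto
  moreover have "above_eq (insert e T) f = above_eq T f" if "f \<in> T" for f using assms that unfolding above_eq_def by auto
  ultimately show ?thesis unfolding chosen_biflats_def by simp
qed

lemma chosen_biflats_covers:
  assumes "S \<subseteq> E" "T \<subseteq> E"
  shows "(\<Union>(F, G)\<in>chosen_biflats S T. F \<inter> G) = cl S \<union> cl' T"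
proof
  show "(\<Union>(F, G)\<in>chosen_biflats S T. F \<inter> G) \<subseteq> cl S \<union> cl' T" using chosen_biflats_cases by fastforce
  have "cl S \<subseteq> (\<Union>(F, G)\<in>chosen_biflats S T. F \<inter> G)"
  proof (cases "S = {}")
    case False
    then have "(cl S, E) \<in> chosen_biflats S T" using chosen_biflats_top(1)[OF assms] by blast
    then show ?thesis using cl_subset_E[of S] by fast
  qed (use cl_empty in simp)
  moreover have "cl' T \<subseteq> (\<Union>(F, G)\<in>chosen_biflats S T. F \<inter> G)"
  proof (cases "T = {}")
    case False
    then have "(E, cl' T) \<in> chosen_biflats S T" using chosen_biflats_top(2)[OF assms] by blast
    then show ?thesis using flat_subset[OF flat_cl'[OF assms(2)]] by fast
  qed (use cl'_empty in simp)
  ultimately show "cl S \<union> cl' T \<subseteq> (\<Union>(F, G)\<in>chosen_biflats S T. F \<inter> G)" by blast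
qed

section \<open>Nbc bases that extend a choice\<close>

definition nbc_extending :: "nat set \<Rightarrow> nat set \<Rightarrow> nat set set" where
  "nbc_extending S T = {B. nbc_basis E Bs B \<and> card (IA E Bs B) = k + 1 \<and> S \<subseteq> SB E Bs B \<and> T \<subseteq> TB E B}"

lemma finite_nbc_extending: "finite (nbc_extending S T)"
  by (rule finite_subset[of _ "Pow E"]) (use nbc_basis_iff basis_subset in \<open>auto simp: nbc_extending_def\<close>)

lemma nbc_extending_facts:
  assumes "B \<in> nbc_extending S T"
  shows "B \<in> Bs" "E - B \<noteq> {}" "valid_choice (SB E Bs B) (TB E B)"
    "is_next (SB E Bs B) (TB E B) (Min (E - B))"
    "card (SB E Bs B) = left_len" "card (TB E B) = right_len" "insert (Min (E - B)) (TB E B) = E - B"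
    "S \<subseteq> SB E Bs B" "T \<subseteq> TB E B"
proof -
  interpret d: nat_matroid E dBs by (rule nat_matroid_dual)
  have nbc: "nbc_basis E Bs B" and cIA: "card (IA E Bs B) = k + 1" using assms unfolding nbc_extending_def by auto
  show B: "B \<in> Bs" using nbc nbc_basis_iff by blast
  have card': "card (E - B) = rk' E" using d.rk_E[of "E - B"] B by (simp add: dual_bases_def)
  then show ne: "E - B \<noteq> {}" using rk'_E_pos by (metis card.empty less_irrefl)
  show "valid_choice (SB E Bs B) (TB E B)" "is_next (SB E Bs B) (TB E B) (Min (E - B))"
    by (rule TB_facts[OF nbc ne])+
  have IA_B: "IA E Bs B \<subseteq> B" unfolding IA_def by blast
  then have "card (SB E Bs B) = card B - card (IA E Bs B)"
    unfolding SB_def using finite_subset[OF IA_B finite_basis[OF B]] by (intro card_Diff_subset)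
  then show "card (SB E Bs B) = left_len" using rk_E[OF B] cIA unfolding left_len_def by simp
  have fin: "finite (E - B)" by simp
  have x: "Min (E - B) \<in> E - B" by (rule Min_in[OF fin ne])
  show "card (TB E B) = right_len" unfolding TB_def right_len_def using card' x by simp
  show "insert (Min (E - B)) (TB E B) = E - B" unfolding TB_def using x by blast
  show "S \<subseteq> SB E Bs B" "T \<subseteq> TB E B" using assms unfolding nbc_extending_def by auto
qed

text \<open>A basis would supply a next element: by \<open>valid_extension\<close> if the choice is
  incomplete, otherwise \<open>Min (E - B)\<close>.\<close>

lemma nbc_extending_stuck: "valid_choice S T \<Longrightarrow> uncovered S T = {} \<Longrightarrow> nbc_extending S T = {}"
proof (rule ccontr)
  assume v: "valid_choice S T" and u: "uncovered S T = {}" and "nbc_extending S T \<noteq> {}"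
  then obtain B where B: "B \<in> nbc_extending S T" by blast
  have "\<exists>e. is_next S T e"
  proof (cases "S = SB E Bs B \<and> T = TB E B")
    case True
    then show ?thesis using nbc_extending_facts(4)[OF B] by blast
  next
    case False
    then show ?thesis using valid_extension[OF v nbc_extending_facts(3)[OF B] nbc_extending_facts(8,9)[OF B]] by blast
  qed
  then show False using u unfolding is_next_def by blast
qed

lemma stuck_zero:
  assumes v: "valid_choice S T" and c: "card S \<le> left_len" "card T \<le> right_len" and u: "uncovered S T = {}"
  shows "xmon (chosen_biflats S T) \<approx> 0"
proof (rule xmon_not_biflag[OF chosen_biflats_subset_biflats[OF v c]])
  have "cl S \<union> cl' T = E"
    using u cl_subset_E[of S] flat_subset[OF flat_cl'[OF valid_E(2)[OF v]]] unfolding uncovered_def by blast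
  then show "\<not> biflag E Bs (chosen_biflats S T)"
    unfolding biflag_def using chosen_biflats_covers[OF valid_E(1,2)[OF v]] by simp
qed

text \<open>Adding \<open>x\<close> completes \<open>T\<close> to a basis of the dual, so
  \<open>valid_nbc\<close> applies. For any other candidate, the sizes force the same pair and
  uniqueness of the next element forces the same minimum.\<close>

lemma nbc_extending_full:
  assumes v: "valid_choice S T" and c: "card S = left_len" "card T = right_len" and x: "is_next S T x"
  shows "nbc_extending S T = {E - insert x T}" "SB E Bs (E - insert x T) = S" "TB E (E - insert x T) = T"
proof -
  interpret d: nat_matroid E dBs by (rule nat_matroid_dual)
  let ?B = "E - insert x T"
  have v1: "valid_choice S (insert x T)" by (rule valid_insert(2)[OF v x])
  note E1 = valid_E[OF v1]
  have xST: "x \<notin> S" "x \<notin> T" using next_notin[OF valid_E(1,2)[OF v] x] by auto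
  have cT: "card (insert x T) = rk' E" using xST c valid_finite[OF v] rk'_E_eq by simp
  have T1: "insert x T \<in> dBs" by (rule d.ind_card_rk_E_basis[OF valid_ind'[OF v1] cT])
  note nbc = valid_nbc[OF v1 T1]
  have EB: "E - ?B = insert x T" using E1 by blast
  have min: "Min (insert x T) = x"
    using next_less[OF v x] valid_finite[OF v] by (intro Min_eqI) (auto intro: less_imp_le)
  show TB: "TB E ?B = T" unfolding TB_def EB min using xST by blast
  show SB: "SB E Bs ?B = S" unfolding SB_def nbc(2) using E1 by blast
  have B: "?B \<in> Bs" using nbc(1) nbc_basis_iff by blast
  have "card (IA E Bs ?B) = card ?B - card S" unfolding nbc(2)
    using E1 valid_finite[OF v] by (intro card_Diff_subset) auto
  then have "card (IA E Bs ?B) = k + 1" using rk_E[OF B] rk_E_eq c by simp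
  then have "?B \<in> nbc_extending S T" using nbc(1) SB TB unfolding nbc_extending_def by simp
  moreover have "B' = ?B" if B': "B' \<in> nbc_extending S T" for B'
  proof -
    note f = nbc_extending_facts[OF B']
    have "SB E Bs B' = S" using f(5,8) c valid_finite[OF f(3)] by (metis card_subset_eq)
    moreover have TB': "TB E B' = T" using f(6,9) c valid_finite[OF f(3)] by (metis card_subset_eq)
    ultimately have "Min (E - B') = x" using f(4) x is_next_unique by simp
    then have "insert x T = E - B'" using f(7) TB' by simp
    then show ?thesis using basis_subset[OF f(1)] by blast
  qed
  ultimately show "nbc_extending S T = {?B}" by blast
qed

text \<open>By \<open>valid_extension\<close> the next element is in \<open>SB E Bs B\<close> or in
  \<open>TB E B\<close>, and these are disjoint.\<close>

lemma nbc_extending_split: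
  assumes v: "valid_choice S T" and c: "card S + card T < left_len + right_len" and e: "is_next S T e"
  shows "nbc_extending S T = nbc_extending (insert e S) T \<union> nbc_extending S (insert e T)" "nbc_extending (insert e S) T \<inter> nbc_extending S (insert e T) = {}"
proof -
  show "nbc_extending (insert e S) T \<inter> nbc_extending S (insert e T) = {}"
  proof (rule ccontr)
    assume "\<not> ?thesis"
    then obtain B where B: "B \<in> nbc_extending (insert e S) T" "B \<in> nbc_extending S (insert e T)" by blast
    then have "e \<in> SB E Bs B" "e \<in> TB E B" using nbc_extending_facts(8)[OF B(1)] nbc_extending_facts(9)[OF B(2)] by auto
    then show False using valid_E(3)[OF nbc_extending_facts(3)[OF B(1)]] by blast
  qed
  have "B \<in> nbc_extending (insert e S) T \<union> nbc_extending S (insert e T)" if B: "B \<in> nbc_extending S T" for B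
  proof -
    note f = nbc_extending_facts[OF B]
    have "S \<noteq> SB E Bs B \<or> T \<noteq> TB E B" using c f(5,6) by auto
    from valid_extension[OF v f(3) f(8,9) this]
    have "e \<in> SB E Bs B \<union> TB E B" using is_next_unique[OF e] by blast
    then show ?thesis using B unfolding nbc_extending_def by auto
  qed
  then show "nbc_extending S T = nbc_extending (insert e S) T \<union> nbc_extending S (insert e T)" unfolding nbc_extending_def by auto
qed

text \<open>Induction on the number of factors \<delta> left. \<open>Fp\<close> and the assumption
  \<open>final\<close> postpone the multiplication by the power of \<gamma>, which is kept until
  then because it kills the flats of small corank.\<close>

lemma expansion:
  assumes final: "\<And>B. B \<in> nbc_extending {} {} \<Longrightarrow> gamma E Bs i ^ k * xmon (chosen_biflats (SB E Bs B) (TB E B)) \<approx> xmon (Fp B)"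
    and ij: "i \<in> E" "j \<in> E"
    and v: "valid_choice S T" and c: "card S \<le> left_len" "card T \<le> right_len"
  shows "gamma E Bs i ^ k * delta E Bs j ^ (left_len + right_len - (card S + card T)) * xmon (chosen_biflats S T)
     \<approx> (\<Sum>B\<in>nbc_extending S T. xmon (Fp B))"
  using v c
proof (induction "left_len + right_len - (card S + card T)" arbitrary: S T)
  case 0
  then have cc: "card S = left_len" "card T = right_len" by auto
  show ?case
  proof (cases "uncovered S T = {}")
    case True
    then show ?thesis using nbc_extending_stuck[OF 0(2) True] chow_zero_mult[OF stuck_zero[OF 0(2-4) True]] by simp
  next
    case False
    then obtain x where x: "is_next S T x" using is_next_exists by blast
    note f = nbc_extending_full[OF 0(2) cc x]
    have "E - insert x T \<in> nbc_extending {} {}" using f(1) unfolding nbc_extending_def by auto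
    from final[OF this] show ?thesis using f cc by simp
  qed
next
  case (Suc m)
  note v = Suc.prems(1) and c = Suc.prems(2,3)
  show ?case
  proof (cases "uncovered S T = {}")
    case True
    then show ?thesis using nbc_extending_stuck[OF v True] chow_zero_mult[OF stuck_zero[OF v c True]] by simp
  next
    case False
    then obtain e where e: "is_next S T e" using is_next_exists by blast
    have lt: "card S + card T < left_len + right_len" using Suc.hyps(2) by simp
    have m: "m = left_len + right_len - Suc (card S + card T)" using Suc.hyps(2) by simp
    note ne = next_notin[OF valid_E(1,2)[OF v] e]
    note fin = valid_finite[OF v]
    have less: "\<forall>f\<in>S. e < f" "\<forall>f\<in>T. e < f" using next_less[OF v e] by auto
    have stB: "chosen_biflats S T \<subseteq> Bfs" by (rule chosen_biflats_subset_biflats[OF v c])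
    have unc: "\<forall>P\<in>chosen_biflats S T. e \<notin> fst P \<inter> snd P" using chosen_biflats_cases[of _ S T] ne by blast
    have card_ins: "card (insert P (chosen_biflats S T)) = Suc (card S + card T)" if "e \<in> fst P \<inter> snd P" for P
      using that unc card_chosen_biflats[OF v c] finite_subset_biflats[OF stB] by (subst card_insert_disjoint) auto
    define A where "A = {P \<in> Bfs. e \<in> fst P \<inter> snd P}"
    define P1 where "P1 = (cl (insert e S), E)"
    define P2 where "P2 = (E, cl' (insert e T))"
    define co where "co = gamma E Bs i ^ k * delta E Bs j ^ m"
    define f where "f P = co * xmon (insert P (chosen_biflats S T))" for P
    have kill: "f P \<approx> 0" if P: "P \<in> Bfs" "fst P \<noteq> E" "rk E \<le> rk (fst P) + k" for P
    proof -
      have "delta E Bs j ^ m * (gamma E Bs i ^ k * xmon (insert P (chosen_biflats S T))) \<approx> 0"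
        using P stB ij by (intro chow_zero_mult gamma_power_xmon_zero[of _ P]) auto
      then show ?thesis unfolding f_def co_def by (simp add: mult_ac)
    qed
    have zero: "f P \<approx> 0" if P: "P \<in> A - A \<inter> {P1, P2}" for P
    proof (cases "P \<in> LB")
      case True
      have eP: "e \<in> fst P \<inter> snd P" and PB: "P \<in> Bfs" using P unfolding A_def by auto
      have "vanishing E LB (left_len + right_len) (insert P (chosen_biflats S T))"
        using P unfolding A_def P1_def P2_def by (intro other_biflats_vanishing[OF v c(1) e True eP]) auto
      from vanishing_imp_zero[OF this _ _ ij] show ?thesis
        using stB PB card_ins[OF eP] lt m unfolding f_def co_def by (simp add: mult_ac)
    next
      case False
      then show ?thesis using P unfolding large_corank_biflats_def A_def by (intro kill) auto
    qed
    have finA: "finite A" unfolding A_def using finite_biflats by simp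
    have r1: "sum f A \<approx> sum f (A \<inter> {P1, P2})"
      using zero finA by (intro chow_eq_sum_restrict) auto
    have r2: "sum f A = co * (delta E Bs e * xmon (chosen_biflats S T))"
      unfolding delta_times_xmon[OF stB unc] f_def A_def sum_distrib_left ..
    have r3: "sum f (A \<inter> {P1, P2}) = (if P1 \<in> A then f P1 else 0) + (if P2 \<in> A then f P2 else 0)"
    proof -
      \<comment> \<open>They coincide only as \<open>(E, E)\<close>, which is not a biflat.\<close>
      have "\<not> (P1 = P2 \<and> P1 \<in> A)" unfolding P1_def P2_def A_def biflats_iff by auto
      then show ?thesis by (cases "P1 \<in> A"; cases "P2 \<in> A") auto
    qed
    have r4: "(if P1 \<in> A then f P1 else 0) \<approx> (\<Sum>B\<in>nbc_extending (insert e S) T. xmon (Fp B))"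
    proof -
      have v1: "valid_choice (insert e S) T" by (rule valid_insert(1)[OF v e])
      have c1: "card (insert e S) = Suc (card S)" using ne fin by simp
      have rk1: "rk (cl (insert e S)) = Suc (card S)" using rk_cl_valid[OF v1] c1 by simp
      show ?thesis
      proof (cases "card S < left_len")
        case True
        have st1: "insert P1 (chosen_biflats S T) = chosen_biflats (insert e S) T" unfolding P1_def chosen_biflats_insert_left[OF less(1)] ..
        have "chosen_biflats (insert e S) T \<subseteq> Bfs" using True c c1 by (intro chosen_biflats_subset_biflats[OF v1]) auto
        then have "P1 \<in> Bfs" using st1 by blast
        then have "P1 \<in> A" unfolding A_def P1_def using subset_cl[of "insert e S"] valid_E(1)[OF v1] ne(1) by auto
        moreover have "gamma E Bs i ^ k * delta E Bs j ^ (left_len + right_len - (card (insert e S) + card T)) * xmon (chosen_biflats (insert e S) T)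
            \<approx> (\<Sum>B\<in>nbc_extending (insert e S) T. xmon (Fp B))"
          using Suc.hyps(1)[of "insert e S" T] v1 c1 c True m by simp
        ultimately show ?thesis unfolding f_def co_def st1 m c1 by simp
      next
        case False
        \<comment> \<open>The left side is full and \<open>cl (insert e S)\<close> has corank
          \<open>k\<close>. Thus \<open>P1\<close> is killed by the power of \<gamma> if it is a
          biflat at all, and no basis accounts for it.\<close>
        then have "nbc_extending (insert e S) T = {}"
          using nbc_extending_facts(5,8)[of _ "insert e S" T] c1 nbc_extending_facts(3)[of _ "insert e S" T]
            card_mono[of "SB E Bs _" "insert e S"] valid_finite(1) by fastforce
        moreover have "f P1 \<approx> 0" if "P1 \<in> A"
        proof (rule kill)
          show "P1 \<in> Bfs" "fst P1 \<noteq> E" using that unfolding A_def biflats_iff P1_def by auto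
          show "rk E \<le> rk (fst P1) + k" unfolding P1_def fst_conv rk1 using False rk_E_eq by simp
        qed
        ultimately show ?thesis by (simp add: chow_eq_refl)
      qed
    qed
    have r5: "(if P2 \<in> A then f P2 else 0) \<approx> (\<Sum>B\<in>nbc_extending S (insert e T). xmon (Fp B))"
    proof -
      have v1: "valid_choice S (insert e T)" by (rule valid_insert(2)[OF v e])
      have c1: "card (insert e T) = Suc (card T)" using ne fin by simp
      have rk1: "rk' (cl' (insert e T)) = Suc (card T)" using rk'_cl_valid[OF v1] c1 by simp
      show ?thesis
      proof (cases "card T < right_len")
        case True
        have st1: "insert P2 (chosen_biflats S T) = chosen_biflats S (insert e T)" unfolding P2_def chosen_biflats_insert_right[OF less(2)] ..
        have "chosen_biflats S (insert e T) \<subseteq> Bfs" using True c c1 by (intro chosen_biflats_subset_biflats[OF v1]) auto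
        then have "P2 \<in> Bfs" using st1 by blast
        then have "P2 \<in> A" unfolding A_def P2_def using subset_cl'[of "insert e T"] valid_E(2)[OF v1] ne(1) by auto
        moreover have "gamma E Bs i ^ k * delta E Bs j ^ (left_len + right_len - (card S + card (insert e T))) * xmon (chosen_biflats S (insert e T))
            \<approx> (\<Sum>B\<in>nbc_extending S (insert e T). xmon (Fp B))"
          using Suc.hyps(1)[of S "insert e T"] v1 c1 c True m by simp
        ultimately show ?thesis unfolding f_def co_def st1 m c1 by simp
      next
        case False
        \<comment> \<open>The right side is full: \<open>insert e T\<close> has full dual rank, so
          its closure is \<open>E\<close> and \<open>P2\<close> is not a biflat.\<close>
        then have "nbc_extending S (insert e T) = {}"
          using nbc_extending_facts(6,9)[of _ S "insert e T"] c1 nbc_extending_facts(3)[of _ S "insert e T"]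
            card_mono[of "TB E _" "insert e T"] valid_finite(2) by fastforce
        moreover have "P2 \<notin> A"
        proof
          assume "P2 \<in> A"
          then have "cl' (insert e T) \<noteq> E" "cl' (insert e T) \<subseteq> E"
            unfolding A_def biflats_iff P2_def using flat_subset by auto
          then have "rk' (cl' (insert e T)) < rk' E"
            using flat_rk'_less[OF flat_cl'[OF valid_E(2)[OF v1]], of E] by blast
          then show False using rk1 False rk'_E_eq by simp
        qed
        ultimately show ?thesis by (simp add: chow_eq_refl)
      qed
    qed
    have "co * (delta E Bs e * xmon (chosen_biflats S T)) \<approx>
        (\<Sum>B\<in>nbc_extending (insert e S) T. xmon (Fp B)) + (\<Sum>B\<in>nbc_extending S (insert e T). xmon (Fp B))"
      by (rule chow_eq_trans[OF r1[unfolded r2 r3] chow_eq_add[OF r4 r5]])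
    also have "(\<Sum>B\<in>nbc_extending (insert e S) T. xmon (Fp B)) + (\<Sum>B\<in>nbc_extending S (insert e T). xmon (Fp B)) =
        (\<Sum>B\<in>nbc_extending S T. xmon (Fp B))"
      using nbc_extending_split[OF v lt e] finite_nbc_extending by (simp add: sum.union_disjoint)
    finally have main: "co * (delta E Bs e * xmon (chosen_biflats S T)) \<approx> (\<Sum>B\<in>nbc_extending S T. xmon (Fp B))" .
    have "co * xmon (chosen_biflats S T) * delta E Bs j \<approx> co * xmon (chosen_biflats S T) * delta E Bs e"
      using ij ne by (intro chow_eq_mult chow_delta_eq) auto
    then have "co * xmon (chosen_biflats S T) * delta E Bs j \<approx> (\<Sum>B\<in>nbc_extending S T. xmon (Fp B))"
      using chow_eq_trans[OF _ main] by (simp add: mult_ac)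
    moreover have "delta E Bs j ^ (left_len + right_len - (card S + card T)) = delta E Bs j * delta E Bs j ^ m"
      unfolding Suc.hyps(2)[symmetric] by simp
    ultimately show ?thesis unfolding co_def by (simp add: mult_ac)
  qed
qed

end

section \<open>Multiplication by powers of \<open>\<gamma>\<close>\<close>

lemma nth_sorted_list_of_set_less:
  assumes "finite A" "p < q" "q < card A"
  shows "sorted_list_of_set A ! p < sorted_list_of_set A ! q"
  using assms strict_sorted_list_of_set[of A] by (simp add: sorted_wrt_nth_less)

lemma nth_smallest_less:
  assumes "finite A" "1 \<le> p" "p < q" "q \<le> card A"
  shows "nth_smallest A p < nth_smallest A q"
  unfolding nth_smallest_def using assms by (intro nth_sorted_list_of_set_less) auto

lemma nth_largest_eq:
  assumes "finite A" "1 \<le> p" "p \<le> card A"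
  shows "nth_largest A p = sorted_list_of_set A ! (card A - p)"
  unfolding nth_largest_def using assms by (simp add: rev_nth Suc_diff_Suc Suc_diff_le)

lemma nth_largest_less:
  assumes "finite A" "1 \<le> p" "p < q" "q \<le> card A"
  shows "nth_largest A q < nth_largest A p"
  using assms nth_sorted_list_of_set_less[of A "card A - q" "card A - p"] by (simp add: nth_largest_eq)

lemma nth_smallest_image: "finite A \<Longrightarrow> nth_smallest A ` {1..card A} = A"
proof -
  assume "finite A"
  then have "A = (\<lambda>p. sorted_list_of_set A ! p) ` {0..<card A}"
    using nth_image[of "card A" "sorted_list_of_set A"] by simp
  also have "{0..<card A} = (\<lambda>m. m - 1) ` {1..card A}"
  proof -
    have "x \<in> (\<lambda>m. m - 1) ` {1..card A}" if "x < card A" for x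
      using that by (intro image_eqI[of _ _ "Suc x"]) auto
    then show ?thesis by auto
  qed
  finally show ?thesis unfolding nth_smallest_def by (simp add: image_image)
qed

lemma inj_on_nth_largest: "finite A \<Longrightarrow> inj_on (nth_largest A) {1..card A}"
proof (rule inj_onI, rule ccontr)
  fix p q assume A: "finite A" "p \<in> {1..card A}" "q \<in> {1..card A}" "nth_largest A p = nth_largest A q" "p \<noteq> q"
  then consider "p < q" | "q < p" by linarith
  then show False using nth_largest_less[of A p q] nth_largest_less[of A q p] A by cases auto
qed

lemma nth_largest_image: "finite A \<Longrightarrow> nth_largest A ` {1..card A} = A"
proof -
  assume A: "finite A"
  have "nth_largest A m \<in> A" if "m \<in> {1..card A}" for m
    using that A nth_largest_eq[OF A, of m] nth_mem[of "card A - m" "sorted_list_of_set A"] by auto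
  then have "nth_largest A ` {1..card A} \<subseteq> A" by blast
  moreover have "card (nth_largest A ` {1..card A}) = card A"
    using card_image[OF inj_on_nth_largest[OF A]] by simp
  ultimately show ?thesis using A by (intro card_subset_eq)
qed

text \<open>Translates the index ranges in \<open>ext_biflat\<close> into the sets
  \<open>above_eq\<close> of \<open>chosen_biflats\<close>; \<open>nth_smallest_final\<close> does
  the same on the right.\<close>

lemma nth_largest_initial:
  assumes "finite A" "1 \<le> j" "j \<le> card A"
  shows "nth_largest A ` {1..j} = above_eq A (nth_largest A j)"
proof
  have le: "nth_largest A j \<le> nth_largest A m" if "1 \<le> m" "m \<le> j" for m
    using nth_largest_less[OF assms(1) that(1), of j] that assms by (cases "m = j") auto
  show "nth_largest A ` {1..j} \<subseteq> above_eq A (nth_largest A j)"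
    using le nth_largest_image[OF assms(1)] assms(3) unfolding above_eq_def by fastforce
  show "above_eq A (nth_largest A j) \<subseteq> nth_largest A ` {1..j}"
  proof
    fix x assume x: "x \<in> above_eq A (nth_largest A j)"
    then obtain m where m: "m \<in> {1..card A}" "x = nth_largest A m"
      using nth_largest_image[OF assms(1)] unfolding above_eq_def by blast
    have "\<not> j < m" using x nth_largest_less[OF assms(1,2), of m] m unfolding above_eq_def by auto
    then show "x \<in> nth_largest A ` {1..j}" using m by auto
  qed
qed

lemma nth_smallest_final:
  assumes "finite A" "1 \<le> j" "j \<le> card A"
  shows "nth_smallest A ` {j..card A} = above_eq A (nth_smallest A j)"
proof
  have le: "nth_smallest A j \<le> nth_smallest A m" if "j \<le> m" "m \<le> card A" for m
    using nth_smallest_less[OF assms(1,2), of m] that by (cases "m = j") auto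
  show "nth_smallest A ` {j..card A} \<subseteq> above_eq A (nth_smallest A j)"
    using le nth_smallest_image[OF assms(1)] assms(2) unfolding above_eq_def by fastforce
  show "above_eq A (nth_smallest A j) \<subseteq> nth_smallest A ` {j..card A}"
  proof
    fix x assume x: "x \<in> above_eq A (nth_smallest A j)"
    then obtain m where m: "m \<in> {1..card A}" "x = nth_smallest A m"
      using nth_smallest_image[OF assms(1)] unfolding above_eq_def by blast
    have "\<not> m < j" using x nth_smallest_less[OF assms(1), of m j] m assms(3) unfolding above_eq_def by auto
    then show "x \<in> nth_smallest A ` {j..card A}" using m by auto
  qed
qed

lemma setcompr_interval: "{f m |m. a \<le> m \<and> m \<le> b} = f ` {a..b}" for a b :: nat
  by auto

section \<open>Loops of the matroid and of its dual\<close>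

lemma (in nat_matroid) cl_empty_if_no_loops:
  assumes "\<forall>e\<in>E. \<not> loop Bs e"
  shows "cl {} = {}"
proof -
  have "e \<notin> cl {}" for e
    using assms in_cl_ind[OF ind_empty, of e] cl_subset_E[of "{}"] unfolding loop_def by blast
  then show ?thesis by blast
qed

lemma (in nat_matroid) cl'_empty_if_no_coloops:
  assumes "\<forall>e\<in>E. \<not> coloop Bs e"
  shows "cl' {} = {}"
proof -
  interpret d: nat_matroid E dBs by (rule nat_matroid_dual)
  have "\<not> loop dBs e" if e: "e \<in> E" for e
  proof -
    obtain B where "B \<in> Bs" "e \<notin> B" using assms e unfolding coloop_def by blast
    then show ?thesis using e unfolding loop_def indep_def dual_bases_def by blast
  qed
  then show ?thesis by (intro d.cl_empty_if_no_loops) blast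
qed

lemma (in nat_matroid) gamma_times_xmon:
  assumes X: "X \<subseteq> Bfs" and c: "\<forall>P\<in>X. c \<in> fst P \<longrightarrow> fst P = E"
  shows "gamma E Bs c * xmon X = (\<Sum>P\<in>{P \<in> Bfs. c \<in> fst P \<and> fst P \<noteq> E}. xmon (insert P X))"
  unfolding gamma_alt sum_distrib_right
  by (rule sum.cong[OF refl], subst xmon_insert) (use c finite_subset_biflats[OF X] in auto)

section \<open>From the biflats of a choice to the extended nbc biflag\<close>

context loopless_nat_matroid
begin

text \<open>Multiplying by \<open>\<gamma>\<^sub>c\<close> for an element \<open>c\<close> outside the largest proper flat \<open>F\<close>, only the flats
  of smallest rank above \<open>F\<close> can survive the remaining powers of \<open>\<gamma>\<close>, and one of these contains \<open>c\<close>.\<close>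

lemma gamma_chain:
  fixes c :: "nat \<Rightarrow> nat"
  assumes v: "valid_choice S T" and cS: "card S = left_len" and cT: "card T = right_len"
    and ind: "ind (S \<union> c ` {1..k})" and inj: "inj_on c {1..k}" and disj: "S \<inter> c ` {1..k} = {}"
    and i: "i \<in> E"
  defines "Fc \<equiv> \<lambda>j. cl (S \<union> c ` {1..j})"
  defines "Yc \<equiv> \<lambda>j. (Fc j, if Fc j \<union> cl' T = E then cl' T else E)"
  shows "j \<le> k \<Longrightarrow> gamma E Bs i ^ k * xmon (chosen_biflats S T) \<approx> gamma E Bs i ^ (k - j) * xmon (chosen_biflats S T \<union> Yc ` {1..j})"
proof (induction j)
  case 0
  show ?case by (simp add: chow_eq_refl)
next
  case (Suc j)
  let ?H = "cl' T" and ?X = "chosen_biflats S T \<union> Yc ` {1..j}" and ?c = "c (Suc j)" and ?m = "k - Suc j"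
  note ST = valid_E[OF v]
  have cle: "card S \<le> left_len" "card T \<le> right_len" using cS cT by auto
  have cE: "c ` {1..k} \<subseteq> E" using ind_subset_E[OF ind] by blast
  have sub: "S \<union> c ` {1..p} \<subseteq> S \<union> c ` {1..k}" if "p \<le> k" for p using that by auto
  have subE: "S \<union> c ` {1..p} \<subseteq> E" if "p \<le> k" for p using sub[OF that] ind_subset_E[OF ind] by blast
  have flatF: "flat E Bs (Fc p)" if "p \<le> k" for p unfolding Fc_def by (rule flat_cl[OF subE[OF that]])
  have rkF: "rk (Fc p) = left_len + p" if p: "p \<le> k" for p
  proof -
    have "card (S \<union> c ` {1..p}) = card S + card (c ` {1..p})"
      using disj p valid_finite[OF v] by (intro card_Un_disjoint) auto
    moreover have "card (c ` {1..p}) = p" using card_image[OF inj_on_subset[OF inj, of "{1..p}"]] p by simp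
    ultimately show ?thesis
      unfolding Fc_def using rk_cl[OF subE[OF p]] rk_ind[OF ind_mono[OF ind sub[OF p]]] cS by simp
  qed
  have F_ne: "Fc p \<noteq> E" if "p \<le> k" for p using rkF[OF that] rk_E_eq that by auto
  have F_mono: "Fc p \<subseteq> Fc q" if "p \<le> q" for p q
    unfolding Fc_def using that by (intro cl_mono) auto
  have j: "j \<le> k" using Suc.prems by simp
  have cin: "?c \<in> Fc (Suc j)" using subset_cl[OF subE[OF Suc.prems]] unfolding Fc_def by auto
  have cnot: "?c \<notin> Fc j"
  proof -
    have "?c \<noteq> c p" if "p \<in> {1..j}" for p
      using inj_on_eq_iff[OF inj, of "Suc j" p] that Suc.prems by auto
    moreover have "?c \<in> c ` {1..k}" using Suc.prems by auto
    ultimately have "?c \<notin> S \<union> c ` {1..j}" using disj by blast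
    then show ?thesis unfolding Fc_def
      using ind_notin_cl[OF ind _ sub[OF j], of ?c] Suc.prems by auto
  qed
  have H: "flat E dBs ?H" "?H \<subseteq> E" "?H \<noteq> E"
    using flat_cl'[OF ST(2)] flat_subset[OF flat_cl'[OF ST(2)]] valid_subflats(2)[OF v cle] by auto
  have YB: "Yc p \<in> Bfs" if p: "1 \<le> p" "p \<le> k" for p
  proof -
    have "c p \<in> Fc p" using subset_cl[OF subE[OF p(2)]] p unfolding Fc_def by auto
    then have F: "flat E Bs (Fc p)" "Fc p \<noteq> {}" "Fc p \<noteq> E" "Fc p \<union> E = E"
      using flatF[OF p(2)] F_ne[OF p(2)] flat_subset[OF flatF[OF p(2)]] by auto
    show ?thesis
    proof (cases "Fc p \<union> ?H = E")
      case True
      then have "?H \<noteq> {}" using F(3) by (metis Un_empty_right)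
      then show ?thesis using F(1-3) H(1) True unfolding biflats_iff Yc_def by simp
    next
      case False
      have "flat E dBs E" using flats_basics(4) unfolding Fl2_def by blast
      then show ?thesis using F E_nonempty False unfolding biflats_iff Yc_def by simp
    qed
  qed
  have XB: "?X \<subseteq> Bfs" using chosen_biflats_subset_biflats[OF v cle] YB j by auto
  have low: "fst P \<subseteq> Fc j \<or> fst P = E" if PX: "P \<in> ?X" for P
  proof -
    consider "P \<in> chosen_biflats S T" | p where "p \<in> {1..j}" "P = Yc p" using PX by blast
    then show ?thesis
    proof cases
      case 1
      have "cl S \<subseteq> Fc j" unfolding Fc_def by (intro cl_mono) auto
      then show ?thesis using chosen_biflats_cases[OF 1] by blast
    next
      case (2 p)
      then show ?thesis using F_mono[of p j] unfolding Yc_def by auto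
    qed
  qed
  have top: "Fc j = {} \<or> (\<exists>P\<in>?X. fst P = Fc j)"
  proof (cases "j = 0")
    case True
    then have "Fc j = cl S" unfolding Fc_def by simp
    moreover have "cl S = {} \<or> (cl S, E) \<in> ?X" using chosen_biflats_top(1)[OF ST(1,2)] cl_empty by auto
    ultimately show ?thesis by (metis fst_conv)
  next
    case False
    then have "Yc j \<in> ?X" "fst (Yc j) = Fc j" unfolding Yc_def by auto
    then show ?thesis by blast
  qed
  define A where "A = {P \<in> Bfs. ?c \<in> fst P \<and> fst P \<noteq> E}"
  define f where "f P = gamma E Bs i ^ ?m * xmon (insert P ?X)" for P
  have YA: "Yc (Suc j) \<in> A"
    unfolding A_def using YB[OF _ Suc.prems] cin F_ne[OF Suc.prems] by (auto simp: Yc_def)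
  have zero: "f P \<approx> 0" if P: "P \<in> A - {Yc (Suc j)}" for P
  proof (cases "biflag E Bs (insert P ?X)")
    case False
    have "insert P ?X \<subseteq> Bfs" using P XB unfolding A_def by blast
    then show ?thesis unfolding f_def using False by (intro chow_zero_mult xmon_not_biflag)
  next
    case True
    have comp: "compatible P Q" if "Q \<in> insert P ?X" for Q using True that unfolding biflag_def by blast
    have PA: "P \<in> Bfs" "?c \<in> fst P" "fst P \<noteq> E" using P unfolding A_def by auto
    have flats: "flat E Bs (fst P)" "flat E dBs (snd P)" "fst P \<union> snd P = E" "snd P \<noteq> {}"
      using PA(1) unfolding biflats_iff by auto
    have sE: "fst P \<subseteq> E" "snd P \<subseteq> E" using flats flat_subset by auto
    have "Fc j \<subseteq> fst P"
    proof (cases "Fc j = {}")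
      case False
      then obtain Q where "Q \<in> ?X" "fst Q = Fc j" using top by blast
      then show ?thesis using comp[of Q] PA(2) cnot unfolding compatible_iff_biflat_le biflat_le_def by auto
    qed simp
    then have "S \<union> c ` {1..Suc j} \<subseteq> fst P"
      using subset_cl[OF subE[OF j]] PA(2) unfolding Fc_def by (auto simp: atLeastAtMostSuc_conv)
    then have Fle: "Fc (Suc j) \<subseteq> fst P" unfolding Fc_def by (rule cl_least[OF flats(1)])
    have Hle: "?H \<subseteq> snd P"
    proof (cases "T = {}")
      case True
      then show ?thesis using cl'_empty by simp
    next
      case False
      then have "compatible P (E, ?H)" using comp chosen_biflats_top(2)[OF ST(1,2)] by blast
      then show ?thesis using PA(3) sE unfolding compatible_iff_biflat_le biflat_le_def by auto
    qed
    have "fst P \<noteq> Fc (Suc j)"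
    proof
      assume F: "fst P = Fc (Suc j)"
      then have ne: "snd P \<noteq> (if Fc (Suc j) \<union> ?H = E then ?H else E)"
        using P unfolding Yc_def by (auto simp: prod_eq_iff)
      have "snd P = ?H \<or> snd P = E"
      proof (rule ccontr)
        assume "\<not> ?thesis"
        then have "rk' ?H < rk' (snd P)" "rk' (snd P) < rk' E"
          using flat_rk'_less[OF H(1), of "snd P"] flat_rk'_less[OF flats(2), of E] Hle sE by blast+
        then show False using rk'_cl_valid[OF v] cT rk'_E_eq by simp
      qed
      moreover have "snd P \<noteq> ?H" using ne flats(3) F by auto
      ultimately have G: "snd P = E" by blast
      then have un: "Fc (Suc j) \<union> ?H = E" using ne by (simp split: if_splits)
      then have "T \<noteq> {}" using cl'_empty F_ne[OF Suc.prems] by auto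
      then have HX: "(E, ?H) \<in> insert P ?X" using chosen_biflats_top(2)[OF ST(1,2)] by blast
      have FX: "(Fc (Suc j), E) \<in> insert P ?X" using F G by (simp add: prod_eq_iff)
      have "E \<subseteq> (\<Union>(F, G)\<in>insert P ?X. F \<inter> G)"
      proof
        fix x assume x: "x \<in> E"
        then consider "x \<in> Fc (Suc j)" | "x \<in> ?H" using un by blast
        then show "x \<in> (\<Union>(F, G)\<in>insert P ?X. F \<inter> G)"
          using UN_I[OF FX, of x "\<lambda>(F, G). F \<inter> G"] UN_I[OF HX, of x "\<lambda>(F, G). F \<inter> G"] x
          by cases simp_all
      qed
      moreover have "(\<Union>(F, G)\<in>insert P ?X. F \<inter> G) \<subseteq> E"
      proof (rule UN_least)
        fix Q assume "Q \<in> insert P ?X"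
        then have "Q \<in> Bfs" using XB PA(1) by blast
        then have "flat E Bs (fst Q)" unfolding biflats_iff by blast
        then have "fst Q \<subseteq> E" by (rule flat_subset)
        then show "(case Q of (F, G) \<Rightarrow> F \<inter> G) \<subseteq> E" by (cases Q) auto
      qed
      ultimately show False using True unfolding biflag_def by blast
    qed
    then have "rk (Fc (Suc j)) < rk (fst P)"
      using flat_rk_less[OF flatF[OF Suc.prems], of "fst P"] Fle sE by blast
    \<comment> \<open>A flat larger than \<open>Fc (Suc j)\<close> has corank at most
      \<open>k - Suc j\<close>, the number of factors \<gamma> that remain.\<close>
    then have "rk E \<le> rk (fst P) + ?m" using rkF[OF Suc.prems] rk_E_eq Suc.prems by simp
    then show ?thesis unfolding f_def using PA XB i by (intro gamma_power_xmon_zero[of _ P]) auto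
  qed
  have finA: "finite A" unfolding A_def using finite_biflats by simp
  have cX: "\<forall>P\<in>?X. ?c \<in> fst P \<longrightarrow> fst P = E" using low cnot by blast
  have "gamma E Bs i ^ ?m * xmon ?X * gamma E Bs i \<approx> gamma E Bs i ^ ?m * xmon ?X * gamma E Bs ?c"
    using i cE Suc.prems by (intro chow_eq_mult chow_gamma_eq) auto
  also have "gamma E Bs i ^ ?m * xmon ?X * gamma E Bs ?c = gamma E Bs i ^ ?m * (gamma E Bs ?c * xmon ?X)"
    by (simp add: mult_ac)
  also have "\<dots> = sum f A"
    unfolding gamma_times_xmon[OF XB cX] f_def A_def sum_distrib_left ..
  finally have e1: "gamma E Bs i ^ ?m * xmon ?X * gamma E Bs i \<approx> sum f A" .
  have e2: "sum f A \<approx> sum f {Yc (Suc j)}"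
    using finA YA zero by (intro chow_eq_sum_restrict) auto
  have "insert (Yc (Suc j)) ?X = chosen_biflats S T \<union> Yc ` {1..Suc j}" by (auto simp: atLeastAtMostSuc_conv)
  then have e3: "sum f {Yc (Suc j)} = gamma E Bs i ^ (k - Suc j) * xmon (chosen_biflats S T \<union> Yc ` {1..Suc j})"
    unfolding f_def by simp
  have "gamma E Bs i ^ (k - j) = gamma E Bs i * gamma E Bs i ^ ?m"
    using Suc.prems by (simp add: Suc_diff_Suc flip: power_Suc)
  then have "gamma E Bs i ^ (k - j) * xmon ?X \<approx> gamma E Bs i ^ (k - Suc j) * xmon (chosen_biflats S T \<union> Yc ` {1..Suc j})"
    using chow_eq_trans[OF e1 e2] unfolding e3 by (simp add: mult_ac)
  then show ?case by (rule chow_eq_trans[OF Suc.IH[OF j]])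
qed

text \<open>The first and last index ranges give the biflats of the choice, the middle range the
  chain of \<open>gamma_chain\<close>. There the comparison with the least index \<open>iB\<close>
  becomes the test whether the union is \<open>E\<close>, as the flats increase.\<close>

lemma ext_nbc_biflag_eq:
  assumes B: "B \<in> nbc_extending {} {}" and r: "r = left_len + k" and n: "n = r + 1 + right_len"
  defines "Fc \<equiv> \<lambda>j. cl (SB E Bs B \<union> cB E Bs B ` {1..j})"
  shows "ext_nbc_biflag E Bs n r k B = chosen_biflats (SB E Bs B) (TB E B) \<union>
    (\<lambda>j. (Fc j, if Fc j \<union> cl' (TB E B) = E then cl' (TB E B) else E)) ` {1..k}"
proof -
  let ?S = "SB E Bs B" and ?T = "TB E B"
  define Yc where "Yc j = (Fc j, if Fc j \<union> cl' ?T = E then cl' ?T else E)" for j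
  note f = nbc_extending_facts[OF B]
  have fin: "finite ?S" "finite ?T" using valid_finite[OF f(3)] by auto
  have rk0: "r - k = left_len" using r by simp
  have left: "ext_biflat E Bs n r k B j = (cl (above_eq ?S (nth_largest ?S j)), E)" if j: "j \<in> {1..left_len}" for j
  proof -
    have "{eB E Bs r k B m |m. 1 \<le> m \<and> m \<le> j} = eB E Bs r k B ` {1..j}" by (rule setcompr_interval)
    also have "\<dots> = nth_largest ?S ` {1..j}"
      using j by (intro image_cong) (auto simp: eB_def rk0)
    also have "\<dots> = above_eq ?S (nth_largest ?S j)"
      using nth_largest_initial[OF fin(1), of j] j f(5) by simp
    finally show ?thesis using j unfolding ext_biflat_def rk0 by simp
  qed
  have right: "ext_biflat E Bs n r k B (r + q) = (E, cl' (above_eq ?T (nth_smallest ?T q)))" if q: "q \<in> {1..right_len}" for q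
  proof -
    have nk: "n - k - 1 = left_len + right_len" "r + q - k = left_len + q" using n r by auto
    have "{eB E Bs r k B m |m. r + q - k \<le> m \<and> m \<le> n - k - 1} = eB E Bs r k B ` {left_len + q..left_len + right_len}"
      unfolding nk by (rule setcompr_interval)
    also have "{left_len + q..left_len + right_len} = (\<lambda>m. left_len + m) ` {q..right_len}" by simp
    also have "eB E Bs r k B ` (\<lambda>m. left_len + m) ` {q..right_len} = nth_smallest ?T ` {q..right_len}"
      unfolding image_image using q by (intro image_cong) (auto simp: eB_def rk0)
    also have "\<dots> = above_eq ?T (nth_smallest ?T q)"
      using nth_smallest_final[OF fin(2), of q] q f(6) by simp
    finally show ?thesis using q r unfolding ext_biflat_def rk0 by simp
  qed
  have cIA: "card (IA E Bs B) = k + 1" using B unfolding nbc_extending_def by simp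
  then have finIA: "finite (IA E Bs B)" by (simp add: card_ge_0_finite)
  have F_iB: "mcl E Bs (?S \<union> {cB E Bs B m |m. 1 \<le> m \<and> m \<le> p}) = Fc p" for p
    unfolding Fc_def setcompr_interval ..
  have F_mono: "Fc p \<subseteq> Fc q" if "p \<le> q" for p q
    unfolding Fc_def using that by (intro cl_mono) auto
  have F_E: "Fc p \<subseteq> E" for p unfolding Fc_def by (rule cl_subset_E)
  have H_E: "cl' ?T \<subseteq> E" using flat_subset[OF flat_cl'[OF valid_E(2)[OF f(3)]]] .
  have iB: "iB E Bs B = (LEAST p. Fc p \<union> cl' ?T = E)" unfolding iB_def F_iB ..
  \<comment> \<open>All \<open>k + 1\<close> internally active elements together with
    \<open>SB E Bs B\<close> form the basis, so the least index exists.\<close>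
  have "Fc (k + 1) \<union> cl' ?T = E"
  proof -
    have "cB E Bs B ` {1..k + 1} = IA E Bs B"
      using nth_largest_image[OF finIA] cIA unfolding cB_def by simp
    then have "?S \<union> cB E Bs B ` {1..k + 1} = B" unfolding SB_def IA_def by blast
    then show ?thesis using cl_basis[OF f(1)] H_E unfolding Fc_def by auto
  qed
  then have least: "Fc (iB E Bs B) \<union> cl' ?T = E" unfolding iB by (rule LeastI)
  \<comment> \<open>\<open>p \<ge> 1\<close> matters here, since \<open>iB E Bs B - 1\<close> is
    truncated at zero.\<close>
  have iB_iff: "p \<le> iB E Bs B - 1 \<longleftrightarrow> Fc p \<union> cl' ?T \<noteq> E" if p: "1 \<le> p" for p
  proof
    assume "p \<le> iB E Bs B - 1"
    then have "p < iB E Bs B" using p by simp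
    then show "Fc p \<union> cl' ?T \<noteq> E" unfolding iB by (rule not_less_Least)
  next
    assume n: "Fc p \<union> cl' ?T \<noteq> E"
    have "\<not> iB E Bs B \<le> p"
    proof
      assume "iB E Bs B \<le> p"
      then show False using F_mono[of "iB E Bs B" p] least n F_E[of p] H_E by blast
    qed
    then show "p \<le> iB E Bs B - 1" by simp
  qed
  have middle: "ext_biflat E Bs n r k B (left_len + p) = Yc p" if p: "p \<in> {1..k}" for p
    using p r iB_iff[of p] unfolding ext_biflat_def rk0 F_iB Yc_def by (auto simp: Let_def F_iB)
  have split: "{1..n - 1} = {1..left_len} \<union> (\<lambda>p. left_len + p) ` {1..k} \<union> (\<lambda>q. r + q) ` {1..right_len}"
  proof -
    have "(\<lambda>p. left_len + p) ` {1..k} = {left_len + 1..left_len + k}" "(\<lambda>q. r + q) ` {1..right_len} = {r + 1..r + right_len}" by auto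
    then show ?thesis using n r by auto
  qed
  have "ext_biflat E Bs n r k B ` {1..left_len} = (\<lambda>e. (cl (above_eq ?S e), E)) ` nth_largest ?S ` {1..left_len}"
    unfolding image_image using left by (intro image_cong) auto
  also have "nth_largest ?S ` {1..left_len} = ?S" using nth_largest_image[OF fin(1)] f(5) by simp
  finally have i1: "ext_biflat E Bs n r k B ` {1..left_len} = (\<lambda>e. (cl (above_eq ?S e), E)) ` ?S" .
  have "ext_biflat E Bs n r k B ` (\<lambda>q. r + q) ` {1..right_len} = (\<lambda>e. (E, cl' (above_eq ?T e))) ` nth_smallest ?T ` {1..right_len}"
    unfolding image_image using right by (intro image_cong) auto
  also have "nth_smallest ?T ` {1..right_len} = ?T" using nth_smallest_image[OF fin(2)] f(6) by simp
  finally have i2: "ext_biflat E Bs n r k B ` (\<lambda>q. r + q) ` {1..right_len} = (\<lambda>e. (E, cl' (above_eq ?T e))) ` ?T" .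
  have i3: "ext_biflat E Bs n r k B ` (\<lambda>p. left_len + p) ` {1..k} = Yc ` {1..k}"
    unfolding image_image using middle by (intro image_cong) auto
  show ?thesis
    unfolding ext_nbc_biflag_def split image_Un i1 i2 i3 chosen_biflats_def Yc_def by blast
qed

text \<open>\<open>SB E Bs B\<close> and the \<open>k\<close> largest internally active elements are
  disjoint parts of the basis, so they satisfy the independence conditions of
  \<open>gamma_chain\<close>.\<close>

lemma gamma_power_nbc_biflag:
  assumes B: "B \<in> nbc_extending {} {}" and r: "r = left_len + k" and n: "n = r + 1 + right_len" and i: "i \<in> E"
  shows "gamma E Bs i ^ k * xmon (chosen_biflats (SB E Bs B) (TB E B)) \<approx> xmon (ext_nbc_biflag E Bs n r k B)"
proof -
  note f = nbc_extending_facts[OF B]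
  have cIA: "card (IA E Bs B) = k + 1" using B unfolding nbc_extending_def by simp
  then have finIA: "finite (IA E Bs B)" by (simp add: card_ge_0_finite)
  have sub: "cB E Bs B ` {1..k} \<subseteq> IA E Bs B"
    using nth_largest_image[OF finIA] cIA unfolding cB_def by auto
  have "IA E Bs B \<subseteq> B" unfolding IA_def by blast
  then have ind: "ind (SB E Bs B \<union> cB E Bs B ` {1..k})"
    using sub SB_subset by (intro ind_mono[OF ind_basis[OF f(1)]]) blast
  have inj: "inj_on (cB E Bs B) {1..k}"
    unfolding cB_def using inj_on_nth_largest[OF finIA] cIA by (auto intro: inj_on_subset)
  have disj: "SB E Bs B \<inter> cB E Bs B ` {1..k} = {}" using sub unfolding SB_def by blast
  show ?thesis
    using gamma_chain[OF f(3,5,6) ind inj disj i order_refl]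
    unfolding ext_nbc_biflag_eq[OF B r n] by simp
qed

end

theorem theorem1p1:
  fixes n r k :: nat and Bs :: "nat set set"
  assumes "matroid_bases {0..n} Bs"
    and "\<forall>e\<in>{0..n}. \<not> loop Bs e"
    and "\<forall>e\<in>{0..n}. \<not> coloop Bs e"
    and "mrank Bs {0..n} = r + 1"
    and "k \<le> r"
    and "i \<in> {0..n}" and "j \<in> {0..n}"
  shows "chow_eq {0..n} Bs
           (gamma {0..n} Bs i ^ k * delta {0..n} Bs j ^ (n - k - 1))
           (\<Sum>B\<in>{B. nbc_basis {0..n} Bs B \<and> card (IA {0..n} Bs B) = k + 1}.
              xmon (ext_nbc_biflag {0..n} Bs n r k B))"
proof -
  have m: "nat_matroid {0..n} Bs" using assms(1) by unfold_locales
  interpret l: loopless_nat_matroid "{0..n}" Bs k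
  proof (intro loopless_nat_matroid.intro loopless_nat_matroid_axioms.intro m)
    show "mcl {0..n} Bs {} = {}" by (rule nat_matroid.cl_empty_if_no_loops[OF m assms(2)])
    show "mcl {0..n} (dual_bases {0..n} Bs) {} = {}"
      by (rule nat_matroid.cl'_empty_if_no_coloops[OF m assms(3)])
    show "k < mrank Bs {0..n}" using assms(4,5) by simp
  qed
  have r: "r = l.left_len + k" using l.rk_E_eq assms(4) by simp
  \<comment> \<open>The ground set has \<open>n + 1\<close> elements, and the ranks
    \<open>r + 1\<close> and \<open>right_len + 1\<close> of the matroid and its dual add up to
    this.\<close>
  have n: "n = r + 1 + l.right_len" using l.rk_sum l.rk'_E_eq assms(4) by simp
  have v: "l.valid_choice {} {}" unfolding l.valid_choice_def by simp
  \<comment> \<open>The expansion starts with nothing chosen: the monomial is the empty product, and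
    every nbc basis with \<open>k + 1\<close> internally active elements extends the empty
    choice.\<close>
  have "l.ceq (gamma {0..n} Bs i ^ k * delta {0..n} Bs j ^ (l.left_len + l.right_len - (card ({} :: nat set) + card ({} :: nat set))) * xmon (l.chosen_biflats {} {}))
      (\<Sum>B\<in>l.nbc_extending {} {}. xmon (ext_nbc_biflag {0..n} Bs n r k B))"
    by (rule l.expansion[OF l.gamma_power_nbc_biflag[OF _ r n assms(6)] assms(6,7) v]) simp_all
  moreover have "l.left_len + l.right_len = n - k - 1" using r n by simp
  moreover have "l.chosen_biflats {} {} = {}" unfolding l.chosen_biflats_def by simp
  moreover have "l.nbc_extending {} {} = {B. nbc_basis {0..n} Bs B \<and> card (IA {0..n} Bs B) = k + 1}"
    unfolding l.nbc_extending_def by simp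
  ultimately show ?thesis by (simp add: xmon_def)
qed

end
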